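(* Let $\mathfrak g$ be $\mathfrak{so}(2n+1)$, $\mathfrak{sp}(2n)$ or $\mathfrak{so}(2n)$, and let $\check f_{ij}\in U_q(\mathfrak g_-)\otimes\mathcal A_j$ and $\delta^-_j\in\mathcal A_j$ be as defined in the context. Suppose that $i,j\in\{1,\dots,N\}$ satisfy $i\prec j$ and $i\leqslant j'$. Then $\check f_{ij}(\lambda)/\delta^-_j(\lambda)\neq 0$ at all $\lambda\in\mathfrak h^*$, i.e. the quotient $\check f_{ij}/\delta_j^-\in U_q(\mathfrak g_-)\otimes\mathcal A_j$, regarded as a $U_q(\mathfrak g_-)$-valued function on $\mathfrak h^*$, vanishes at no $\lambda\in\mathfrak h^*$.
   Context: **Quantum group.** $\mathfrak g$ is a complex simple Lie algebra $\mathfrak{so}(2n+1)$, $\mathfrak{sp}(2n)$ or $\mathfrak{so}(2n)$ of rank $n$ with Cartan subalgebra $\mathfrak h$; $N=2n+1,2n,2n$, respectively. $\{\varepsilon_i\}_{i=1}^n$ is an orthonormal basis of $\mathfrak h^*$ for the inner product $(\cdot,\cdot)$; the simple roots are $\alpha_i=\varepsilon_i-\varepsilon_{i+1}$ for $i<n$ and $\alpha_n=\varepsilon_n$, $2\varepsilon_n$, $\varepsilon_{n-1}+\varepsilon_n$, respectively. $\rho$ is the half-sum of positive roots. For $\mu\in\mathfrak h^*$, $h_\mu\in\mathfrak h$ is defined by $\beta(h_\mu)=(\mu,\beta)$ for all $\beta\in\mathfrak h^*$. $q\in\mathbb C^\times$ is not a root of unity, $\bar q=q^{-1}$, $q^z=e^{z\log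 q}$ for a fixed value of $\log q$, $[z]_q=\frac{q^z-q^{-z}}{q-q^{-1}}$. $U_q(\mathfrak g_-)$ is the $\mathbb C$-algebra generated by $f_1,\dots,f_n$ ($f_i$ being the negative Chevalley generator of root $-\alpha_i$, up to a nonzero scalar) subject to the $q$-Serre relations $\sum_{k=0}^{1-a_{lm}}(-1)^k\binom{1-a_{lm}}{k}_{q_l} f_l^{1-a_{lm}-k}f_mf_l^k=0$ for $l\ne m$, with $a_{lm}=\frac{2(\alpha_l,\alpha_m)}{(\alpha_l,\alpha_l)}$, $q_l=q^{(\alpha_l,\alpha_l)/2}$ and $q$-binomial coefficients $\binom{m}{k}_q=\frac{[m]_q!}{[k]_q![m-k]_q!}$. $U_q(\mathfrak h)$ is the commutative algebra generated by $q^{\pm h_{\alpha_i}}$. The Borel algebra $U_q(\mathfrak b_-)$ is identified as a free right $U_q(\mathfrak h)$-module with $U_q(\mathfrak g_-)\otimes U_q(\mathfrak h)$; an element $u=\sum_k b_kc_k$, $b_k\in U_q(\mathfrak g_-)$, $c_k\in U_q(\mathfrak h)$, is regarded as the function $\mathfrak h^*\to U_q(\mathfrak g_-)$, $\lambda\mapsto u(\lambda)=\sum_kb_kc_k(\lambda)$, where $q^{h_\mu}(\lambda)=q^{(\mu,\lambda)}$. **Poset.** $I=\{1,\dots,N\}$, $i'=N+1-i$, $*=\frac{N+1}2$, $\varepsilon_{i'}=-\varepsilon_i$ (so $\varepsilon_*=0$ for odd $N$). The partial order $\preccurlyeq$ on $I$ is the usual order $\leqslant$, except that for $\mathfrak{so}(2n)$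 the elements $n$ and $n'=n+1$ are incomparable. (Equivalently, $i\preccurlyeq j$ iff $w_j\in U_q(\mathfrak g_-)w_i$ in the natural representation with standard weight basis $w_1,\dots,w_N$.) Put $\mathrm s=n$ for $\mathfrak{so}(2n+1)$, $\mathfrak{sp}(2n)$ and $\mathrm s=n-1$ for $\mathfrak{so}(2n)$. A route is a $\prec$-ascending sequence $\vec m=(m_1,\dots,m_k)$; $i\prec\vec m\prec j$ means $i\prec m_1$, $m_k\prec j$. **Elements $f_{ij}\in U_q(\mathfrak g_-)$.** Let $[x,y]_a=xy-ayx$. For $i<j\leqslant *$: $f_{ij}=[f_{j-1},\dots[f_{i+1},f_i]_{\bar q}\dots]_{\bar q}$ and $f_{j'i'}=[\dots[f_i,f_{i+1}]_{\bar q},\dots,f_{j-1}]_{\bar q}$, with $f_{i,i+1}=f_i=f_{i'-1,i'}$. Moreover: - $\mathfrak{so}(2n+1)$: $f_{ij'}=q^{\delta_{ij}}[f_{*,j'},f_{i,*}]_{\bar q^{\delta_{ij}}}$ for $i,j\leqslant n$ (in particular $f_{nn'}=(q-1)f_n^2$). - $\mathfrak{sp}(2n)$: $f_{nn'}=[2]_qf_n$; $f_{in'}=[f_n,f_{in}]_{\bar q^2}$ and $f_{ni'}=[f_{n'i'},f_n]_{\bar q^2}$ for $i<n$; $f_{ij'}=q^{\delta_{ij}}[f_{nj'},f_{in}]_{\bar q^{1+\delta_{ij}}}$ for $i,j<n$. - $\mathfrak{so}(2n)$: $f_{nn'}=0$; $f_{n-1,n'}=f_{n,n'+1}=f_n$;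 $f_{in'}=[f_n,f_{i,n-1}]_{\bar q}$ and $f_{ni'}=[f_{n'+1,i'},f_n]_{\bar q}$ for $i<n-1$; $f_{ji'}=q^{\delta_{ij}}[f_{ni'},f_{jn}]_{\bar q^{1+\delta_{ij}}}$ for $i,j<n$. Finally $f_{ii}=1$ and $f_{ij}=0$ for $i>j$ ($\delta_{ij}$ is the Kronecker symbol). **Elements $\hat f_{ij}$, $\check f_{ij}$.** Let $\rho_i=(\rho,\varepsilon_i)$ and $\eta_{ij}=h_{\varepsilon_i}-h_{\varepsilon_j}+\rho_i-\rho_j-\frac12\|\varepsilon_i-\varepsilon_j\|^2$. For fixed $j$ and $l\prec j$ put $y_l=q^{-2\eta_{lj}}\in U_q(\mathfrak h)$ and $A_l=A_l^j=\frac{q-\bar q}{y_l-1}$. $\mathcal A_j\subset U_q(\mathfrak h)$ is the subalgebra generated by $y_l^{\pm1}$, $l\prec j$; for $\mathfrak{so}(2n+1)$ and $j>*$ one writes $y_{j'}^{1/2}=qy_*\in\mathcal A_j$ (indeed $(qy_* )^2=y_{j'}$). For $i\prec j$, $\hat f_{ij}=\sum_{i\prec\vec m\prec j} f_{i,m_1}f_{m_1,m_2}\cdots f_{m_k,j}\,A_iA_{m_1}\cdots A_{m_k}$, the sum being over all routes $\vec m=(m_1,\dots,m_k)$ including the empty one (which contributes $f_{ij}A_i$). The natural regularization is $\check f_{ij}=\hat f_{ij}\prod_{l\prec j}A_l^{-1}\in U_q(\mathfrak g_-)\otimes\mathcal A_j$, the product being over all $l\in I$ with $l\prec j$. **Element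 $\delta_j^-$.** For symplectic $\mathfrak g$, $\delta^-_j=1$ for all $j$. For orthogonal $\mathfrak g$, $\delta_j^-=1$ if $j<\mathrm s'$; if $j\geqslant\mathrm s'$, then $\delta_j^-=\frac{y_{j'}-1}{q-\bar q}$ for $\mathfrak{so}(2n)$ and $\delta_j^-=\frac{y_{j'}^{1/2}+1}{q+1}$ for $\mathfrak{so}(2n+1)$. For $i\leqslant j'$ the element $\check f_{ij}$ is divisible by $\delta^-_j$ in $U_q(\mathfrak g_-)\otimes\mathcal A_j$, and $\check f_{ij}/\delta_j^-$ denotes the unique quotient.
   Formalization: The product of the A_l^{-1} defining f̌_ij runs over i ≼ l ≺ j instead of all l ≺ j; with the full range, for i ≥ 2 the uncancelled factor A_1^{-1} makes the quotient vanish where y_1 = 1 (e.g. sp(4), i=2, j=3). *)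

theory Defs
  imports Complex_Main "HOL-Library.Poly_Mapping" "HOL-Algebra.QuotRing"
begin

section \<open>Root data of the classical series\<close>

text \<open>so(2n+1), sp(2n), so(2n)\<close>

datatype series = SO_odd | SP | SO_even

text \<open>The algebra is simple; so(4) is not.\<close>

definition simple_rank :: "series \<Rightarrow> nat \<Rightarrow> bool" where
  "simple_rank g n \<longleftrightarrow> (case g of SO_odd \<Rightarrow> n \<ge> 1 | SP \<Rightarrow> n \<ge> 1 | SO_even \<Rightarrow> n \<ge> 3)"

definition dimN :: "series \<Rightarrow> nat \<Rightarrow> nat" where
  "dimN g n = (case g of SO_odd \<Rightarrow> 2 * n + 1 | SP \<Rightarrow> 2 * n | SO_even \<Rightarrow> 2 * n)"

definition prime_ix :: "series \<Rightarrow> nat \<Rightarrow> nat \<Rightarrow> nat" where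
  "prime_ix g n i = dimN g n + 1 - i"

text \<open>
  Integral weights are given by their integer coordinates and elements of \<open>\<hh>\<^sup>*\<close> by their complex
  coordinates in the orthonormal basis \<open>\<epsilon>\<^sub>1, \<dots>, \<epsilon>\<^sub>n\<close>.  Both are functions on \<^typ>\<open>nat\<close> of which only
  the values at \<open>1, \<dots>, n\<close> are ever used.
\<close>

type_synonym weight = "nat \<Rightarrow> int"
type_synonym dual = "nat \<Rightarrow> complex"

definition eps :: "series \<Rightarrow> nat \<Rightarrow> nat \<Rightarrow> weight" where
  "eps g n i = (\<lambda>k. if k \<notin> {1..n} then 0
                    else if k = i then 1
                    else if k = prime_ix g n i then -1 else 0)"

definition ip :: "nat \<Rightarrow> weight \<Rightarrow> weight \<Rightarrow> int" where
  "ip n \<mu> \<nu> = (\<Sum>k = 1..n. \<mu> k * \<nu> k)"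

text \<open>The function \<open>h\<^sub>\<mu>\<close> on \<open>\<hh>\<^sup>*\<close>, that is \<open>\<lambda> \<mapsto> (\<mu>, \<lambda>)\<close>\<close>

definition h_fun :: "nat \<Rightarrow> weight \<Rightarrow> dual \<Rightarrow> complex" where
  "h_fun n \<mu> lam = (\<Sum>k = 1..n. of_int (\<mu> k) * lam k)"

definition alpha :: "series \<Rightarrow> nat \<Rightarrow> nat \<Rightarrow> weight" where
  "alpha g n i =
     (if i < n then (\<lambda>k. eps g n i k - eps g n (i + 1) k)
      else case g of
          SO_odd \<Rightarrow> eps g n n
        | SP \<Rightarrow> (\<lambda>k. 2 * eps g n n k)
        | SO_even \<Rightarrow> (\<lambda>k. eps g n (n - 1) k + eps g n n k))"

definition pos_roots :: "series \<Rightarrow> nat \<Rightarrow> weight set" where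
  "pos_roots g n =
     {(\<lambda>k. eps g n i k - eps g n j k) | i j. 1 \<le> i \<and> i < j \<and> j \<le> n} \<union>
     {(\<lambda>k. eps g n i k + eps g n j k) | i j. 1 \<le> i \<and> i < j \<and> j \<le> n} \<union>
     (case g of
        SO_odd \<Rightarrow> {eps g n i | i. 1 \<le> i \<and> i \<le> n}
      | SP \<Rightarrow> {(\<lambda>k. 2 * eps g n i k) | i. 1 \<le> i \<and> i \<le> n}
      | SO_even \<Rightarrow> {})"

definition rho :: "series \<Rightarrow> nat \<Rightarrow> dual" where
  "rho g n = (\<lambda>k. (\<Sum>\<beta>\<in>pos_roots g n. of_int (\<beta> k)) / 2)"

definition rho_ix :: "series \<Rightarrow> nat \<Rightarrow> nat \<Rightarrow> complex" where
  "rho_ix g n i = h_fun n (eps g n i) (rho g n)"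

text \<open>The strict and the weak version of the order on \<open>I = {1..N}\<close>\<close>

definition prec :: "series \<Rightarrow> nat \<Rightarrow> nat \<Rightarrow> nat \<Rightarrow> bool" where
  "prec g n i j \<longleftrightarrow> i < j \<and> \<not> (g = SO_even \<and> i = n \<and> j = n + 1)"

definition preceq :: "series \<Rightarrow> nat \<Rightarrow> nat \<Rightarrow> nat \<Rightarrow> bool" where
  "preceq g n i j \<longleftrightarrow> i = j \<or> prec g n i j"


section \<open>The free algebra and \<open>U\<^sub>q(\<gg>\<^sub>-)\<close>\<close>

text \<open>
  Words form a monoid under concatenation, written additively so that \<^typ>\<open>'a \<Rightarrow>\<^sub>0 complex\<close> becomes
  the monoid algebra, here the free algebra.
\<close>

datatype fword = FWord (letters: "nat list")

instantiation fword :: monoid_add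
begin
definition zero_fword :: fword where "zero_fword = FWord []"
definition plus_fword :: "fword \<Rightarrow> fword \<Rightarrow> fword" where
  "plus_fword u v = FWord (letters u @ letters v)"
instance by standard (simp_all add: zero_fword_def plus_fword_def)
end

type_synonym freealg = "fword \<Rightarrow>\<^sub>0 complex"

definition scal :: "complex \<Rightarrow> freealg" where
  "scal c = Poly_Mapping.single 0 c"

definition gen :: "nat \<Rightarrow> freealg" where
  "gen i = Poly_Mapping.single (FWord [i]) 1"

definition free_ring :: "nat \<Rightarrow> freealg ring" where
  "free_ring n = \<lparr>carrier = {x. \<forall>w\<in>Poly_Mapping.keys x. set (letters w) \<subseteq> {1..n}},
                  monoid.mult = (*), one = 1, zero = 0, add = (+)\<rparr>"

lemma ring_free_ring: "ring (free_ring n)"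
proof -
  have kt: "Poly_Mapping.keys (a * b) \<subseteq> {u + v | u v. u \<in> Poly_Mapping.keys a \<and> v \<in> Poly_Mapping.keys b}"
    for a b :: freealg
    by (rule keys_mult)
  show ?thesis
  proof (intro ringI abelian_groupI monoidI)
    fix x assume "x \<in> carrier (free_ring n)"
    then show "\<exists>z\<in>carrier (free_ring n). z \<oplus>\<^bsub>free_ring n\<^esub> x = \<zero>\<^bsub>free_ring n\<^esub>"
      by (intro bexI[of _ "- x"]) (auto simp: free_ring_def)
  next
    fix a b assume ab: "a \<in> carrier (free_ring n)" "b \<in> carrier (free_ring n)"
    show "a \<otimes>\<^bsub>free_ring n\<^esub> b \<in> carrier (free_ring n)"
      using ab kt[of a b] by (fastforce simp: free_ring_def plus_fword_def)
    show "a \<oplus>\<^bsub>free_ring n\<^esub> b \<in> carrier (free_ring n)"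
      using ab Poly_Mapping.keys_add[of a b] by (auto simp: free_ring_def)
  qed (auto simp: free_ring_def algebra_simps zero_fword_def)
qed

text \<open>\<open>L\<close> is the fixed value of \<open>log q\<close>.\<close>

definition qpow :: "complex \<Rightarrow> complex \<Rightarrow> complex" where
  "qpow L z = exp (z * L)"

abbreviation qq :: "complex \<Rightarrow> complex" where
  "qq L \<equiv> qpow L 1"

abbreviation qbar :: "complex \<Rightarrow> complex" where
  "qbar L \<equiv> inverse (qq L)"

definition qint :: "complex \<Rightarrow> nat \<Rightarrow> complex" where
  "qint p m = (p ^ m - inverse p ^ m) / (p - inverse p)"

definition qfact :: "complex \<Rightarrow> nat \<Rightarrow> complex" where
  "qfact p m = (\<Prod>k = 1..m. qint p k)"

definition qbinom :: "complex \<Rightarrow> nat \<Rightarrow> nat \<Rightarrow> complex" where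
  "qbinom p m k = qfact p m / (qfact p k * qfact p (m - k))"

text \<open>The division is exact.\<close>

definition cartan :: "series \<Rightarrow> nat \<Rightarrow> nat \<Rightarrow> nat \<Rightarrow> int" where
  "cartan g n l m = 2 * ip n (alpha g n l) (alpha g n m) div ip n (alpha g n l) (alpha g n l)"

definition q_ix :: "series \<Rightarrow> nat \<Rightarrow> complex \<Rightarrow> nat \<Rightarrow> complex" where
  "q_ix g n L l = qpow L (of_int (ip n (alpha g n l) (alpha g n l)) / 2)"

definition serre :: "series \<Rightarrow> nat \<Rightarrow> complex \<Rightarrow> nat \<Rightarrow> nat \<Rightarrow> freealg" where
  "serre g n L l m =
     (let r = nat (1 - cartan g n l m) in
      \<Sum>k = 0..r. scal ((-1) ^ k * qbinom (q_ix g n L l) r k) * gen l ^ (r - k) * gen m * gen l ^ k)"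

definition serre_ideal :: "series \<Rightarrow> nat \<Rightarrow> complex \<Rightarrow> freealg set" where
  "serre_ideal g n L =
     Idl\<^bsub>free_ring n\<^esub> {serre g n L l m | l m. l \<in> {1..n} \<and> m \<in> {1..n} \<and> l \<noteq> m}"

definition Uq :: "series \<Rightarrow> nat \<Rightarrow> complex \<Rightarrow> freealg set ring" where
  "Uq g n L = free_ring n Quot serre_ideal g n L"

definition cls :: "series \<Rightarrow> nat \<Rightarrow> complex \<Rightarrow> freealg \<Rightarrow> freealg set" where
  "cls g n L x = serre_ideal g n L +>\<^bsub>free_ring n\<^esub> x"

definition uscale :: "series \<Rightarrow> nat \<Rightarrow> complex \<Rightarrow> complex \<Rightarrow> freealg set \<Rightarrow> freealg set" where
  "uscale g n L c X = cls g n L (scal c) \<otimes>\<^bsub>Uq g n L\<^esub> X"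


section \<open>The elements \<open>f\<^sub>i\<^sub>j\<close>\<close>

text \<open>
  They are written down in the free algebra, by the same expressions in the generators; their
  classes are the elements of \<open>U\<^sub>q(\<gg>\<^sub>-)\<close>.
\<close>

definition qcomm :: "complex \<Rightarrow> freealg \<Rightarrow> freealg \<Rightarrow> freealg" where
  "qcomm a x y = x * y - scal a * y * x"

text \<open>\<open>chain_lo L i d = [f\<^sub>i\<^sub>+\<^sub>d, \<dots> [f\<^sub>i\<^sub>+\<^sub>1, f\<^sub>i] \<dots> ]\<close> and \<open>chain_up L i d = [ \<dots> [f\<^sub>i, f\<^sub>i\<^sub>+\<^sub>1], \<dots>, f\<^sub>i\<^sub>+\<^sub>d]\<close>\<close>

primrec chain_lo :: "complex \<Rightarrow> nat \<Rightarrow> nat \<Rightarrow> freealg" where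
  "chain_lo L i 0 = gen i"
| "chain_lo L i (Suc d) = qcomm (qbar L) (gen (i + Suc d)) (chain_lo L i d)"

primrec chain_up :: "complex \<Rightarrow> nat \<Rightarrow> nat \<Rightarrow> freealg" where
  "chain_up L i 0 = gen i"
| "chain_up L i (Suc d) = qcomm (qbar L) (chain_up L i d) (gen (i + Suc d))"

text \<open>For \<open>i < j \<le> *\<close>: \<open>f_lo L i j\<close> is \<open>f\<^sub>i\<^sub>j\<close> and \<open>f_up L i j\<close> is \<open>f\<close> with the indices \<open>j' i'\<close>.\<close>

definition f_lo :: "complex \<Rightarrow> nat \<Rightarrow> nat \<Rightarrow> freealg" where
  "f_lo L i j = chain_lo L i (j - i - 1)"

definition f_up :: "complex \<Rightarrow> nat \<Rightarrow> nat \<Rightarrow> freealg" where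
  "f_up L i j = chain_up L i (j - i - 1)"

text \<open>
  For \<open>i, j \<le> n\<close>, each of \<open>fB\<close>, \<open>fC\<close>, \<open>fD\<close> at \<open>i j\<close> is \<open>f\<close> with the indices \<open>i j'\<close>; note
  that \<open>(n - 1)' = n' + 1\<close>.
\<close>

definition fB :: "nat \<Rightarrow> complex \<Rightarrow> nat \<Rightarrow> nat \<Rightarrow> freealg" where
  "fB n L i j =
     (let \<delta> = of_bool (i = j) in
      scal (qq L ^ \<delta>) * qcomm (qbar L ^ \<delta>) (f_up L j (n + 1)) (f_lo L i (n + 1)))"

definition fC_left :: "nat \<Rightarrow> complex \<Rightarrow> nat \<Rightarrow> freealg" where
  "fC_left n L i = qcomm (qbar L ^ 2) (gen n) (f_lo L i n)"

definition fC_right :: "nat \<Rightarrow> complex \<Rightarrow> nat \<Rightarrow> freealg" where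
  "fC_right n L j = qcomm (qbar L ^ 2) (f_up L j n) (gen n)"

definition fC :: "nat \<Rightarrow> complex \<Rightarrow> nat \<Rightarrow> nat \<Rightarrow> freealg" where
  "fC n L i j =
     (let \<delta> = of_bool (i = j) in
      if i = n \<and> j = n then scal (qint (qq L) 2) * gen n
      else if j = n then fC_left n L i
      else if i = n then fC_right n L j
      else scal (qq L ^ \<delta>) * qcomm (qbar L ^ (1 + \<delta>)) (fC_right n L j) (f_lo L i n))"

definition fD_left :: "nat \<Rightarrow> complex \<Rightarrow> nat \<Rightarrow> freealg" where
  "fD_left n L i =
     (if i = n - 1 then gen n else qcomm (qbar L) (gen n) (f_lo L i (n - 1)))"

definition fD_right :: "nat \<Rightarrow> complex \<Rightarrow> nat \<Rightarrow> freealg" where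
  "fD_right n L j =
     (if j = n - 1 then gen n else qcomm (qbar L) (f_up L j (n - 1)) (gen n))"

definition fD :: "nat \<Rightarrow> complex \<Rightarrow> nat \<Rightarrow> nat \<Rightarrow> freealg" where
  "fD n L i j =
     (let \<delta> = of_bool (i = j) in
      if i = n \<and> j = n then 0
      else if j = n then fD_left n L i
      else if i = n then fD_right n L j
      else scal (qq L ^ \<delta>) * qcomm (qbar L ^ (1 + \<delta>)) (fD_right n L j) (f_lo L i n))"

text \<open>Recall \<open>* = (N + 1) / 2\<close>.\<close>

definition f_el :: "series \<Rightarrow> nat \<Rightarrow> complex \<Rightarrow> nat \<Rightarrow> nat \<Rightarrow> freealg" where
  "f_el g n L i j =
     (if i = j then 1
      else if i > j then 0
      else if 2 * j \<le> dimN g n + 1 then f_lo L i j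
      else if 2 * i \<ge> dimN g n + 1 then f_up L (prime_ix g n j) (prime_ix g n i)
      else (case g of SO_odd \<Rightarrow> fB | SP \<Rightarrow> fC | SO_even \<Rightarrow> fD) n L i (prime_ix g n j))"


section \<open>Functions on \<open>\<hh>\<^sup>*\<close>\<close>

definition eta :: "series \<Rightarrow> nat \<Rightarrow> nat \<Rightarrow> nat \<Rightarrow> dual \<Rightarrow> complex" where
  "eta g n i j lam =
     (let d = (\<lambda>k. eps g n i k - eps g n j k) in
      h_fun n (eps g n i) lam - h_fun n (eps g n j) lam + rho_ix g n i - rho_ix g n j - of_int (ip n d d) / 2)"

definition y_fun :: "series \<Rightarrow> nat \<Rightarrow> complex \<Rightarrow> nat \<Rightarrow> nat \<Rightarrow> dual \<Rightarrow> complex" where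
  "y_fun g n L j l lam = qpow L (- 2 * eta g n l j lam)"

definition A_fun :: "series \<Rightarrow> nat \<Rightarrow> complex \<Rightarrow> nat \<Rightarrow> nat \<Rightarrow> dual \<Rightarrow> complex" where
  "A_fun g n L j l lam = (qq L - qbar L) / (y_fun g n L j l lam - 1)"

text \<open>\<open>A\<^sup>-\<^sup>1\<close> as an element of \<open>U\<^sub>q(\<hh>)\<close>: a function without poles\<close>

definition A_inv :: "series \<Rightarrow> nat \<Rightarrow> complex \<Rightarrow> nat \<Rightarrow> nat \<Rightarrow> dual \<Rightarrow> complex" where
  "A_inv g n L j l lam = (y_fun g n L j l lam - 1) / (qq L - qbar L)"

text \<open>
  The subalgebra \<open>\<A>\<^sub>j\<close> of \<open>U\<^sub>q(\<hh>)\<close>, whose elements are regarded as functions on \<open>\<hh>\<^sup>*\<close>.  This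
  loses nothing: as \<open>q\<close> is not a root of unity, the functions given by distinct monomials
  \<open>q\<close> to the \<open>h\<^sub>\<mu>\<close> are linearly independent.
\<close>

inductive_set Aalg :: "series \<Rightarrow> nat \<Rightarrow> complex \<Rightarrow> nat \<Rightarrow> (dual \<Rightarrow> complex) set"
  for g n L j where
  const: "(\<lambda>_. c) \<in> Aalg g n L j"
| gen: "1 \<le> l \<Longrightarrow> prec g n l j \<Longrightarrow> y_fun g n L j l \<in> Aalg g n L j"
| gen_inv: "1 \<le> l \<Longrightarrow> prec g n l j \<Longrightarrow> (\<lambda>lam. inverse (y_fun g n L j l lam)) \<in> Aalg g n L j"
| add: "a \<in> Aalg g n L j \<Longrightarrow> b \<in> Aalg g n L j \<Longrightarrow> (\<lambda>lam. a lam + b lam) \<in> Aalg g n L j"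
| mult: "a \<in> Aalg g n L j \<Longrightarrow> b \<in> Aalg g n L j \<Longrightarrow> (\<lambda>lam. a lam * b lam) \<in> Aalg g n L j"

text \<open>\<open>U\<^sub>q(\<gg>\<^sub>-) \<otimes> \<A>\<^sub>j\<close>: the functions \<open>\<lambda> \<mapsto> \<Sum>\<^sub>k b\<^sub>k c\<^sub>k(\<lambda>)\<close>\<close>

definition UA :: "series \<Rightarrow> nat \<Rightarrow> complex \<Rightarrow> nat \<Rightarrow> (dual \<Rightarrow> freealg set) set" where
  "UA g n L j =
     {(\<lambda>lam. \<Oplus>\<^bsub>Uq g n L\<^esub>k\<in>{..<K}. uscale g n L (c k lam) (b k)) | (K::nat) b c.
        \<forall>k<K. b k \<in> carrier (Uq g n L) \<and> c k \<in> Aalg g n L j}"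


section \<open>The elements with a hat and with a check\<close>

definition routes :: "series \<Rightarrow> nat \<Rightarrow> nat \<Rightarrow> nat \<Rightarrow> nat list set" where
  "routes g n i j = {m. sorted_wrt (prec g n) (i # m @ [j])}"

definition route_prod :: "series \<Rightarrow> nat \<Rightarrow> complex \<Rightarrow> nat \<Rightarrow> nat list \<Rightarrow> nat \<Rightarrow> freealg" where
  "route_prod g n L i m j = prod_list (map2 (f_el g n L) (i # m) (m @ [j]))"

text \<open>
  As with the \<open>f\<^sub>i\<^sub>j\<close>, first the expressions in the free algebra.  \<open>hat_rep\<close> is to be read only
  where no \<open>y\<^sub>l\<close> with \<open>i \<preceq> l \<prec> j\<close> equals 1; elsewhere there are poles.
\<close>

definition hat_rep :: "series \<Rightarrow> nat \<Rightarrow> complex \<Rightarrow> nat \<Rightarrow> nat \<Rightarrow> dual \<Rightarrow> freealg" where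
  "hat_rep g n L i j lam =
     (\<Sum>m\<in>routes g n i j. scal (\<Prod>l\<leftarrow>i # m. A_fun g n L j l lam) * route_prod g n L i m j)"

definition f_hat :: "series \<Rightarrow> nat \<Rightarrow> complex \<Rightarrow> nat \<Rightarrow> nat \<Rightarrow> dual \<Rightarrow> freealg set" where
  "f_hat g n L i j lam = cls g n L (hat_rep g n L i j lam)"

text \<open>
  The product of \<open>hat_rep\<close> and all \<open>A\<^sub>l\<^sup>-\<^sup>1\<close>, \<open>l \<in> S\<close>, with the factors \<open>A\<^sub>l A\<^sub>l\<^sup>-\<^sup>1\<close> cancelled
  in each term.  This makes it a function on all of \<open>\<hh>\<^sup>*\<close>.
\<close>

definition reg_rep :: "nat set \<Rightarrow> series \<Rightarrow> nat \<Rightarrow> complex \<Rightarrow> nat \<Rightarrow> nat \<Rightarrow> dual \<Rightarrow> freealg" where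
  "reg_rep S g n L i j lam =
     (\<Sum>m\<in>routes g n i j. scal (\<Prod>l\<in>S - set (i # m). A_inv g n L j l lam) * route_prod g n L i m j)"

lemma route_range:
  assumes "prec g n i j" and "m \<in> routes g n i j" and "l \<in> set (i # m)"
  shows "preceq g n i l" and "prec g n l j"
  using assms by (auto simp: routes_def preceq_def sorted_wrt_append)

lemma route_distinct:
  assumes "m \<in> routes g n i j"
  shows "distinct (i # m)"
proof -
  have "sorted_wrt (prec g n) (i # m)"
    using assms by (auto simp: routes_def sorted_wrt_append)
  then have "sorted_wrt (<) (i # m)"
    by (rule sorted_wrt_mono_rel[rotated]) (simp add: prec_def)
  then show ?thesis
    by (simp only: strict_sorted_iff)
qed

lemma scal_mult: "scal a * scal b = scal (a * b)"
  by (simp add: scal_def mult_single)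

lemma reg_rep_eq:
  assumes "prec g n i j" and "finite S" and "{l. preceq g n i l \<and> prec g n l j} \<subseteq> S"
    and "\<forall>l\<in>S. y_fun g n L j l lam \<noteq> 1" and "qq L \<noteq> qbar L"
  shows "reg_rep S g n L i j lam = scal (\<Prod>l\<in>S. inverse (A_fun g n L j l lam)) * hat_rep g n L i j lam"
proof -
  have inv: "A_inv g n L j l lam = inverse (A_fun g n L j l lam)" for l
    by (simp add: A_inv_def A_fun_def)
  have nz: "A_fun g n L j l lam \<noteq> 0" if "l \<in> S" for l
    using that assms(4,5) by (simp add: A_fun_def)
  have "(\<Prod>l\<in>S - set (i # m). A_inv g n L j l lam) =
        (\<Prod>l\<in>S. inverse (A_fun g n L j l lam)) * (\<Prod>l\<leftarrow>i # m. A_fun g n L j l lam)"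
    if m: "m \<in> routes g n i j" for m
  proof -
    let ?T = "set (i # m)"
    have T: "?T \<subseteq> S"
      using route_range[OF assms(1) m] assms(3) by blast
    have list: "(\<Prod>l\<leftarrow>i # m. A_fun g n L j l lam) = (\<Prod>l\<in>?T. A_fun g n L j l lam)"
      by (rule prod.distinct_set_conv_list[OF route_distinct[OF m], symmetric])
    have "(\<Prod>l\<in>S. inverse (A_fun g n L j l lam)) =
          (\<Prod>l\<in>S - ?T. inverse (A_fun g n L j l lam)) * (\<Prod>l\<in>?T. inverse (A_fun g n L j l lam))"
      by (rule prod.subset_diff[OF T assms(2)])
    moreover have "(\<Prod>l\<in>?T. inverse (A_fun g n L j l lam)) * (\<Prod>l\<in>?T. A_fun g n L j l lam) = 1"
      unfolding prod.distrib[symmetric] using T nz by (intro prod.neutral) (auto simp del: set_simps)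
    ultimately show ?thesis
      unfolding list inv by (simp add: mult.assoc del: set_simps)
  qed
  then show ?thesis
    unfolding reg_rep_def hat_rep_def sum_distrib_left
    by (intro sum.cong) (simp_all add: scal_mult mult.assoc[symmetric])
qed

lemma reg_rep_vanishes:
  assumes "prec g n i j" and "finite S" and "l \<in> S" and "prec g n l i" and "y_fun g n L j l lam = 1"
  shows "reg_rep S g n L i j lam = 0"
proof -
  have "(\<Prod>l\<in>S - set (i # m). A_inv g n L j l lam) = 0" if m: "m \<in> routes g n i j" for m
  proof (rule prod_zero)
    have "l \<notin> set (i # m)"
      using route_range(1)[OF assms(1) m, of l] assms(4) by (auto simp: preceq_def prec_def)
    then show "\<exists>l\<in>S - set (i # m). A_inv g n L j l lam = 0"
      using assms(3,5) by (intro bexI[of _ l]) (auto simp: A_inv_def)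
  qed (use assms(2) in simp)
  then show ?thesis
    unfolding reg_rep_def by (intro sum.neutral) (auto simp: scal_def simp del: set_simps)
qed

text \<open>
  The factors \<open>A\<^sub>l\<^sup>-\<^sup>1\<close> are those with \<open>i \<preceq> l \<prec> j\<close>, which are the \<open>l\<close> whose \<open>A\<^sub>l\<close> occurs
  in \<open>f_hat\<close>.  A factor with \<open>l \<prec> i\<close> would cancel nothing and, by \<open>reg_rep_vanishes\<close>, make the
  element vanish wherever \<open>y\<^sub>l\<close> equals 1.  For \<open>i = 1\<close> these are all \<open>l \<prec> j\<close>.
\<close>

definition f_check :: "series \<Rightarrow> nat \<Rightarrow> complex \<Rightarrow> nat \<Rightarrow> nat \<Rightarrow> dual \<Rightarrow> freealg set" where
  "f_check g n L i j lam = cls g n L (reg_rep {l. preceq g n i l \<and> prec g n l j} g n L i j lam)"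

text \<open>\<open>s'\<close>\<close>

definition s_prime :: "series \<Rightarrow> nat \<Rightarrow> nat" where
  "s_prime g n = prime_ix g n (case g of SO_odd \<Rightarrow> n | SP \<Rightarrow> n | SO_even \<Rightarrow> n - 1)"

text \<open>In \<open>SO_odd\<close>, the square root of \<open>y\<close> at \<open>j'\<close> is \<open>q y\<close> at \<open>* = n + 1\<close>.\<close>

definition delta :: "series \<Rightarrow> nat \<Rightarrow> complex \<Rightarrow> nat \<Rightarrow> dual \<Rightarrow> complex" where
  "delta g n L j lam =
     (case g of
        SP \<Rightarrow> 1
      | SO_odd \<Rightarrow> if j < s_prime g n then 1
                  else (qq L * y_fun g n L j (n + 1) lam + 1) / (qq L + 1)
      | SO_even \<Rightarrow> if j < s_prime g n then 1
                   else (y_fun g n L j (prime_ix g n j) lam - 1) / (qq L - qbar L))"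

definition f_check_quot :: "series \<Rightarrow> nat \<Rightarrow> complex \<Rightarrow> nat \<Rightarrow> nat \<Rightarrow> dual \<Rightarrow> freealg set" where
  "f_check_quot g n L i j =
     (THE u. u \<in> UA g n L j \<and> (\<forall>lam. uscale g n L (delta g n L j lam) (u lam) = f_check g n L i j lam))"

end

theory Submission
  imports Defs "HOL-Library.Multiset"
begin

text \<open>
  Fix \<open>j\<close> and put \<open>k = j'\<close> and \<open>B\<^sub>l = A\<^sub>l\<^sup>-\<^sup>1 = (y\<^sub>l - 1) / (q - q\<^sup>-\<^sup>1)\<close>.  The element with a check is a sum
  over routes in which every level \<open>l\<close> is either visited or skipped at the price of a factor \<open>B\<^sub>l\<close>; this is
  the recursion \<open>path_sum\<close>.  The quotient by \<open>\<delta>\<^sub>j\<close> is given by a definite description, so there is something to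
  prove even before its values are considered: that it exists and that it is unique.
  
  No value is zero.  The algebra \<open>U\<^sub>q(\<gg>\<^sub>-)\<close> maps to a quantum torus: send \<open>f\<^sub>l\<close> to \<open>t\<^sub>l\<close> with
  \<open>t\<^sub>l t\<^sub>m = q\<^bsup>(\<alpha>\<^sub>l, \<alpha>\<^sub>m)\<^esup> t\<^sub>m t\<^sub>l\<close> for \<open>l > m\<close>.  This respects the Serre relations because the polynomial with
  the alternating \<open>q\<close>-binomial coefficients vanishes at \<open>q\<^sub>l\<close> to the power \<open>a\<^sub>l\<^sub>m\<close>.  All \<open>f\<^sub>a\<^sub>b\<close> with
  \<open>a < b - 1\<close> in the first half go to 0, so only those routes survive that climb to the middle in unit steps.
  On the second half nothing vanishes, but the sum over the routes factors: the level \<open>l'\<close> contributes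
  \<open>q\<^sup>-\<^sup>1 + (1 - q\<^sup>-\<^sup>2) B\<^sub>l\<^sub>'\<close>, which is \<open>q\<^sup>-\<^sup>1 y\<^sub>l\<^sub>'\<close>, and the steps across the middle contribute \<open>\<delta>\<^sub>j\<close> up to a scalar.  So the
  value of the element with a check is \<open>\<delta>\<^sub>j\<close> times a function without zeros (\<open>torus_eval_f_check\<close>).  The zeros of
  \<open>\<delta>\<^sub>j\<close> are nowhere dense, hence \<open>\<delta>\<^sub>j\<close> can be cancelled (\<open>delta_cancel\<close>), and the quotient has a nonzero image
  everywhere.  Cancellation under an arbitrary linear functional also gives uniqueness.  For \<open>j\<close> up to the middle, unit
  steps are the whole route and \<open>\<delta>\<^sub>j = 1\<close>.
  
  The quotient exists.  This is clear if \<open>\<delta>\<^sub>j = 1\<close>, so let the algebra be orthogonal and \<open>j\<close> beyond the middle.  A route either skips \<open>k\<close>, and then has the factor \<open>B\<^sub>k\<close>, which \<open>\<delta>\<^sub>j\<close> divides, or it visits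
  \<open>k\<close>; so only routes from \<open>k\<close> to \<open>k'\<close> matter.  Sum over them by eliminating the pairs of levels \<open>l, l'\<close> from the
  middle outwards.  As \<open>y\<^sub>l y\<^sub>l\<^sub>' = y\<^sub>k\<close>, the product \<open>B\<^sub>l B\<^sub>l\<^sub>'\<close> equals \<open>- (B\<^sub>l + B\<^sub>l\<^sub>') / (q - q\<^sup>-\<^sup>1)\<close> modulo \<open>\<delta>\<^sub>j\<close>, so
  that one step turns a matrix \<open>G\<^sub>a\<^sub>b\<close> of elements into a combination of the two matrices
  \<open>- G\<^sub>a\<^sub>b / (q - q\<^sup>-\<^sup>1) + f\<^sub>a\<^sub>l G\<^sub>l\<^sub>b\<close> and \<open>- G\<^sub>a\<^sub>b / (q - q\<^sup>-\<^sup>1) + G\<^sub>a\<^sub>l f\<^sub>l\<^sub>'\<^sub>b\<^sub>'\<close>.  Modulo \<open>\<delta>\<^sub>j\<close> the matrices at the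
  start are \<open>q\<close>-commutators of two chains of root vectors.  They satisfy a linear system of commutation relations
  with the generators, \<open>half_rel\<close> and its mirror image, and have the last diagonal entry 0.  Both properties
  are inherited by the two new matrices (\<open>half_rel_left\<close>, \<open>half_rel_right\<close>, \<open>diagonal_vanishes\<close>).  When only
  \<open>k\<close> is left, the sum is a diagonal entry, hence 0 modulo \<open>\<delta>\<^sub>j\<close>.
\<close>

section \<open>Evaluation in a quantum torus\<close>

lemma poly_mapping_sum_single: "x = (\<Sum>w\<in>Poly_Mapping.keys x. Poly_Mapping.single w (Poly_Mapping.lookup x w))"
  by (rule poly_mapping_eqI)
    (simp add: lookup_sum lookup_single when_def in_keys_iff)

text \<open>
  If \<open>t a b\<close> is the scalar by which \<open>t\<^sub>a t\<^sub>b\<close> differs from the sorted product, then \<open>twist\<close> is the scalar by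
  which the product of the sorted monomials of multidegrees \<open>\<mu>\<close> and \<open>\<nu>\<close> differs from that of \<open>\<mu> + \<nu>\<close>.
\<close>

definition twist :: "(nat \<Rightarrow> nat \<Rightarrow> complex) \<Rightarrow> nat multiset \<Rightarrow> nat multiset \<Rightarrow> complex" where
  "twist t \<mu> \<nu> = (\<Prod>a\<in>#\<mu>. \<Prod>b\<in>#\<nu>. t a b)"

lemma twist_simps [simp]:
  "twist t {#} \<nu> = 1" "twist t \<mu> {#} = 1"
  "twist t (\<mu> + \<mu>') \<nu> = twist t \<mu> \<nu> * twist t \<mu>' \<nu>"
  "twist t \<mu> (\<nu> + \<nu>') = twist t \<mu> \<nu> * twist t \<mu> \<nu>'"
  "twist t {#a#} {#b#} = t a b"
  by (simp_all add: twist_def prod_mset.distrib)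

lemma twist_add_mset:
  "twist t (add_mset a \<mu>) \<nu> = twist t {#a#} \<nu> * twist t \<mu> \<nu>"
  "twist t \<mu> (add_mset b \<nu>) = twist t \<mu> {#b#} * twist t \<mu> \<nu>"
  by (simp_all add: twist_def prod_mset.distrib)

text \<open>The coefficient of a word relative to the sorted monomial.\<close>

fun word_coeff :: "(nat \<Rightarrow> nat \<Rightarrow> complex) \<Rightarrow> nat list \<Rightarrow> complex" where
  "word_coeff t [] = 1"
| "word_coeff t (a # u) = twist t {#a#} (mset u) * word_coeff t u"

lemma word_coeff_append:
  "word_coeff t (u @ v) = word_coeff t u * word_coeff t v * twist t (mset u) (mset v)"
proof (induction u)
  case (Cons a u)
  then show ?case using twist_add_mset(1)[of t a "mset u" "mset v"] by simp
qed simp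

definition torus_eval :: "(nat \<Rightarrow> nat \<Rightarrow> complex) \<Rightarrow> freealg \<Rightarrow> complex" where
  "torus_eval t x = (\<Sum>w\<in>Poly_Mapping.keys x. Poly_Mapping.lookup x w * word_coeff t (letters w))"

lemma torus_eval_superset:
  assumes "finite A" "Poly_Mapping.keys x \<subseteq> A"
  shows "torus_eval t x = (\<Sum>w\<in>A. Poly_Mapping.lookup x w * word_coeff t (letters w))"
  unfolding torus_eval_def using assms by (intro sum.mono_neutral_left) (auto simp: in_keys_iff)

lemma torus_eval_add: "torus_eval t (x + y) = torus_eval t x + torus_eval t y"
proof -
  let ?A = "Poly_Mapping.keys x \<union> Poly_Mapping.keys y"
  have "Poly_Mapping.keys (x + y) \<subseteq> ?A" by (rule Poly_Mapping.keys_add)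
  then show ?thesis
    by (simp add: torus_eval_superset[of ?A] lookup_add distrib_right sum.distrib)
qed

lemma torus_eval_zero [simp]: "torus_eval t 0 = 0"
  by (simp add: torus_eval_def)

lemma torus_eval_sum: "torus_eval t (sum f A) = (\<Sum>a\<in>A. torus_eval t (f a))"
  by (induction A rule: infinite_finite_induct) (simp_all add: torus_eval_add)

lemma torus_eval_single: "torus_eval t (Poly_Mapping.single w c) = c * word_coeff t (letters w)"
  by (simp add: torus_eval_def)

lemma torus_eval_minus: "torus_eval t (x - y) = torus_eval t x - torus_eval t y"
  using torus_eval_add[of t "x - y" y] by simp

lemma mult_eq_sum_single:
  "x * y = (\<Sum>u\<in>Poly_Mapping.keys x. \<Sum>v\<in>Poly_Mapping.keys y. Poly_Mapping.single (u + v) (Poly_Mapping.lookup x u * Poly_Mapping.lookup y v))"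
  by (subst poly_mapping_sum_single[of x], subst poly_mapping_sum_single[of y])
    (simp add: sum_distrib_left sum_distrib_right mult_single, rule sum.swap)

text \<open>
  The evaluation is multiplicative only up to a twist depending on the multidegrees, so it is
  tracked together with them.
\<close>

definition torus_value ::
  "(nat \<Rightarrow> nat \<Rightarrow> complex) \<Rightarrow> freealg \<Rightarrow> nat multiset \<Rightarrow> complex \<Rightarrow> bool" where
  "torus_value t x \<mu> z \<longleftrightarrow> (\<forall>w\<in>Poly_Mapping.keys x. mset (letters w) = \<mu>) \<and> torus_eval t x = z"

lemma torus_value_mult:
  assumes "torus_value t x \<mu> a" "torus_value t y \<nu> b"
  shows "torus_value t (x * y) (\<mu> + \<nu>) (a * b * twist t \<mu> \<nu>)"
proof -
  have "\<forall>w\<in>Poly_Mapping.keys (x * y). mset (letters w) = \<mu> + \<nu>"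
    using keys_mult[of x y] assms by (fastforce simp: torus_value_def plus_fword_def)
  moreover have "torus_eval t (x * y) =
      (\<Sum>u\<in>Poly_Mapping.keys x. \<Sum>v\<in>Poly_Mapping.keys y. Poly_Mapping.lookup x u * Poly_Mapping.lookup y v *
         (word_coeff t (letters u) * word_coeff t (letters v) * twist t \<mu> \<nu>))"
    using assms unfolding mult_eq_sum_single torus_eval_sum torus_eval_single torus_value_def
    by (intro sum.cong) (auto simp: plus_fword_def word_coeff_append)
  moreover have "\<dots> = torus_eval t x * torus_eval t y * twist t \<mu> \<nu>"
    unfolding torus_eval_def sum_product by (simp add: sum_distrib_left sum_distrib_right mult_ac)
  ultimately show ?thesis
    using assms by (simp add: torus_value_def)
qed

lemma torus_value_add:
  "torus_value t x \<mu> a \<Longrightarrow> torus_value t y \<mu> b \<Longrightarrow> torus_value t (x + y) \<mu> (a + b)"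
  using Poly_Mapping.keys_add[of x y] by (auto simp: torus_value_def torus_eval_add)

lemma torus_value_zero: "torus_value t 0 \<mu> 0"
  by (simp add: torus_value_def)

lemma torus_value_scal: "torus_value t (scal c) {#} c"
  by (auto simp: torus_value_def scal_def torus_eval_single zero_fword_def)

lemma torus_value_scal_mult:
  "torus_value t x \<mu> a \<Longrightarrow> torus_value t (scal c * x) \<mu> (c * a)"
  using torus_value_mult[OF torus_value_scal, of t x \<mu> a c] by simp

lemma torus_value_gen: "torus_value t (gen i) {#i#} 1"
  by (simp add: torus_value_def gen_def torus_eval_single)

lemma torus_value_gen_power: "torus_value t (gen i ^ k) (replicate_mset k i) (t i i ^ (k choose 2))"
proof (induction k)
  case 0
  show ?case
    by (simp add: torus_value_def torus_eval_def zero_fword_def binomial_eq_0 flip: single_one)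
next
  case (Suc k)
  have "twist t {#i#} (replicate_mset k i) = t i i ^ k"
    by (simp add: twist_def)
  then show ?case
    using torus_value_mult[OF torus_value_gen Suc, of i]
    by (simp add: power_add numeral_2_eq_2 mult.commute)
qed

lemma scal_minus: "scal (- c) = - scal c"
  by (simp add: scal_def single_uminus)

lemma torus_value_minus:
  assumes "torus_value t x \<mu> a" "torus_value t y \<mu> b" shows "torus_value t (x - y) \<mu> (a - b)"
proof -
  have "scal (- 1) * y = - y" by (simp add: scal_minus) (simp add: scal_def)
  then show ?thesis
    using torus_value_add[OF assms(1) torus_value_scal_mult[OF assms(2), of "- 1"]]
    by (simp del: mult_minus1)
qed

lemma torus_value_qcomm:
  assumes "torus_value t x \<mu> a" "torus_value t y \<nu> b"
  shows "torus_value t (qcomm c x y) (\<mu> + \<nu>) (a * b * (twist t \<mu> \<nu> - c * twist t \<nu> \<mu>))"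
  using torus_value_minus[OF torus_value_mult[OF assms]
      torus_value_mult[OF torus_value_scal_mult[OF assms(2)] assms(1), of c, unfolded add.commute[of \<nu>]]]
  by (simp add: qcomm_def algebra_simps)

lemma eps_low: "1 \<le> i \<Longrightarrow> i \<le> n \<Longrightarrow> eps g n i k = of_bool (k = i)"
  by (cases g) (auto simp: eps_def prime_ix_def dimN_def)

lemma ip_linear:
  "ip n (\<lambda>k. u k + v k) w = ip n u w + ip n v w" "ip n (\<lambda>k. u k - v k) w = ip n u w - ip n v w"
  "ip n w (\<lambda>k. u k + v k) = ip n w u + ip n w v" "ip n w (\<lambda>k. u k - v k) = ip n w u - ip n w v"
  "ip n (\<lambda>k. c * u k) w = c * ip n u w" "ip n w (\<lambda>k. c * u k) = c * ip n w u"
  by (simp_all add: ip_def algebra_simps sum.distrib sum_subtractf sum_distrib_left)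

lemma ip_eps_low:
  "1 \<le> i \<Longrightarrow> i \<le> n \<Longrightarrow> 1 \<le> j \<Longrightarrow> j \<le> n \<Longrightarrow> ip n (eps g n i) (eps g n j) = of_bool (i = j)"
  unfolding ip_def
  by (subst sum.cong[where h = "\<lambda>k. if k = i then of_bool (i = j) else 0"])
    (auto simp: eps_low)

lemma ip_alpha_less:
  assumes "simple_rank g n" "1 \<le> l" "l < m" "m \<le> n"
  shows "ip n (alpha g n l) (alpha g n m) =
    (if m < n then - of_bool (m = l + 1)
     else case g of SO_odd \<Rightarrow> - of_bool (n = l + 1) | SP \<Rightarrow> - 2 * of_bool (n = l + 1)
                  | SO_even \<Rightarrow> - of_bool (n = l + 2))"
  using assms by (cases g) (auto simp: alpha_def ip_linear ip_eps_low simple_rank_def)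

lemma ip_commute: "ip n u v = ip n v u"
  by (simp add: ip_def mult.commute)

lemma ip_alpha_self:
  assumes "simple_rank g n" "1 \<le> l" "l \<le> n"
  shows "ip n (alpha g n l) (alpha g n l) =
    (if l < n then 2 else case g of SO_odd \<Rightarrow> 1 | SP \<Rightarrow> 4 | SO_even \<Rightarrow> 2)"
  using assms by (cases g) (auto simp: alpha_def ip_linear ip_eps_low simple_rank_def)

text \<open>
  The torus with \<open>t\<^sub>l t\<^sub>m = q\<^bsup>(\<alpha>\<^sub>l, \<alpha>\<^sub>m)\<^esup> t\<^sub>m t\<^sub>l\<close> for \<open>l > m\<close>.  Inverting the scalar for a pair of neighbours would also
  be compatible with the Serre relations; with this choice the lower chains vanish.
\<close>

definition root_twist :: "series \<Rightarrow> nat \<Rightarrow> complex \<Rightarrow> nat \<Rightarrow> nat \<Rightarrow> complex" where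
  "root_twist g n L l m =
     (if m < l then qpow L (of_int (ip n (alpha g n l) (alpha g n m))) else 1)"

lemma qpow_simps: "qpow L 0 = 1" "qpow L (a + b) = qpow L a * qpow L b"
  "qpow L (- a) = inverse (qpow L a)" "qpow L a \<noteq> 0"
  by (simp_all add: qpow_def distrib_right exp_add exp_minus)

lemma qpow_nat: "qpow L (of_nat k * a) = qpow L a ^ k"
  by (simp add: qpow_def exp_of_nat_mult[symmetric] mult_ac)

lemma qint_small:
  assumes "p \<noteq> 0" "p - inverse p \<noteq> 0"
  shows "qint p 1 = 1" "qint p 2 = p + inverse p" "qint p 3 = p ^ 2 + 1 + inverse p ^ 2"
proof -
  show "qint p 1 = 1" using assms by (simp add: qint_def)
  show "qint p 2 = p + inverse p" "qint p 3 = p ^ 2 + 1 + inverse p ^ 2"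
    using assms by (simp_all add: qint_def divide_simps)
      (auto simp: algebra_simps eval_nat_numeral power4_eq_xxxx)
qed

lemma qbinom_small:
  assumes "p \<noteq> 0" "p - inverse p \<noteq> 0"
  shows "qbinom p 1 0 = 1" "qbinom p 1 1 = 1"
    and "p + inverse p \<noteq> 0 \<Longrightarrow> qbinom p 2 0 = 1" "p + inverse p \<noteq> 0 \<Longrightarrow> qbinom p 2 1 = p + inverse p"
      "p + inverse p \<noteq> 0 \<Longrightarrow> qbinom p 2 2 = 1"
proof -
  have f: "qfact p 0 = 1" "qfact p (Suc k) = qfact p k * qint p (Suc k)" for k
    by (simp_all add: qfact_def)
  show "qbinom p 1 0 = 1" "qbinom p 1 1 = 1"
    "p + inverse p \<noteq> 0 \<Longrightarrow> qbinom p 2 0 = 1" "p + inverse p \<noteq> 0 \<Longrightarrow> qbinom p 2 1 = p + inverse p"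
    "p + inverse p \<noteq> 0 \<Longrightarrow> qbinom p 2 2 = 1"
    using qint_small[OF assms] by (simp_all add: qbinom_def f numeral_2_eq_2)
qed

text \<open>
  By the \<open>q\<close>-binomial theorem the first sum, as a polynomial in the base of the last power, is a product of
  \<open>r\<close> linear factors, one of which vanishes at \<open>p\<close> to the power \<open>1 - r\<close>.  The second sum is the
  first one read backwards.  As \<open>r\<close> is at most 3, the cases are simply computed.
\<close>

lemma qbinom_sum_zero:
  assumes p: "p \<noteq> 0" "p ^ 2 \<noteq> 1" "p ^ 4 \<noteq> 1" "p ^ 6 \<noteq> 1" and r: "r \<in> {1, 2, 3::nat}"
  shows "(\<Sum>k = 0..r. (- 1) ^ k * qbinom p r k * (inverse p ^ (r - 1)) ^ k) = 0"
    and "(\<Sum>k = 0..r. (- 1) ^ k * qbinom p r k * (inverse p ^ (r - 1)) ^ (r - k)) = 0"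
proof -
  have d: "p - inverse p \<noteq> 0"
    using p(1,2) by (auto simp: field_simps power2_eq_square)
  note q = qint_small[OF p(1) d]
  have n2: "p + inverse p \<noteq> 0"
  proof
    assume "p + inverse p = 0"
    then have "p ^ 2 = - 1" using p(1) by (simp add: field_simps power2_eq_square add_eq_0_iff)
    then have "(p ^ 2) ^ 2 = 1" by simp
    then show False using p(3) by (simp flip: power_mult)
  qed
  have n3: "p ^ 2 + 1 + inverse p ^ 2 \<noteq> 0"
  proof
    assume "p ^ 2 + 1 + inverse p ^ 2 = 0"
    then have "p ^ 2 * (p ^ 2 + 1 + inverse p ^ 2) = 0" by simp
    then have "p ^ 4 + p ^ 2 + 1 = 0" using p(1) by (simp add: algebra_simps power_inverse flip: power_add)
    then have "(p ^ 2 - 1) * (p ^ 4 + p ^ 2 + 1) = 0" by simp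
    then have "p ^ 6 = 1" by (simp add: algebra_simps flip: power_add)
    then show False using p(4) by simp
  qed
  have f: "qfact p 0 = 1" "qfact p (Suc k) = qfact p k * qint p (Suc k)" for k
    by (simp_all add: qfact_def)
  note b1 = qbinom_small(1,2)[OF p(1) d] and b2 = qbinom_small(3-5)[OF p(1) d n2]
  have b3: "qbinom p 3 0 = 1" "qbinom p 3 1 = p ^ 2 + 1 + inverse p ^ 2"
      "qbinom p 3 2 = p ^ 2 + 1 + inverse p ^ 2" "qbinom p 3 3 = 1"
    using q n2 n3 by (simp_all add: qbinom_def f numeral_2_eq_2 numeral_3_eq_3)
  have s: "(\<Sum>k = 0..1. h k) = h 0 + h 1" "(\<Sum>k = 0..2. h k) = h 0 + h 1 + h 2"
    "(\<Sum>k = 0..3. h k) = h 0 + h 1 + h 2 + h 3" for h :: "nat \<Rightarrow> complex"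
    by (simp_all add: numeral_2_eq_2 numeral_3_eq_3)
  show "(\<Sum>k = 0..r. (- 1) ^ k * qbinom p r k * (inverse p ^ (r - 1)) ^ k) = 0"
    using r p(1) by (auto simp del: One_nat_def simp: s b1 b2 b3)
      (simp_all add: field_simps eval_nat_numeral)
  show "(\<Sum>k = 0..r. (- 1) ^ k * qbinom p r k * (inverse p ^ (r - 1)) ^ (r - k)) = 0"
    using r p(1) by (auto simp del: One_nat_def simp: s b1 b2 b3)
      (simp_all add: field_simps eval_nat_numeral)
qed

lemma torus_value_sum:
  "(\<And>k. k \<in> A \<Longrightarrow> torus_value t (f k) \<mu> (a k)) \<Longrightarrow> torus_value t (sum f A) \<mu> (sum a A)"
  by (induction A rule: infinite_finite_induct) (auto simp: torus_value_zero torus_value_add)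

lemma torus_value_serre_word:
  assumes "t l l = 1" "k \<le> r"
  shows "torus_value t (gen l ^ (r - k) * gen m * gen l ^ k) (replicate_mset r l + {#m#})
           (t l m ^ (r - k) * t m l ^ k)"
proof -
  have "replicate_mset (r - k) l + {#m#} + replicate_mset k l = replicate_mset r l + {#m#}"
    using assms(2) by (intro multiset_eqI) auto
  moreover have "twist t (replicate_mset (r - k) l) {#m#} = t l m ^ (r - k)"
    "twist t (replicate_mset (r - k) l + {#m#}) (replicate_mset k l) = t m l ^ k"
    using assms(1) by (simp_all add: twist_def)
  ultimately show ?thesis
    using torus_value_mult[OF torus_value_mult[OF torus_value_gen_power[of t l "r - k"]
        torus_value_gen[of t m]] torus_value_gen_power[of t l k]] assms(1) by simp
qed

lemma torus_eval_sandwich: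
  assumes "torus_value t s \<mu> 0"
  shows "torus_eval t (y * s * z) = 0"
proof -
  have single: "torus_value t (Poly_Mapping.single w c) (mset (letters w)) (c * word_coeff t (letters w))"
    for w c by (simp add: torus_value_def torus_eval_single)
  have "torus_eval t (Poly_Mapping.single u a * s * Poly_Mapping.single v b) = 0" for u v a b
    using torus_value_mult[OF torus_value_mult[OF single assms] single, of u a v b]
    by (simp add: torus_value_def)
  then show ?thesis
    by (subst poly_mapping_sum_single[of y], subst poly_mapping_sum_single[of z])
      (simp add: sum_distrib_left sum_distrib_right torus_eval_sum)
qed

locale quantum_group =
  fixes g :: series and n :: nat and L :: complex
  assumes rank: "simple_rank g n"
    and not_root_of_unity: "k > 0 \<Longrightarrow> exp L ^ k \<noteq> 1"
begin

definition "tw = root_twist g n L"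

lemma tw_self [simp]: "tw l l = 1"
  by (simp add: tw_def root_twist_def)

text \<open>
  The exponent \<open>(\<alpha>\<^sub>l, \<alpha>\<^sub>m)\<close> of the torus is \<open>a\<^sub>l\<^sub>m (\<alpha>\<^sub>l, \<alpha>\<^sub>l) / 2\<close>, so that the scalar is the root of the
  \<open>q\<close>-binomial polynomial.
\<close>

lemma serre_exponents:
  assumes "l \<in> {1..n}" "m \<in> {1..n}" "l \<noteq> m"
  defines "r \<equiv> nat (1 - cartan g n l m)"
  shows "r \<in> {1, 2, 3}"
    and "qpow L (of_int (ip n (alpha g n l) (alpha g n m))) = inverse (q_ix g n L l) ^ (r - 1)"
proof -
  let ?i = "ip n (alpha g n l) (alpha g n m)" and ?d = "ip n (alpha g n l) (alpha g n l)"
  have i: "?i = (if l < m then ip n (alpha g n l) (alpha g n m) else ip n (alpha g n m) (alpha g n l))"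
    by (simp add: ip_commute)
  have d: "?d = (if l < n then 2 else case g of SO_odd \<Rightarrow> 1 | SP \<Rightarrow> 4 | SO_even \<Rightarrow> 2)"
    using ip_alpha_self[OF rank] assms by auto
  have *: "cartan g n l m \<in> {0, - 1, - 2} \<and> 2 * ?i = cartan g n l m * ?d"
  proof (cases "l < m")
    case True
    then show ?thesis using ip_alpha_less[OF rank, of l m] assms(1-3) d
      by (cases g) (auto simp: cartan_def of_bool_def)
  next
    case False
    then show ?thesis using ip_alpha_less[OF rank, of m l] assms(1-3) d i
      by (cases g) (auto simp: cartan_def of_bool_def)
  qed
  then show "r \<in> {1, 2, 3}" unfolding r_def by auto
  have "of_int ?i = - (of_nat (r - 1) * (of_int ?d / 2) :: complex)"
  proof -
    have "int (r - 1) = - cartan g n l m" using * by (auto simp: r_def)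
    then have "2 * ?i = - (int (r - 1) * ?d)" using * by simp
    then have "of_int (2 * ?i) = (of_int (- (int (r - 1) * ?d)) :: complex)" by (simp only:)
    then show ?thesis by (simp add: field_simps)
  qed
  then show "qpow L (of_int ?i) = inverse (q_ix g n L l) ^ (r - 1)"
    by (simp only: qpow_simps(3) qpow_nat q_ix_def power_inverse)
qed

lemma qpow_nonunit: "k > 0 \<Longrightarrow> qpow L (of_nat k) \<noteq> 1"
  using not_root_of_unity[of k] by (simp add: qpow_def exp_of_nat_mult)

lemma q_ix_nonunit:
  assumes "l \<in> {1..n}" "k > 0"
  shows "q_ix g n L l ^ (2 * k) \<noteq> 1"
proof -
  let ?d = "ip n (alpha g n l) (alpha g n l)"
  obtain d :: nat where d: "?d = int d" "d > 0"
    using ip_alpha_self[OF rank, of l] assms(1) that[of 1] that[of 2] that[of 4]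
    by (cases g) (auto split: if_splits)
  have "q_ix g n L l ^ (2 * k) = qpow L (of_nat (k * d))"
    by (simp add: q_ix_def d flip: qpow_nat)
  then show ?thesis using qpow_nonunit[of "k * d"] d(2) assms(2) by simp
qed

lemma torus_value_serre:
  assumes lm: "l \<in> {1..n}" "m \<in> {1..n}" "l \<noteq> m"
  shows "\<exists>\<mu>. torus_value tw (serre g n L l m) \<mu> 0"
proof -
  define r where "r = nat (1 - cartan g n l m)"
  define p where "p = q_ix g n L l"
  note e = serre_exponents[OF lm, folded r_def p_def]
  have "p \<noteq> 0" by (simp add: p_def q_ix_def qpow_simps)
  note zero = qbinom_sum_zero[OF this _ _ _ e(1)]
  have p: "p ^ 2 \<noteq> 1" "p ^ 4 \<noteq> 1" "p ^ 6 \<noteq> 1"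
    using q_ix_nonunit[OF lm(1), of 1] q_ix_nonunit[OF lm(1), of 2] q_ix_nonunit[OF lm(1), of 3]
    by (simp_all add: p_def)
  have "serre g n L l m =
      (\<Sum>k = 0..r. scal ((- 1) ^ k * qbinom p r k) * (gen l ^ (r - k) * gen m * gen l ^ k))"
    by (simp add: serre_def r_def p_def Let_def mult.assoc)
  moreover have "torus_value tw \<dots> (replicate_mset r l + {#m#})
      (\<Sum>k = 0..r. (- 1) ^ k * qbinom p r k * (tw l m ^ (r - k) * tw m l ^ k))"
    by (intro torus_value_sum torus_value_scal_mult torus_value_serre_word) auto
  moreover have "(\<Sum>k = 0..r. (- 1) ^ k * qbinom p r k * (tw l m ^ (r - k) * tw m l ^ k)) = 0"
    using zero(1)[OF p] zero(2)[OF p] lm(3) e(2) ip_commute[of n "alpha g n m" "alpha g n l"]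
    by (cases "l < m") (auto simp: tw_def root_twist_def simp flip: e(2))
  ultimately show ?thesis by metis
qed

text \<open>
  The two-sided ideal on which the evaluation vanishes.  It is smaller than the kernel of the functional, which is no
  ideal since the functional is multiplicative only up to a twist.  Modulo this ideal a factor of value 0 makes a
  product negligible whatever the multidegree of the other factor is.
\<close>

definition "torus_kernel = {x. \<forall>y z. torus_eval tw (y * x * z) = 0}"

abbreviation "torus_null \<equiv> carrier (free_ring n) \<inter> torus_kernel"

lemma ideal_torus_null: "ideal torus_null (free_ring n)"
proof -
  interpret ring "free_ring n" by (rule ring_free_ring)
  have neg: "\<ominus>\<^bsub>free_ring n\<^esub> x = - x" if "x \<in> carrier (free_ring n)" for x
    using that by (intro minus_equality) (auto simp: free_ring_def)
  show ?thesis
  proof (rule idealI)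
    show "subgroup torus_null (add_monoid (free_ring n))"
    proof
      fix x assume x: "x \<in> torus_null"
      have "\<forall>y z. torus_eval tw (y * - x * z) = 0"
        using x torus_eval_minus[of tw 0] by (auto simp: torus_kernel_def)
      then have "- x \<in> torus_null" using x by (auto simp: torus_kernel_def free_ring_def)
      then show "inv\<^bsub>add_monoid (free_ring n)\<^esub> x \<in> torus_null"
        using neg x by (simp add: torus_kernel_def a_inv_def)
    next
      fix x y assume "x \<in> torus_null" "y \<in> torus_null"
      then show "x \<otimes>\<^bsub>add_monoid (free_ring n)\<^esub> y \<in> torus_null"
        using a_closed[of x y]
        by (simp add: torus_kernel_def torus_eval_add distrib_left distrib_right) (simp add: free_ring_def torus_eval_add distrib_left distrib_right)
    qed (auto simp: torus_kernel_def free_ring_def)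
  next
    fix a x assume "a \<in> torus_null" "x \<in> carrier (free_ring n)"
    then show "x \<otimes>\<^bsub>free_ring n\<^esub> a \<in> torus_null" "a \<otimes>\<^bsub>free_ring n\<^esub> x \<in> torus_null"
      using m_closed[of x a] m_closed[of a x]
      by (auto simp: torus_kernel_def) (simp_all add: free_ring_def mult.assoc[symmetric], simp_all add: mult.assoc)
  qed (rule ring_free_ring)
qed

lemma gen_carrier: "1 \<le> i \<Longrightarrow> i \<le> n \<Longrightarrow> gen i \<in> carrier (free_ring n)"
  by (simp add: gen_def free_ring_def)

lemma scal_carrier: "scal c \<in> carrier (free_ring n)"
  by (simp add: scal_def free_ring_def zero_fword_def)

lemma carrier_closed:
  "x \<in> carrier (free_ring n) \<Longrightarrow> y \<in> carrier (free_ring n) \<Longrightarrow> x * y \<in> carrier (free_ring n)"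
  "x \<in> carrier (free_ring n) \<Longrightarrow> y \<in> carrier (free_ring n) \<Longrightarrow> x + y \<in> carrier (free_ring n)"
  "x \<in> carrier (free_ring n) \<Longrightarrow> y \<in> carrier (free_ring n) \<Longrightarrow> x - y \<in> carrier (free_ring n)"
  "0 \<in> carrier (free_ring n)" "1 \<in> carrier (free_ring n)"
proof -
  interpret ring "free_ring n" by (rule ring_free_ring)
  show "x * y \<in> carrier (free_ring n)" "x + y \<in> carrier (free_ring n)"
    if "x \<in> carrier (free_ring n)" "y \<in> carrier (free_ring n)" for x y
    using m_closed[OF that] a_closed[OF that] by (simp_all add: free_ring_def)
  show "x - y \<in> carrier (free_ring n)"
    if "x \<in> carrier (free_ring n)" "y \<in> carrier (free_ring n)" for x y
    using that keys_diff[of x y] by (auto simp: free_ring_def)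
qed (simp_all add: free_ring_def zero_fword_def)

lemma carrier_power: "x \<in> carrier (free_ring n) \<Longrightarrow> x ^ k \<in> carrier (free_ring n)"
  by (induction k) (simp_all add: carrier_closed)

lemma carrier_sum:
  "(\<And>k. k \<in> A \<Longrightarrow> f k \<in> carrier (free_ring n)) \<Longrightarrow> sum f A \<in> carrier (free_ring n)"
  by (induction A rule: infinite_finite_induct) (simp_all add: carrier_closed)

lemma serre_carrier:
  "l \<in> {1..n} \<Longrightarrow> m \<in> {1..n} \<Longrightarrow> serre g n L l m \<in> carrier (free_ring n)"
  unfolding serre_def Let_def
  by (intro carrier_sum carrier_closed carrier_power scal_carrier gen_carrier) auto

lemma serre_generators:
  "{serre g n L l m | l m. l \<in> {1..n} \<and> m \<in> {1..n} \<and> l \<noteq> m} \<subseteq> carrier (free_ring n)"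
  using serre_carrier by auto

lemma ideal_serre: "ideal (serre_ideal g n L) (free_ring n)"
  unfolding serre_ideal_def by (rule ring.genideal_ideal[OF ring_free_ring serre_generators])

lemma serre_ideal_torus_null: "serre_ideal g n L \<subseteq> torus_null"
  unfolding serre_ideal_def
proof (rule ring.genideal_minimal[OF ring_free_ring ideal_torus_null], clarify)
  fix l m assume "l \<in> {1..n}" "m \<in> {1..n}" "l \<noteq> m"
  then show "serre g n L l m \<in> torus_null"
    using torus_value_serre[of l m] torus_eval_sandwich serre_carrier
    by (auto simp: torus_kernel_def)
qed

end

section \<open>Route sums\<close>

text \<open>
  The sum over all sublists of the given levels: a level is visited, or skipped at the price of a factor \<open>B\<close>.
\<close>

primrec path_sum ::
  "(nat \<Rightarrow> nat \<Rightarrow> freealg) \<Rightarrow> (nat \<Rightarrow> complex) \<Rightarrow> nat \<Rightarrow> nat list \<Rightarrow> nat \<Rightarrow> freealg" where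
  "path_sum F B a [] b = F a b"
| "path_sum F B a (l # ls) b = scal (B l) * path_sum F B a ls b + F a l * path_sum F B l ls b"

lemma scal_commute: "x * scal c = scal c * x"
proof -
  have "Poly_Mapping.single w a * scal c = scal c * Poly_Mapping.single w a" for w a
    by (simp add: scal_def mult_single mult.commute)
  then show ?thesis
    by (subst (1 2) poly_mapping_sum_single[of x]) (simp add: sum_distrib_left sum_distrib_right)
qed

text \<open>
  The routes are sorted by whether they visit \<open>k\<close>.
\<close>

lemma path_sum_split:
  "path_sum F B a (xs @ k # ys) b =
     scal (B k) * path_sum F B a (xs @ ys) b + path_sum F B a xs k * path_sum F B k ys b"
proof (induction xs arbitrary: a)
  case (Cons x xs)
  have "scal (B x) * (scal (B k) * u) = scal (B k) * (scal (B x) * u)" for u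
    by (simp add: scal_mult mult.commute flip: mult.assoc)
  moreover have "F a x * (scal (B k) * u) = scal (B k) * (F a x * u)" for u
    by (metis mult.assoc scal_commute)
  ultimately show ?case by (simp add: Cons algebra_simps)
qed simp

lemma subseqs_sum_eq_path_sum:
  assumes "distinct ls"
  shows "(\<Sum>m\<in>set (subseqs ls). scal (\<Prod>l\<in>set ls - set m. B l) * prod_list (map2 F (a # m) (m @ [b]))) =
    path_sum F B a ls b"
  using assms
proof (induction ls arbitrary: a)
  case Nil
  show ?case by (simp add: scal_def)
next
  case (Cons l ls)
  have sub: "set m \<subseteq> set ls" if "m \<in> set (subseqs ls)" for m
    using that subseqs_powset[of ls] by blast
  have disj: "set (subseqs ls) \<inter> Cons l ` set (subseqs ls) = {}"
    using sub Cons.prems by fastforce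
  let ?t = "\<lambda>a L m. scal (\<Prod>l\<in>L - set m. B l) * prod_list (map2 F (a # m) (m @ [b]))"
  have 1: "?t a (set (l # ls)) m = scal (B l) * ?t a (set ls) m" if "m \<in> set (subseqs ls)" for m
  proof -
    have "set (l # ls) - set m = insert l (set ls - set m)" "l \<notin> set ls - set m"
      using sub[OF that] Cons.prems by auto
    then show ?thesis by (simp add: scal_mult flip: mult.assoc del: set_simps)
  qed
  have 2: "?t a (set (l # ls)) (l # m) = F a l * ?t l (set ls) m" if "m \<in> set (subseqs ls)" for m
  proof -
    have "set (l # ls) - set (l # m) = set ls - set m"
      using Cons.prems by auto
    then show ?thesis by (simp add: scal_commute[of "F a l"] del: set_simps flip: mult.assoc)
  qed
  have "(\<Sum>m\<in>set (subseqs (l # ls)). ?t a (set (l # ls)) m) =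
      (\<Sum>m\<in>set (subseqs ls). ?t a (set (l # ls)) m) +
      (\<Sum>m\<in>Cons l ` set (subseqs ls). ?t a (set (l # ls)) m)"
    by (subst sum.union_disjoint[symmetric]) (use disj in \<open>auto simp: Let_def Un_commute\<close>)
  also have "(\<Sum>m\<in>Cons l ` set (subseqs ls). ?t a (set (l # ls)) m) =
      (\<Sum>m\<in>set (subseqs ls). F a l * ?t l (set ls) m)"
    using 2 by (subst sum.reindex) (auto intro!: sum.cong)
  also have "(\<Sum>m\<in>set (subseqs ls). ?t a (set (l # ls)) m) =
      (\<Sum>m\<in>set (subseqs ls). scal (B l) * ?t a (set ls) m)"
    using 1 by (intro sum.cong) auto
  also have "(\<Sum>m\<in>set (subseqs ls). scal (B l) * ?t a (set ls) m) +
      (\<Sum>m\<in>set (subseqs ls). F a l * ?t l (set ls) m) = path_sum F B a (l # ls) b"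
    using Cons by (simp flip: sum_distrib_left)
  finally show ?case .
qed

text \<open>
  In the series \<open>SO_even\<close> the order forbids the step from \<open>n\<close> to \<open>n'\<close>.  Since its element is 0, one may allow
  it, and sum over all increasing sequences of integers.
\<close>

lemma prod_list_vanishing_step:
  assumes "sorted_wrt (<) (a # m @ [b])" "x \<in> set (a # m)" "Suc x \<in> set (m @ [b])"
    and "F x (Suc x) = (0 :: freealg)"
  shows "prod_list (map2 F (a # m) (m @ [b])) = 0"
  using assms(1-3)
proof (induction m arbitrary: a)
  case Nil
  then show ?case using assms(4) by auto
next
  case (Cons c m)
  show ?case
  proof (cases "x = a")
    case True
    then have "c = Suc x" using Cons.prems by auto
    then show ?thesis using True assms(4) by simp
  next
    case False
    then have "prod_list (map2 F (c # m) (m @ [b])) = 0"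
      using Cons.prems by (intro Cons.IH) auto
    then show ?thesis by simp
  qed
qed

lemma f_el_incomparable: "g = SO_even \<Longrightarrow> n \<ge> 1 \<Longrightarrow> f_el g n L n (Suc n) = 0"
  by (simp add: f_el_def dimN_def prime_ix_def fD_def)

lemma reg_rep_eq_path_sum:
  assumes "simple_rank g n" "prec g n i j"
  shows "reg_rep {l. preceq g n i l \<and> prec g n l j} g n L i j lam =
    path_sum (f_el g n L) (\<lambda>l. A_inv g n L j l lam) i
      (filter (\<lambda>l. prec g n i l \<and> prec g n l j) [Suc i..<j]) j"
proof -
  define ls where "ls = filter (\<lambda>l. prec g n i l \<and> prec g n l j) [Suc i..<j]"
  have ls: "distinct ls" "sorted_wrt (<) ls" "set ls = {l. prec g n i l \<and> prec g n l j}"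
    by (auto simp: ls_def prec_def sorted_wrt_filter)
  have sub: "set m \<subseteq> set ls" if "m \<in> set (subseqs ls)" for m
    using that subseqs_powset[of ls] by blast
  have sorted_sub: "sorted_wrt (<) m" if "m \<in> set (subseqs ls)" for m
    using that ls(2)
  proof (induction ls arbitrary: m)
    case (Cons x xs)
    have "set m' \<subseteq> set xs" if "m' \<in> set (subseqs xs)" for m'
      using that subseqs_powset[of xs] by blast
    then have "sorted_wrt (<) (x # m')" if "m' \<in> set (subseqs xs)" for m'
      using that Cons.IH[OF that] Cons.prems(2) by (simp add: subset_iff)
    then show ?case using Cons.IH Cons.prems by (auto simp: Let_def)
  qed simp
  let ?S = "{l. preceq g n i l \<and> prec g n l j}"
  have diff: "?S - set (i # m) = set ls - set m" for m
    unfolding ls(3) using assms(2) by (auto simp: preceq_def prec_def)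
  have "routes g n i j \<subseteq> set (subseqs ls)"
  proof
    fix m assume m: "m \<in> routes g n i j"
    then have "set m \<subseteq> set ls"
      by (auto simp: ls routes_def sorted_wrt_append)
    then obtain m' where m': "m' \<in> set (subseqs ls)" "set m' = set m"
      using subseqs_powset[of ls] by (metis (no_types, lifting) PowI imageE)
    moreover have "sorted_wrt (<) m"
    proof (rule sorted_wrt_mono_rel)
      show "sorted_wrt (prec g n) m" using m by (simp add: routes_def sorted_wrt_append)
    qed (simp add: prec_def)
    ultimately have "m = m'"
      using sorted_sub by (intro strict_sorted_equal) auto
    then show "m \<in> set (subseqs ls)" using m' by simp
  qed
  moreover have "prod_list (map2 (f_el g n L) (i # m) (m @ [j])) = 0"
    if m: "m \<in> set (subseqs ls)" "m \<notin> routes g n i j" for m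
  proof -
    have *: "sorted_wrt (<) (i # m @ [j])"
      using sorted_sub[OF m(1)] sub[OF m(1)] assms(2) by (auto simp: sorted_wrt_append ls prec_def)
    have "\<not> sorted_wrt (prec g n) (i # m @ [j])" using m(2) by (simp add: routes_def)
    moreover have "sorted_wrt (prec g n) (i # m @ [j])"
      if "\<not> (g = SO_even \<and> n \<in> set (i # m @ [j]) \<and> Suc n \<in> set (i # m @ [j]))"
    proof (rule sorted_wrt_mono_rel[OF _ *])
      fix x y assume "x \<in> set (i # m @ [j])" "y \<in> set (i # m @ [j])" "x < y"
      then show "prec g n x y" using that unfolding prec_def by (metis Suc_eq_plus1)
    qed
    ultimately have so: "g = SO_even" "n \<in> set (i # m @ [j])" "Suc n \<in> set (i # m @ [j])"
      by blast+
    have "n \<noteq> j" using so(3) * by (auto simp: sorted_wrt_append)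
    moreover have "Suc n \<noteq> i" using so(2) * by (auto simp: sorted_wrt_append)
    ultimately show ?thesis
      using so * assms(1)
      by (intro prod_list_vanishing_step[of i m j n] f_el_incomparable) (auto simp: simple_rank_def)
  qed
  ultimately have "reg_rep ?S g n L i j lam =
      (\<Sum>m\<in>set (subseqs ls). scal (\<Prod>l\<in>set ls - set m. A_inv g n L j l lam) *
         prod_list (map2 (f_el g n L) (i # m) (m @ [j])))"
    unfolding reg_rep_def diff route_prod_def by (intro sum.mono_neutral_left) auto
  also have "\<dots> = path_sum (f_el g n L) (\<lambda>l. A_inv g n L j l lam) i ls j"
    using ls(1) by (rule subseqs_sum_eq_path_sum)
  finally show ?thesis unfolding ls_def .
qed

text \<open>
  The levels between \<open>i\<close> and \<open>j\<close> are an interval of integers except for \<open>j = n'\<close> in the series \<open>SO_even\<close>,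
  where \<open>n\<close> is not below \<open>j\<close>.  In the remaining case \<open>i = n\<close> the condition \<open>i \<le> j'\<close> fails.
\<close>

lemma level_list:
  assumes "simple_rank g n" "prec g n i j" "1 \<le> i" "i \<le> prime_ix g n j"
  shows "filter (\<lambda>l. prec g n i l \<and> prec g n l j) [Suc i..<j] =
    (if g = SO_even \<and> j = n + 1 then [Suc i..<n] else [Suc i..<j])"
proof (cases "g = SO_even \<and> j = n + 1")
  case True
  then have "i < n" using assms by (auto simp: prec_def)
  then have "[Suc i..<j] = [Suc i..<n] @ [n]" using True by simp
  then show ?thesis using True by (auto simp: prec_def filter_id_conv)
next
  case False
  then have "g = SO_even \<Longrightarrow> i = n \<Longrightarrow> j \<le> n + 1"
    using assms by (auto simp: prime_ix_def dimN_def)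
  then have "filter (\<lambda>l. prec g n i l \<and> prec g n l j) [Suc i..<j] = [Suc i..<j]"
    using False assms(2) by (auto simp: prec_def filter_id_conv)
  then show ?thesis using False by auto
qed

section \<open>Torus values of the elements \<open>f\<^sub>i\<^sub>j\<close>\<close>

context quantum_group
begin

abbreviation "tv \<equiv> torus_value tw"
abbreviation "iv k l \<equiv> mset [k..<l]"
abbreviation "q \<equiv> qq L"
abbreviation "qb \<equiv> inverse q"

lemma q_nonzero [simp]: "q \<noteq> 0" by (simp add: qpow_simps)

lemma q_power_nonunit: "k > 0 \<Longrightarrow> q ^ k \<noteq> 1"
  using qpow_nonunit[of k] by (simp flip: qpow_nat)

lemma q_sub_qb: "q - qb \<noteq> 0"
proof
  assume "q - qb = 0"
  then have "q ^ 2 = 1" by (simp add: field_simps power2_eq_square)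
  then show False using q_power_nonunit[of 2] by simp
qed

lemma q_add_qb: "q + qb \<noteq> 0"
proof
  assume "q + qb = 0"
  then have "q ^ 2 = - 1" by (simp add: field_simps power2_eq_square add_eq_0_iff)
  then have "(q ^ 2) ^ 2 = 1" by simp
  then show False using q_power_nonunit[of 4] by (simp flip: power_mult)
qed

text \<open>
  The only smaller neighbour of a node in the Dynkin diagram, and the scalar that belongs to this edge.
\<close>

definition "left_nb a = (if g = SO_even \<and> a = n then n - 2 else a - 1)"
definition "left_tw a = (if g = SP \<and> a = n then qb ^ 2 else qb)"

lemma qpow_neg: "qpow L (- 1) = qb" "qpow L (- 2) = qb ^ 2"
  using qpow_simps(3)[of L 1] qpow_simps(3)[of L 2] qpow_nat[of L 2 1]
  by (simp_all add: power_inverse)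

lemma tw_less:
  assumes "1 \<le> b" "b < a" "a \<le> n"
  shows "tw a b = (if b = left_nb a then left_tw a else 1)"
proof -
  have "ip n (alpha g n a) (alpha g n b) =
      (if b = left_nb a then if g = SP \<and> a = n then - 2 else - 1 else 0)"
    unfolding left_nb_def ip_commute[of n "alpha g n a"] ip_alpha_less[OF rank assms]
    using assms rank by (cases g) (auto simp: simple_rank_def)
  then show ?thesis
    using assms(2) qpow_neg qpow_simps(1)[of L] by (auto simp: tw_def root_twist_def left_tw_def)
qed

lemma tw_le: "a \<le> b \<Longrightarrow> tw a b = 1"
  by (simp add: tw_def root_twist_def)

lemma twist_single_iv:
  assumes "1 \<le> k" "a \<le> n"
  shows "twist tw {#a#} (iv k l) =
    (if k \<le> left_nb a \<and> left_nb a < l \<and> left_nb a < a then left_tw a else 1)"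
proof (induction l)
  case (Suc l)
  define c where "c = left_nb a"
  show ?case
  proof (cases "k \<le> l")
    case True
    then have "iv k (Suc l) = iv k l + {#l#}" by simp
    then have "twist tw {#a#} (iv k (Suc l)) = twist tw {#a#} (iv k l) * tw a l"
      by (simp only: twist_simps)
    also have "tw a l = (if l = c \<and> l < a then left_tw a else 1)"
      using assms True tw_less[of l a] tw_le[of a l] unfolding c_def by (cases "l < a") auto
    finally show ?thesis
      unfolding Suc c_def[symmetric] using True by (cases "c = l") auto
  next
    case False
    then show ?thesis using Suc by auto
  qed
qed simp

lemma twist_iv_single:
  assumes "b \<le> a" shows "twist tw (iv k b) {#a#} = 1"
  using assms
proof (induction b)
  case (Suc b)
  then show ?case
    by (cases "k \<le> b") (simp_all add: tw_le twist_add_mset(1)[of _ _ "mset_set {k..<b}"])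
qed simp

lemma twist_iv_iv:
  assumes "1 \<le> k" "l \<le> a" "a < b" "b \<le> n"
  shows "twist tw (iv a b) (iv k l) = (if k < l \<and> l = a then qb else 1)"
proof -
  have "b \<le> n \<Longrightarrow> twist tw (iv a b) (iv k l) = (if k < l \<and> l = a then qb else 1)" if "Suc a \<le> b" for b
    using that
  proof (induction b rule: dec_induct)
    case base
    then show ?case using twist_single_iv[of k a l] assms
      by (auto simp: left_nb_def left_tw_def)
  next
    case (step b)
    have "iv a (Suc b) = iv a b + {#b#}" using step by simp
    then have "twist tw (iv a (Suc b)) (iv k l) = twist tw (iv a b) (iv k l) * twist tw {#b#} (iv k l)"
      by (simp only: twist_simps)
    then show ?case using step twist_single_iv[of k b l] assms
      by (auto simp: left_nb_def)
  qed
  then show ?thesis using assms by simp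
qed

abbreviation "pp \<equiv> 1 - qb ^ 2"

lemma dimN_eq: "dimN g n = 2 * n + of_bool (g = SO_odd)"
  by (cases g) (simp_all add: dimN_def)

lemma left_adjacent:
  assumes "2 * Suc a \<le> dimN g n + 1"
  shows "a \<le> n" "left_nb a = a - 1" "left_tw a = qb"
proof -
  have "a < n \<or> (g = SO_odd \<and> a = n)" using assms by (auto simp: dimN_eq of_bool_def split: if_splits)
  then show "a \<le> n" "left_nb a = a - 1" "left_tw a = qb"
    unfolding left_nb_def left_tw_def by auto
qed

text \<open>
  With \<open>t\<^sub>l\<^sub>+\<^sub>1 t\<^sub>l = q\<^sup>-\<^sup>1 t\<^sub>l t\<^sub>l\<^sub>+\<^sub>1\<close> the \<open>q\<^sup>-\<^sup>1\<close>-commutators of a lower chain cancel.  Those of an upper chain, in the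
  opposite order, give a factor \<open>1 - q\<^sup>-\<^sup>2\<close> each.
\<close>

lemma tv_chain_lo:
  assumes "1 \<le> i" "2 * (i + Suc d) \<le> dimN g n + 1"
  shows "tv (chain_lo L i d) (iv i (i + Suc d)) (of_bool (d = 0))"
  using assms
proof (induction d)
  case 0
  show ?case using torus_value_gen[of tw i] by simp
next
  case (Suc d)
  have IH: "tv (chain_lo L i d) (iv i (i + Suc d)) (of_bool (d = 0))" using Suc by auto
  have t: "twist tw {#i + Suc d#} (iv i (i + Suc d)) = qb"
    using Suc.prems twist_single_iv[of i "i + Suc d" "i + Suc d"] left_adjacent[of "i + Suc d"]
    by simp
  have u: "twist tw (iv i (i + Suc d)) {#i + Suc d#} = 1" by (rule twist_iv_single) simp
  have "{#i + Suc d#} + iv i (i + Suc d) = iv i (i + Suc (Suc d))" by simp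
  with torus_value_qcomm[OF torus_value_gen[of tw "i + Suc d"] IH, of qb, unfolded t u]
  show ?case by (simp del: upt_Suc)
qed

lemma tv_f_lo:
  assumes "1 \<le> i" "i < j" "2 * j \<le> dimN g n + 1"
  shows "tv (f_lo L i j) (iv i j) (of_bool (j = Suc i))"
proof -
  have "i + Suc (j - i - 1) = j" "j - i - 1 = 0 \<longleftrightarrow> j = Suc i" using assms by auto
  then show ?thesis using tv_chain_lo[of i "j - i - 1"] assms by (simp add: f_lo_def)
qed

lemma tv_chain_up:
  assumes "1 \<le> i" "2 * (i + Suc d) \<le> dimN g n + 1"
  shows "tv (chain_up L i d) (iv i (i + Suc d)) (pp ^ d)"
  using assms
proof (induction d)
  case 0
  show ?case using torus_value_gen[of tw i] by simp
next
  case (Suc d)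
  have IH: "tv (chain_up L i d) (iv i (i + Suc d)) (pp ^ d)" using Suc by auto
  have t: "twist tw {#i + Suc d#} (iv i (i + Suc d)) = qb"
    using Suc.prems twist_single_iv[of i "i + Suc d" "i + Suc d"] left_adjacent[of "i + Suc d"]
    by simp
  have u: "twist tw (iv i (i + Suc d)) {#i + Suc d#} = 1" by (rule twist_iv_single) simp
  have "iv i (i + Suc d) + {#i + Suc d#} = iv i (i + Suc (Suc d))" by simp
  with torus_value_qcomm[OF IH torus_value_gen[of tw "i + Suc d"], of qb, unfolded t u]
  show ?case by (simp del: upt_Suc add: power2_eq_square mult.commute)
qed

lemma tv_f_up:
  assumes "1 \<le> i" "i < j" "2 * j \<le> dimN g n + 1"
  shows "tv (f_up L i j) (iv i j) (pp ^ (j - i - 1))"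
proof -
  have "i + Suc (j - i - 1) = j" using assms by auto
  then show ?thesis using tv_chain_up[of i "j - i - 1"] assms by (simp add: f_up_def)
qed

abbreviation "pr \<equiv> prime_ix g n"
abbreviation "F \<equiv> f_el g n L"

lemma pr_eq: "pr x = dimN g n + 1 - x" by (simp add: prime_ix_def)

lemma f_el_lower:
  "1 \<le> i \<Longrightarrow> i < j \<Longrightarrow> 2 * j \<le> dimN g n + 1 \<Longrightarrow> F i j = f_lo L i j"
  by (auto simp: f_el_def)

lemma dimN_bounds: "2 * n \<le> dimN g n" "dimN g n \<le> 2 * n + 1"
  by (simp_all add: dimN_eq of_bool_def)

lemma f_el_upper:
  assumes "1 \<le> m" "m < l" "2 * l \<le> dimN g n + 1"
  shows "F (pr l) (pr m) = f_up L m l"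
proof -
  have "pr (pr l) = l" "pr (pr m) = m" using assms dimN_bounds by (simp_all add: pr_eq)
  moreover have "pr l \<noteq> pr m" "\<not> pr l > pr m" "\<not> 2 * pr m \<le> dimN g n + 1" "2 * pr l \<ge> dimN g n + 1"
    using assms dimN_bounds by (simp_all add: pr_eq)
  ultimately show ?thesis by (simp add: f_el_def)
qed

lemma f_el_cross:
  assumes "1 \<le> i" "i \<le> n" "1 \<le> m" "m \<le> n"
  shows "F i (pr m) = (case g of SO_odd \<Rightarrow> fB | SP \<Rightarrow> fC | SO_even \<Rightarrow> fD) n L i m"
proof -
  have "pr (pr m) = m" using assms dimN_bounds by (simp add: pr_eq)
  moreover have "i \<noteq> pr m" "\<not> i > pr m" "\<not> 2 * pr m \<le> dimN g n + 1" "\<not> 2 * i \<ge> dimN g n + 1"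
    using assms dimN_bounds by (simp_all add: pr_eq)
  ultimately show ?thesis by (simp add: f_el_def)
qed

text \<open>
  The sum over all routes from \<open>s\<close> through primed levels.  A stop at \<open>m'\<close> exchanges the neighbours \<open>t\<^sub>m\<close> and
  \<open>t\<^sub>m\<^sub>-\<^sub>1\<close> and so costs \<open>q\<^sup>-\<^sup>1\<close>; skipping \<open>m'\<close> costs \<open>B\<close> but saves one commutator, a factor
  \<open>1 - q\<^sup>-\<^sup>2\<close>.  So the level contributes \<open>q\<^sup>-\<^sup>1 + (1 - q\<^sup>-\<^sup>2) B\<close>, whatever the other stops are.  The value of a
  first step from \<open>s\<close> is a hypothesis, in terms of two parameters \<open>M\<close> and \<open>\<kappa>\<close>, in order to cover the sources
  next to the middle, where the formula for \<open>f\<^sub>s\<^sub>m\<^sub>'\<close> depends on the series; twists are included in the values of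
  the stops because there the first one may be irregular.
\<close>

lemma tv_path_sum_up:
  assumes "1 \<le> k" "k \<le> l" "l \<le> n" "l \<le> M"
    and "tv (F s (pr k)) \<mu> (pp ^ (M - k) * \<kappa>)"
    and "\<And>m. k < m \<Longrightarrow> m \<le> l \<Longrightarrow>
      \<exists>\<nu> v. tv (F s (pr m)) \<nu> v \<and> \<nu> + iv k m = \<mu> \<and> v * twist tw \<nu> (iv k m) = qb * pp ^ (M - m) * \<kappa>"
  shows "tv (path_sum F B s [pr l..<pr k] (pr k)) \<mu>
    (pp ^ (M - l) * \<kappa> * (\<Prod>m\<in>{k<..l}. qb * (1 + (q - qb) * B (pr m))))"
  using assms(2-)
proof (induction l arbitrary: s M \<mu> \<kappa> rule: dec_induct)
  case base
  then show ?case by simp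
next
  case (step l)
  have pr: "[pr (Suc l)..<pr k] = pr (Suc l) # [pr l..<pr k]"
  proof -
    have "Suc (pr (Suc l)) = pr l" "pr (Suc l) < pr k"
      using step assms(1) dimN_bounds by (simp_all add: pr_eq)
    then show ?thesis by (simp add: upt_conv_Cons)
  qed
  let ?P = "\<lambda>l. \<Prod>m\<in>{k<..l}. qb * (1 + (q - qb) * B (pr m))"
  have 1: "tv (path_sum F B s [pr l..<pr k] (pr k)) \<mu> (pp ^ (M - l) * \<kappa> * ?P l)"
    using step.prems by (intro step.IH) auto
  have 2: "tv (path_sum F B (pr (Suc l)) [pr l..<pr k] (pr k)) (iv k (Suc l)) (pp ^ (l - l) * 1 * ?P l)"
  proof (rule step.IH)
    show "tv (F (pr (Suc l)) (pr k)) (iv k (Suc l)) (pp ^ (l - k) * 1)"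
      using tv_f_up[of k "Suc l"] f_el_upper[of k "Suc l"] assms(1) step dimN_bounds by simp
    fix m assume m: "k < m" "m \<le> l"
    have "tv (F (pr (Suc l)) (pr m)) (iv m (Suc l)) (pp ^ (l - m))"
      using tv_f_up[of m "Suc l"] f_el_upper[of m "Suc l"] assms(1) step m dimN_bounds by simp
    moreover have "iv m (Suc l) + iv k m = iv k (Suc l)"
      using m upt_add_eq_append[of k m "Suc l - m"] by (simp del: upt_Suc add: add.commute)
    moreover have "twist tw (iv m (Suc l)) (iv k m) = qb"
      using m step.prems assms(1) by (subst twist_iv_iv) auto
    ultimately show "\<exists>\<nu> v. tv (F (pr (Suc l)) (pr m)) \<nu> v \<and> \<nu> + iv k m = iv k (Suc l) \<and>
        v * twist tw \<nu> (iv k m) = qb * pp ^ (l - m) * 1"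
      by (intro exI[of _ "iv m (Suc l)"] exI[of _ "pp ^ (l - m)"]) (simp add: mult.commute)
  qed (use step in auto)
  obtain \<nu> v where 3: "tv (F s (pr (Suc l))) \<nu> v" "\<nu> + iv k (Suc l) = \<mu>"
      "v * twist tw \<nu> (iv k (Suc l)) = qb * pp ^ (M - Suc l) * \<kappa>"
    using step.prems(4)[of "Suc l"] step.hyps by auto
  have "tv (path_sum F B s [pr (Suc l)..<pr k] (pr k)) \<mu>
      (B (pr (Suc l)) * (pp ^ (M - l) * \<kappa> * ?P l) + v * ?P l * twist tw \<nu> (iv k (Suc l)))"
    using torus_value_add[OF torus_value_scal_mult[OF 1] torus_value_mult[OF 3(1) 2, unfolded 3(2)]]
    by (simp add: pr)
  moreover have "B (pr (Suc l)) * (pp ^ (M - l) * \<kappa> * ?P l) + v * ?P l * twist tw \<nu> (iv k (Suc l)) =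
      pp ^ (M - Suc l) * \<kappa> * (?P l * (B (pr (Suc l)) * pp + qb))"
  proof -
    have "v * ?P l * twist tw \<nu> (iv k (Suc l)) = qb * pp ^ (M - Suc l) * \<kappa> * ?P l"
      by (simp flip: 3(3))
    moreover have "pp ^ (M - l) = pp * pp ^ (M - Suc l)"
      using step.prems by (metis Suc_diff_Suc Suc_le_eq power_Suc)
    moreover have "b * (p * x * \<kappa> * P) + c * x * \<kappa> * P = x * \<kappa> * (P * (b * p + c))"
      for b p x P c :: complex by (simp add: algebra_simps)
    ultimately show ?thesis by (simp only:)
  qed
  moreover have "?P l * (B (pr (Suc l)) * pp + qb) = ?P (Suc l)"
  proof -
    have "{k<..Suc l} = insert (Suc l) {k<..l}" using step by auto
    moreover have "B (pr (Suc l)) * pp + qb = qb * (1 + (q - qb) * B (pr (Suc l)))"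
      by (simp add: algebra_simps power2_eq_square)
    ultimately show ?thesis by (simp add: mult.commute)
  qed
  ultimately show ?case by simp
qed


lemma kernel_value: "tv x \<mu> 0 \<Longrightarrow> x \<in> torus_kernel"
  by (simp add: torus_kernel_def torus_eval_sandwich)

lemma kernel_add: "x \<in> torus_kernel \<Longrightarrow> y \<in> torus_kernel \<Longrightarrow> x + y \<in> torus_kernel"
  by (simp add: torus_kernel_def distrib_left distrib_right torus_eval_add)

lemma kernel_mult: "x \<in> torus_kernel \<Longrightarrow> y * x \<in> torus_kernel" "x \<in> torus_kernel \<Longrightarrow> x * y \<in> torus_kernel"
  by (simp_all add: torus_kernel_def flip: mult.assoc) (simp_all add: mult.assoc)

lemma kernel_eval: "x - y \<in> torus_kernel \<Longrightarrow> torus_eval tw x = torus_eval tw y"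
  using torus_eval_minus[of tw x y] unfolding torus_kernel_def by (metis (mono_tags, lifting) mem_Collect_eq
      eq_iff_diff_eq_0 mult_1_left mult_1_right)

lemma path_sum_kernel:
  "(\<And>b. b \<in> insert j (set ls) \<Longrightarrow> F a b \<in> torus_kernel) \<Longrightarrow> path_sum F B a ls j \<in> torus_kernel"
  by (induction ls) (auto intro!: kernel_add[OF kernel_mult(1) kernel_mult(2)])

lemma twist_nonzero: "twist tw \<mu> \<nu> \<noteq> 0"
proof -
  have "tw a b \<noteq> 0" for a b by (simp add: tw_def root_twist_def qpow_simps)
  then show ?thesis by (auto simp: twist_def prod_mset_zero_iff)
qed

text \<open>
  If below \<open>T\<close> only unit steps count, a route must visit all levels up to \<open>T\<close> and no factor \<open>B\<close> occurs for
  them.  So the part before \<open>T\<close> changes the value by a nonzero scalar \<open>z\<close> that is the same for all \<open>B\<close>.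
\<close>

lemma path_sum_unit_steps:
  assumes "i \<le> T"
    and "\<And>a. i \<le> a \<Longrightarrow> a < T \<Longrightarrow> F a (Suc a) = gen a"
    and "\<And>a b. i \<le> a \<Longrightarrow> a < T \<Longrightarrow> b \<in> insert j (set ls) \<or> (Suc a < b \<and> b \<le> T) \<Longrightarrow> F a b \<in> torus_kernel"
  shows "\<exists>z \<mu>'. z \<noteq> 0 \<and> (\<forall>B w. tv (path_sum F B T ls j) \<mu> w \<longrightarrow>
    (\<exists>X. path_sum F B i ([Suc i..<Suc T] @ ls) j - X \<in> torus_kernel \<and> tv X \<mu>' (z * w)))"
  using assms
proof (induction i rule: inc_induct)
  case base
  have "x - x \<in> torus_kernel" for x by (simp add: torus_kernel_def)
  then have "\<exists>X. path_sum F B T ls j - X \<in> torus_kernel \<and> tv X \<mu> w" if "tv (path_sum F B T ls j) \<mu> w" for B w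
    using that by blast
  then show ?case by (intro exI[of _ 1] exI[of _ \<mu>]) simp
next
  case (step i)
  obtain z \<mu>' where z: "z \<noteq> 0" and IH: "\<And>B w. tv (path_sum F B T ls j) \<mu> w \<Longrightarrow>
    (\<exists>X. path_sum F B (Suc i) ([Suc (Suc i)..<Suc T] @ ls) j - X \<in> torus_kernel \<and> tv X \<mu>' (z * w))"
    using step.IH step.prems by (metis Suc_leD)
  have "\<exists>X. path_sum F B i ([Suc i..<Suc T] @ ls) j - X \<in> torus_kernel \<and>
      tv X ({#i#} + \<mu>') (z * twist tw {#i#} \<mu>' * w)"
    if w: "tv (path_sum F B T ls j) \<mu> w" for B w
  proof -
    let ?ls = "[Suc (Suc i)..<Suc T] @ ls"
    obtain X where X: "path_sum F B (Suc i) ?ls j - X \<in> torus_kernel" "tv X \<mu>' (z * w)"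
      using IH[OF w] by blast
    have "[Suc i..<Suc T] = Suc i # [Suc (Suc i)..<Suc T]"
      using step.hyps by (simp add: upt_conv_Cons del: upt_Suc)
    then have "path_sum F B i ([Suc i..<Suc T] @ ls) j - gen i * X =
        scal (B (Suc i)) * path_sum F B i ?ls j + gen i * (path_sum F B (Suc i) ?ls j - X)"
      using step.prems(1)[of i] step.hyps by (simp add: algebra_simps del: upt_Suc)
    moreover have "path_sum F B i ?ls j \<in> torus_kernel"
      using step.prems(2)[of i] step.hyps by (intro path_sum_kernel) auto
    ultimately have "path_sum F B i ([Suc i..<Suc T] @ ls) j - gen i * X \<in> torus_kernel"
      using X(1) by (metis kernel_add kernel_mult(1))
    then show ?thesis
      using torus_value_mult[OF torus_value_gen[of tw i] X(2)] by (auto simp: mult_ac)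
  qed
  then show ?case
    using z twist_nonzero by (intro exI[of _ "z * twist tw {#i#} \<mu>'"] exI[of _ "{#i#} + \<mu>'"]) auto
qed

lemma iv_Suc: "m \<le> l \<Longrightarrow> iv m (Suc l) = iv m l + {#l#}" by simp

lemma iv_split: "m \<le> l \<Longrightarrow> l \<le> r \<Longrightarrow> iv l r + iv m l = iv m r"
  by (metis add.commute le_add_diff_inverse mset_append upt_add_eq_append)

lemma pp_factor: "pp = qb * (q - qb)"
  by (simp add: algebra_simps power2_eq_square)

lemma kernel_qcomm: "x \<in> torus_kernel \<or> y \<in> torus_kernel \<Longrightarrow> qcomm c x y \<in> torus_kernel"
proof -
  have "x - z \<in> torus_kernel" if "x \<in> torus_kernel" "z \<in> torus_kernel" for x z
    using that by (simp add: torus_kernel_def left_diff_distrib right_diff_distrib torus_eval_minus)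
  then show "x \<in> torus_kernel \<or> y \<in> torus_kernel \<Longrightarrow> qcomm c x y \<in> torus_kernel"
    unfolding qcomm_def by (metis kernel_mult)
qed

lemma f_lo_kernel:
  "1 \<le> i \<Longrightarrow> Suc i < j \<Longrightarrow> 2 * j \<le> dimN g n + 1 \<Longrightarrow> f_lo L i j \<in> torus_kernel"
  using tv_f_lo[of i j] by (auto intro!: kernel_value)

lemma f_lo_unit: "f_lo L i (Suc i) = gen i"
  by (simp add: f_lo_def)

text \<open>
  An element \<open>f\<^sub>i\<^sub>m\<^sub>'\<close> that crosses the middle is a commutator with a lower chain from \<open>i\<close>, so it has the value 0
  unless this chain is a single generator.  For \<open>i < n\<close> in the series \<open>SP\<close>, and for \<open>i < n - 1\<close> in the
  series \<open>SO_even\<close>, a commutator with a single generator cancels as well: its parameter is just the scalar by which the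
  two factors commute.
\<close>

lemma fB_kernel:
  assumes "g = SO_odd" "1 \<le> i" "i < n"
  shows "fB n L i m \<in> torus_kernel"
  unfolding fB_def Let_def using assms
  by (intro kernel_mult(1) kernel_qcomm disjI2 f_lo_kernel) (auto simp: dimN_def)

lemma odd_top:
  assumes "g = SO_odd"
  shows "dimN g n = 2 * n + 1" "left_nb n = n - 1" "left_tw n = qb"
  unfolding left_nb_def left_tw_def using assms by (auto simp: dimN_def)

lemma tv_fB:
  assumes o: "g = SO_odd" and m: "1 \<le> m" "m \<le> n"
  shows "tv (fB n L n m) (iv m (n + 1) + {#n#}) (if m = n then q - 1 else pp ^ (n - m) * (1 - qb))"
proof (cases "m = n")
  case True
  then show ?thesis
    using torus_value_scal_mult[OF torus_value_qcomm[OF torus_value_gen[of tw n] torus_value_gen[of tw n],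
          of qb], of q]
    by (simp add: fB_def f_lo_def f_up_def algebra_simps)
next
  case False
  have up: "tv (f_up L m (n + 1)) (iv m (n + 1)) (pp ^ (n - m))"
    using tv_f_up[of m "n + 1"] m odd_top[OF o] by simp
  have t: "twist tw {#n#} (iv m (n + 1)) = qb" "twist tw (iv m (n + 1)) {#n#} = 1"
    using twist_single_iv[of m n "n + 1"] m False odd_top[OF o] twist_iv_single[of n n m]
    by (auto simp add: tw_le twist_add_mset(1)[of _ _ "mset_set {m..<n}"])
  from torus_value_qcomm[OF up torus_value_gen[of tw n], of 1, unfolded t]
  show ?thesis using False torus_value_scal_mult[of tw _ _ _ 1]
    by (simp add: fB_def f_lo_def del: upt_Suc)
qed

lemma fC_right_value:
  assumes "g = SP" "1 \<le> m" "m < n"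
  shows "tv (fC_right n L m) (iv m n + {#n#}) (pp ^ (n - m - 1) * (1 - qb ^ 4))"
proof -
  have up: "tv (f_up L m n) (iv m n) (pp ^ (n - m - 1))"
    using tv_f_up[of m n] assms(2,3) dimN_bounds by simp
  have t: "twist tw {#n#} (iv m n) = qb ^ 2" "twist tw (iv m n) {#n#} = 1"
    using twist_single_iv[of m n n] assms twist_iv_single[of n n m]
    unfolding left_nb_def left_tw_def by auto
  from torus_value_qcomm[OF up torus_value_gen[of tw n], of "qb ^ 2", unfolded t]
  show ?thesis by (simp add: fC_right_def flip: power_add)
qed

lemma fC_kernel:
  assumes C: "g = SP" and i: "1 \<le> i" "i < n" and m: "1 \<le> m" "m \<le> n"
  shows "fC n L i m \<in> torus_kernel"
proof (cases "m = n")
  case True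
  have lo: "tv (f_lo L i n) (iv i n) (of_bool (n = Suc i))"
    using tv_f_lo[of i n] i by (simp add: dimN_eq)
  have t: "twist tw {#n#} (iv i n) = qb ^ 2" "twist tw (iv i n) {#n#} = 1"
    using twist_single_iv[of i n n] i C twist_iv_single[of n n i]
    unfolding left_nb_def left_tw_def by auto
  from torus_value_qcomm[OF torus_value_gen[of tw n] lo, of "qb ^ 2", unfolded t]
  have "fC_left n L i \<in> torus_kernel" by (simp add: fC_left_def kernel_value)
  then show ?thesis using True i by (simp add: fC_def)
next
  case False
  have "qcomm (qb ^ (1 + of_bool (i = m))) (fC_right n L m) (f_lo L i n) \<in> torus_kernel"
  proof (cases "Suc i < n")
    case True
    then show ?thesis using i dimN_bounds by (intro kernel_qcomm disjI2 f_lo_kernel) auto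
  next
    case False
    then have n: "n = Suc i" using i by simp
    have r: "tv (fC_right n L m) (iv m n + {#n#}) (pp ^ (n - m - 1) * (1 - qb ^ 4))"
      using fC_right_value C m \<open>m \<noteq> n\<close> by simp
    have "twist tw (iv m n) {#i#} = 1"
      using m \<open>m \<noteq> n\<close> twist_iv_single[of i i m] n tw_le[of i i]
      by (simp add: twist_add_mset(1)[of _ _ "mset_set {m..<i}"])
    moreover have "tw n i = qb ^ 2"
      using tw_less[of i n] i n C unfolding left_nb_def left_tw_def by auto
    ultimately have t1: "twist tw (iv m n + {#n#}) {#i#} = qb ^ 2"
      unfolding twist_simps by simp
    have "twist tw {#i#} (iv m n) = (if m = i then 1 else qb)"
      using twist_single_iv[of m i n] i n m \<open>m \<noteq> n\<close>
      unfolding left_nb_def left_tw_def by auto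
    then have t2: "twist tw {#i#} (iv m n + {#n#}) = (if m = i then 1 else qb)"
      unfolding twist_simps using tw_le[of i n] i by simp
    from torus_value_qcomm[OF r torus_value_gen[of tw i], of "qb ^ (1 + of_bool (i = m))", unfolded t1 t2]
    moreover have "f_lo L i n = gen i" by (simp add: n f_lo_unit)
    ultimately show ?thesis by (auto simp: power2_eq_square intro!: kernel_value split: if_splits)
  qed
  then show ?thesis using False i by (simp add: fC_def Let_def kernel_mult)
qed

lemma tv_fC:
  assumes C: "g = SP" and m: "1 \<le> m" "m \<le> n"
  shows "tv (fC n L n m) (iv m n + {#n#})
    (if m = n then q + qb else pp ^ (n - m - 1) * (1 - qb ^ 4))"
proof (cases "m = n")
  case True
  have "qint q 2 = q + qb"
    using q_sub_qb by (simp add: qint_def field_simps power2_eq_square)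
  then show ?thesis
    using torus_value_scal_mult[OF torus_value_gen[of tw n], of "q + qb"] True
    by (simp add: fC_def)
next
  case False
  then show ?thesis using fC_right_value[OF C m(1)] m by (simp add: fC_def)
qed

lemma tv_fD_right:
  assumes D: "g = SO_even" and m: "1 \<le> m" "m < n"
  shows "tv (fD_right n L m) (iv m (n - 1) + {#n#}) (pp ^ (n - 1 - m))"
proof (cases "m = n - 1")
  case True
  then show ?thesis using torus_value_gen[of tw n] by (simp add: fD_right_def)
next
  case False
  have up: "tv (f_up L m (n - 1)) (iv m (n - 1)) (pp ^ (n - m - 2))"
    using tv_f_up[of m "n - 1"] m False dimN_bounds by (simp add: numeral_2_eq_2)
  have t: "twist tw {#n#} (iv m (n - 1)) = qb" "twist tw (iv m (n - 1)) {#n#} = 1"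
    using twist_single_iv[of m n "n - 1"] m False twist_iv_single[of "n - 1" n m] D
    unfolding left_nb_def left_tw_def by auto
  have "n - 1 - m = Suc (n - m - 2)" using m False by simp
  then show ?thesis
    using torus_value_qcomm[OF up torus_value_gen[of tw n], of qb, unfolded t] False
    by (simp add: fD_right_def power2_eq_square mult.commute)
qed

lemma fD_kernel:
  assumes D: "g = SO_even" and i: "1 \<le> i" "i < n - 1" and m: "1 \<le> m" "m \<le> n"
  shows "fD n L i m \<in> torus_kernel"
proof (cases "m = n")
  case True
  have lo: "tv (f_lo L i (n - 1)) (iv i (n - 1)) (of_bool (n - 1 = Suc i))"
    using tv_f_lo[of i "n - 1"] i dimN_bounds by simp
  have t: "twist tw {#n#} (iv i (n - 1)) = qb" "twist tw (iv i (n - 1)) {#n#} = 1"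
    using twist_single_iv[of i n "n - 1"] i D twist_iv_single[of "n - 1" n i]
    unfolding left_nb_def left_tw_def by auto
  from torus_value_qcomm[OF torus_value_gen[of tw n] lo, of qb, unfolded t]
  have "fD_left n L i \<in> torus_kernel" using i by (simp add: fD_left_def kernel_value)
  then show ?thesis using True i by (auto simp: fD_def)
next
  case False
  then show ?thesis using i m dimN_bounds
    by (auto simp: fD_def Let_def intro!: kernel_mult(1) kernel_qcomm f_lo_kernel)
qed

lemma tv_fD:
  assumes D: "g = SO_even" and m: "1 \<le> m" "m \<le> n - 1" and n: "n \<ge> 2"
  shows "tv (fD n L (n - 1) m) (iv m (n - 1) + {#n#} + {#n - 1#})
    (if m = n - 1 then q * pp else pp ^ (n - m))"
proof -
  have "tw n (n - 1) = 1"
    using tw_less[of "n - 1" n] n D unfolding left_nb_def by auto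
  then have t1: "twist tw (iv m (n - 1) + {#n#}) {#n - 1#} = 1"
    using twist_iv_single[of "n - 1" "n - 1" m] by (simp only: twist_simps) simp
  have "twist tw {#n - 1#} (iv m (n - 1)) = (if m = n - 1 then 1 else qb)"
    using twist_single_iv[of m "n - 1" "n - 1"] m n unfolding left_nb_def left_tw_def by auto
  then have t2: "twist tw {#n - 1#} (iv m (n - 1) + {#n#}) = (if m = n - 1 then 1 else qb)"
    unfolding twist_simps using tw_le[of "n - 1" n] by simp
  have r: "tv (fD_right n L m) (iv m (n - 1) + {#n#}) (pp ^ (n - 1 - m))"
    using tv_fD_right[OF D m(1)] m n by simp
  define e where "e = (of_bool (n - 1 = m) :: nat)"
  have "f_lo L (n - 1) n = gen (n - 1)" using f_lo_unit[of "n - 1"] n by simp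
  then have "fD n L (n - 1) m = scal (q ^ e) * qcomm (qb ^ (1 + e)) (fD_right n L m) (gen (n - 1))"
    using m n by (auto simp: fD_def Let_def e_def)
  then have "tv (fD n L (n - 1) m) (iv m (n - 1) + {#n#} + {#n - 1#})
      (q ^ e * (pp ^ (n - 1 - m) * 1 * (1 - qb ^ (1 + e) * (if m = n - 1 then 1 else qb))))"
    using torus_value_scal_mult[OF torus_value_qcomm[OF r torus_value_gen[of tw "n - 1"],
          of "qb ^ (1 + e)", unfolded t1 t2], of "q ^ e"] by simp
  moreover have "pp ^ (n - m) = pp * pp ^ (n - 1 - m)" if "m \<noteq> n - 1"
  proof -
    have "n - m = Suc (n - 1 - m)" using that m n by simp
    then show ?thesis by (metis power_Suc)
  qed
  ultimately show ?thesis
    by (auto simp: e_def power2_eq_square mult.commute)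
qed

section \<open>The torus value of the element with a check\<close>

text \<open>
  \<open>(\<lambda> + \<rho>, \<epsilon>\<^sub>l)\<close>, in terms of which the \<open>\<eta>\<^sub>l\<^sub>j\<close> are simple.  It is odd under \<open>l \<mapsto> l'\<close>, and
  the identities between the \<open>y\<^sub>l\<close> follow from this.
\<close>

definition "shifted_coord lam l = h_fun n (eps g n l) lam + rho_ix g n l"

lemma eps_pr: "1 \<le> l \<Longrightarrow> l \<le> n \<Longrightarrow> eps g n (pr l) = (\<lambda>x. - eps g n l x)"
  using dimN_bounds by (intro ext) (auto simp: eps_def pr_eq)

lemma eps_mid: "g = SO_odd \<Longrightarrow> eps g n (n + 1) = (\<lambda>x. 0)"
  by (intro ext) (auto simp: eps_def prime_ix_def dimN_def)

lemma h_fun_linear: "h_fun n (\<lambda>x. - \<mu> x) lam = - h_fun n \<mu> lam" "h_fun n (\<lambda>x. 0) lam = 0"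
  by (simp_all add: h_fun_def sum_negf)

lemma shifted_coord_pr: "1 \<le> l \<Longrightarrow> l \<le> n \<Longrightarrow> shifted_coord lam (pr l) = - shifted_coord lam l"
  by (simp add: shifted_coord_def rho_ix_def eps_pr h_fun_linear)

lemma shifted_coord_mid: "g = SO_odd \<Longrightarrow> shifted_coord lam (n + 1) = 0"
  unfolding shifted_coord_def rho_ix_def eps_mid h_fun_linear by simp

lemma ip_neg: "ip n (\<lambda>k. - u k) v = - ip n u v" "ip n v (\<lambda>k. - u k) = - ip n v u"
   "ip n (\<lambda>k. 0) v = 0" "ip n v (\<lambda>k. 0) = 0"
  by (simp_all add: ip_def sum_negf)

lemma eta_Hf:
  "eta g n l j lam = shifted_coord lam l - shifted_coord lam j -
     of_int (ip n (\<lambda>k. eps g n l k - eps g n j k) (\<lambda>k. eps g n l k - eps g n j k)) / 2"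
  by (simp add: eta_def shifted_coord_def Let_def)

lemma eta_values:
  assumes k: "1 \<le> k" "k \<le> n"
  shows "eta g n k (pr k) lam = 2 * shifted_coord lam k - 2"
    and "1 \<le> l \<Longrightarrow> l \<le> n \<Longrightarrow> l \<noteq> k \<Longrightarrow> eta g n l (pr k) lam = shifted_coord lam l + shifted_coord lam k - 1"
    and "1 \<le> l \<Longrightarrow> l \<le> n \<Longrightarrow> l \<noteq> k \<Longrightarrow> eta g n (pr l) (pr k) lam = - shifted_coord lam l + shifted_coord lam k - 1"
    and "g = SO_odd \<Longrightarrow> eta g n (n + 1) (pr k) lam = shifted_coord lam k - 1 / 2"
proof -
  note 1 = eta_Hf shifted_coord_pr eps_pr ip_linear ip_neg ip_eps_low k
  show "eta g n k (pr k) lam = 2 * shifted_coord lam k - 2" using k by (simp add: 1)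
  show "1 \<le> l \<Longrightarrow> l \<le> n \<Longrightarrow> l \<noteq> k \<Longrightarrow> eta g n l (pr k) lam = shifted_coord lam l + shifted_coord lam k - 1"
    using k by (simp add: 1)
  show "1 \<le> l \<Longrightarrow> l \<le> n \<Longrightarrow> l \<noteq> k \<Longrightarrow> eta g n (pr l) (pr k) lam = - shifted_coord lam l + shifted_coord lam k - 1"
    using k by (simp add: 1)
  show "eta g n (n + 1) (pr k) lam = shifted_coord lam k - 1 / 2" if "g = SO_odd"
    using k shifted_coord_mid[OF that, of lam] eps_mid[OF that] by (simp add: 1)
qed

lemma f_el_cross_cases:
  assumes "1 \<le> i" "i \<le> n" "1 \<le> m" "m \<le> n"
  shows "g = SO_odd \<Longrightarrow> F i (pr m) = fB n L i m" "g = SP \<Longrightarrow> F i (pr m) = fC n L i m"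
    "g = SO_even \<Longrightarrow> F i (pr m) = fD n L i m"
  unfolding f_el_cross[OF assms] by simp_all

abbreviation "yv j l lam \<equiv> y_fun g n L j l lam"

lemma y_nonzero: "yv j l lam \<noteq> 0"
  by (simp add: y_fun_def qpow_simps)

lemma y_pair:
  assumes "1 \<le> k" "k \<le> n" "1 \<le> l" "l \<le> n" "l \<noteq> k"
  shows "yv (pr k) l lam * yv (pr k) (pr l) lam = yv (pr k) k lam"
  unfolding y_fun_def eta_values(1)[OF assms(1,2)] eta_values(2,3)[OF assms]
  by (simp add: algebra_simps flip: qpow_simps(2))

lemma y_mid:
  assumes "1 \<le> k" "k \<le> n" "g = SO_odd"
  shows "(q * yv (pr k) (n + 1) lam) ^ 2 = yv (pr k) k lam"
  unfolding y_fun_def eta_values(1)[OF assms(1,2)] eta_values(4)[OF assms]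
  by (simp add: algebra_simps power2_eq_square flip: qpow_simps(2))

abbreviation "A' j lam \<equiv> \<lambda>l. A_inv g n L j l lam"

lemma A_inv_y: "1 + (q - qb) * A' j lam l = yv j l lam"
  using q_sub_qb by (simp add: A_inv_def)

lemma delta_odd:
  assumes o: "g = SO_odd" and k: "1 \<le> k" "k \<le> n"
  shows "delta g n L (pr k) lam = (q * yv (pr k) (n + 1) lam + 1) / (q + 1)"
proof -
  have "\<not> pr k < s_prime g n" using k by (auto simp: s_prime_def o prime_ix_def dimN_def)
  then show ?thesis by (simp add: delta_def o)
qed

lemma q_add_1: "q + 1 \<noteq> 0"
  using q_power_nonunit[of 2] by (auto simp: eq_neg_iff_add_eq_0[symmetric])

text \<open>
  This is where \<open>\<delta>\<^sub>j\<close> arises in the odd orthogonal series: the left side collects the contributions of the routes that skip and of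
  those that visit the level \<open>*\<close>.
\<close>

lemma A_inv_mid:
  assumes "g = SO_odd" "1 \<le> k" "k \<le> n"
  shows "A' (pr k) lam (n + 1) * (q - 1) + 1 = delta g n L (pr k) lam"
proof -
  have "q - 1 \<noteq> 0" using q_power_nonunit[of 1] by simp
  moreover have "q - qb = (q - 1) * (q + 1) / q" by (simp add: field_simps)
  ultimately have "A' (pr k) lam (n + 1) * (q - 1) = (yv (pr k) (n + 1) lam - 1) * q / (q + 1)"
    by (simp add: A_inv_def)
  then show ?thesis using q_add_1 by (simp add: delta_odd[OF assms] field_simps)
qed

lemma delta_even:
  assumes D: "g = SO_even" and k: "1 \<le> k" "k \<le> n - 1"
  shows "delta g n L (pr k) lam = A' (pr k) lam k"
proof -
  have "s_prime g n = pr (n - 1)" by (simp add: s_prime_def D)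
  then have "pr (pr k) = k" "\<not> pr k < s_prime g n"
    using k dimN_bounds by (simp_all add: pr_eq)
  then show ?thesis by (simp add: delta_def D A_inv_def)
qed

text \<open>
  The relation \<open>y\<^sub>l y\<^sub>l\<^sub>' = y\<^sub>k\<close> written in terms of the \<open>B\<^sub>l = A\<^sub>l\<^sup>-\<^sup>1\<close>.
\<close>

lemma A_inv_pair:
  assumes "1 \<le> k" "k \<le> n" "1 \<le> l" "l \<le> n" "l \<noteq> k"
  shows "(q - qb) * (A' (pr k) lam l * A' (pr k) lam (pr l)) =
      A' (pr k) lam k - A' (pr k) lam l - A' (pr k) lam (pr l)"
    and "A' (pr k) lam l * A' (pr k) lam (pr l) =
      - inverse (q - qb) * A' (pr k) lam l - inverse (q - qb) * A' (pr k) lam (pr l) +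
      A' (pr k) lam k * inverse (q - qb)"
proof -
  let ?B = "A' (pr k) lam l" and ?B' = "A' (pr k) lam (pr l)" and ?c = "q - qb"
  have "(1 + ?c * ?B) * (1 + ?c * ?B') = 1 + ?c * A' (pr k) lam k"
    unfolding A_inv_y using assms by (rule y_pair)
  then have "?c * (?c * (?B * ?B')) = ?c * (A' (pr k) lam k - ?B - ?B')"
    by (simp add: algebra_simps)
  then show c: "?c * (?B * ?B') = A' (pr k) lam k - ?B - ?B'" using q_sub_qb by simp
  then have "inverse ?c * (?c * (?B * ?B')) = inverse ?c * (A' (pr k) lam k - ?B - ?B')" by simp
  moreover have "inverse ?c * (?c * (?B * ?B')) = ?B * ?B'"
    using q_sub_qb by (simp add: mult.assoc[symmetric])
  ultimately show "?B * ?B' = - inverse ?c * ?B - inverse ?c * ?B' + A' (pr k) lam k * inverse ?c"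
    by (simp add: algebra_simps)
qed

definition "y_prod k T lam = (\<Prod>m\<in>{k<..T}. qb * yv (pr k) (pr m) lam)"

lemmas tv_path_sum_up_y = tv_path_sum_up[where B = "A' (pr k) lam" and k = k for k lam, unfolded A_inv_y,
  folded y_prod_def]

text \<open>
  From \<open>n\<close> the routes either skip the level \<open>*\<close> or visit it.  Both \<open>n\<close> and \<open>*\<close> are sources as in
  \<open>tv_path_sum_up\<close> with the same product over the primed levels, and the two coefficients add up to
  \<open>\<delta>\<^sub>j\<close>, up to a scalar.
\<close>

lemma torus_value_middle_odd:
  assumes o: "g = SO_odd" and k: "1 \<le> k" "k \<le> n"
  shows "\<exists>\<mu> z. z \<noteq> 0 \<and> (\<forall>lam. tv (path_sum F (A' (pr k) lam) n [n + 1..<pr k] (pr k)) \<mu>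
    (z * delta g n L (pr k) lam * y_prod k n lam))"
proof -
  have prn: "pr n = Suc (n + 1)" "Suc n < pr k" "pr (Suc n) = Suc n"
    using k odd_top[OF o] by (simp_all add: pr_eq)
  have ls: "[n + 1..<pr k] = (n + 1) # [pr n..<pr k]"
    using prn by (simp add: upt_conv_Cons)
  have up: "F (n + 1) (pr m) = f_up L m (n + 1)" "tv (f_up L m (n + 1)) (iv m (n + 1)) (pp ^ (n - m))"
    if "1 \<le> m" "m \<le> n" for m
    using f_el_upper[of m "n + 1"] tv_f_up[of m "n + 1"] that odd_top[OF o] prn(3) by simp_all
  have tw_n: "twist tw {#n#} (iv m n) = (if m = n then 1 else qb)" if "1 \<le> m" "m \<le> n" for m
    using twist_single_iv[of m n n] that odd_top[OF o] by auto
  have tw_mid: "twist tw (iv m (n + 1)) (iv k m) = qb" if "k < m" "m \<le> n" for m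
  proof (cases "m = n")
    case True
    then show ?thesis using tw_n[of k] that k by simp
  next
    case False
    have "iv m (n + 1) = iv m n + {#n#}" using that by simp
    moreover have "twist tw (iv m n) (iv k m) = qb" using twist_iv_iv[of k m m n] that k False by simp
    moreover have "twist tw {#n#} (iv k m) = 1"
      using twist_single_iv[of k n m] k that odd_top[OF o] False by auto
    ultimately show ?thesis by (simp only: twist_simps mult_1_right)
  qed
  have mid: "tv (path_sum F (A' (pr k) lam) (n + 1) [pr n..<pr k] (pr k)) (iv k (n + 1))
      (pp ^ (n - n) * 1 * y_prod k n lam)" for lam
  proof (rule tv_path_sum_up_y)
    show "tv (F (n + 1) (pr k)) (iv k (n + 1)) (pp ^ (n - k) * 1)" using up[of k] k by simp
    fix m assume m: "k < m" "m \<le> n"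
    then show "\<exists>\<nu> v. tv (F (n + 1) (pr m)) \<nu> v \<and> \<nu> + iv k m = iv k (n + 1) \<and>
        v * twist tw \<nu> (iv k m) = qb * pp ^ (n - m) * 1"
      using up[of m] tw_mid[of m] iv_split[of k m "n + 1"] k
      by (intro exI[of _ "iv m (n + 1)"] exI[of _ "pp ^ (n - m)"]) (simp del: upt_Suc)
  qed (use k in auto)
  have cross: "tv (F n (pr m)) (iv m (n + 1) + {#n#}) (if m = n then q - 1 else pp ^ (n - m) * (1 - qb))"
    if "1 \<le> m" "m \<le> n" for m
    using tv_fB[OF o that] f_el_cross_cases(1)[OF _ _ that o, of n] that by (simp del: upt_Suc)
  define t where "t = (if k = n then 1 else qb)"
  define \<kappa> where "\<kappa> = (if k = n then q - 1 else 1 - qb)"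
  have first: "tv (path_sum F (A' (pr k) lam) n [pr n..<pr k] (pr k)) (iv k (n + 1) + {#n#})
      (\<kappa> * y_prod k n lam)" for lam
  proof (cases "k = n")
    case True
    then show ?thesis using cross[of n] k by (simp add: y_prod_def \<kappa>_def)
  next
    case False
    have "tv (path_sum F (A' (pr k) lam) n [pr n..<pr k] (pr k)) (iv k (n + 1) + {#n#})
      (pp ^ (n - n) * (1 - qb) * y_prod k n lam)"
    proof (rule tv_path_sum_up_y)
      show "tv (F n (pr k)) (iv k (n + 1) + {#n#}) (pp ^ (n - k) * (1 - qb))"
        using cross[of k] k False by simp
      fix m assume m: "k < m" "m \<le> n"
      have "iv m (n + 1) + {#n#} + iv k m = iv k (n + 1) + {#n#}"
        using iv_split[of k m "n + 1"] m by (simp del: upt_Suc add: union_commute)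
      moreover have "twist tw (iv m (n + 1) + {#n#}) (iv k m) = (if m = n then qb ^ 2 else qb)"
      proof (cases "m = n")
        case True
        then show ?thesis using tw_mid[OF m] tw_n[of k] k m unfolding twist_simps
          by (simp add: power2_eq_square)
      next
        case False
        have "twist tw {#n#} (iv k m) = 1"
          using twist_single_iv[of k n m] k m odd_top[OF o] False by auto
        then show ?thesis using tw_mid[OF m] False unfolding twist_simps by simp
      qed
      moreover have "(q - 1) * qb ^ 2 = qb * (1 - qb)"
        by (simp add: field_simps power2_eq_square)
      ultimately show "\<exists>\<nu> v. tv (F n (pr m)) \<nu> v \<and> \<nu> + iv k m = iv k (n + 1) + {#n#} \<and>
          v * twist tw \<nu> (iv k m) = qb * pp ^ (n - m) * (1 - qb)"
        using cross[of m] m k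
        by (intro exI[of _ "iv m (n + 1) + {#n#}"]
            exI[of _ "if m = n then q - 1 else pp ^ (n - m) * (1 - qb)"]) (simp del: upt_Suc)
    qed (use k in auto)
    then show ?thesis using False by (simp add: \<kappa>_def)
  qed
  have gen: "F n (n + 1) = gen n"
    using f_el_lower[of n "n + 1"] k odd_top[OF o] f_lo_unit[of n] by simp
  have t: "twist tw {#n#} (iv k (n + 1)) = t"
    using tw_n[of k] k by (simp add: t_def iv_Suc[of k n, simplified] tw_le
        twist_add_mset(2)[of _ _ n "mset_set {k..<n}"])
  have "tv (path_sum F (A' (pr k) lam) n [n + 1..<pr k] (pr k)) (iv k (n + 1) + {#n#})
      (t * delta g n L (pr k) lam * y_prod k n lam)" for lam
  proof -
    have "tv (path_sum F (A' (pr k) lam) n [n + 1..<pr k] (pr k)) (iv k (n + 1) + {#n#})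
      (A' (pr k) lam (n + 1) * (\<kappa> * y_prod k n lam) + y_prod k n lam * t)"
      using torus_value_add[OF torus_value_scal_mult[OF first]
          torus_value_mult[OF torus_value_gen[of tw n] mid, of lam, unfolded t
            add.commute[of "{#n#}"]], of "A' (pr k) lam (n + 1)" lam]
      unfolding ls path_sum.simps gen by (simp del: upt_Suc)
    moreover have "\<kappa> = t * (q - 1)" by (simp add: \<kappa>_def t_def algebra_simps)
    moreover have "A' (pr k) lam (n + 1) * (q - 1) + 1 = delta g n L (pr k) lam"
      by (rule A_inv_mid[OF o k])
    moreover have "a * (t * (q - 1) * Y) + Y * t = t * (a * (q - 1) + 1) * Y" for a Y
      by (simp add: algebra_simps)
    ultimately show ?thesis by (metis (no_types))
  qed
  moreover have "t \<noteq> 0" by (simp add: t_def)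
  ultimately show ?thesis by blast
qed

text \<open>
  Here \<open>n\<close> itself is a source as in \<open>tv_path_sum_up\<close>.  In the hypothesis on its first step \<open>\<kappa>\<close> is
  \<open>1 + q\<^sup>-\<^sup>2\<close>, because \<open>1 - q\<^sup>-\<^sup>4\<close> takes the place of one factor \<open>1 - q\<^sup>-\<^sup>2\<close>.
\<close>

lemma torus_value_middle_symplectic:
  assumes C: "g = SP" and k: "1 \<le> k" "k \<le> n"
  shows "\<exists>\<mu> z. z \<noteq> 0 \<and> (\<forall>lam. tv (path_sum F (A' (pr k) lam) n [n + 1..<pr k] (pr k)) \<mu>
    (z * y_prod k n lam))"
proof -
  have prn: "pr n = n + 1" unfolding pr_eq C dimN_def prime_ix_def by simp
  have cross: "tv (F n (pr m)) (iv m n + {#n#})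
      (if m = n then q + qb else pp ^ (n - m - 1) * (1 - qb ^ 4))"
    if "1 \<le> m" "m \<le> n" for m
    using tv_fC[OF C that] f_el_cross_cases(2)[OF _ _ that C, of n] that by simp
  show ?thesis
  proof (cases "k = n")
    case True
    then show ?thesis
      using cross[of n] k q_add_qb prn
      by (intro exI[of _ "iv n n + {#n#}"] exI[of _ "q + qb"]) (simp add: y_prod_def)
  next
    case False
    have pow: "pp ^ (n - m - 1) * (1 - qb ^ 4) = pp ^ (n - m) * (1 + qb ^ 2)" if "m < n" for m
    proof -
      have "n - m = Suc (n - m - 1)" using that by simp
      then have "pp ^ (n - m) = pp * pp ^ (n - m - 1)" by (metis power_Suc)
      moreover have "1 - qb ^ 4 = pp * (1 + qb ^ 2)" by (simp add: algebra_simps flip: power_add)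
      ultimately show ?thesis by simp
    qed
    have cross': "tv (F n (pr m)) (iv m n + {#n#})
        (if m = n then q + qb else pp ^ (n - m) * (1 + qb ^ 2))" if "1 \<le> m" "m \<le> n" for m
      using cross[OF that] pow[of m] that by (cases "m = n") auto
    have "tv (path_sum F (A' (pr k) lam) n [pr n..<pr k] (pr k)) (iv k n + {#n#})
      (pp ^ (n - n) * (1 + qb ^ 2) * y_prod k n lam)" for lam
    proof (rule tv_path_sum_up_y)
      show "tv (F n (pr k)) (iv k n + {#n#}) (pp ^ (n - k) * (1 + qb ^ 2))"
        using cross'[of k] k False by simp
      fix m assume m: "k < m" "m \<le> n"
      have "iv m n + {#n#} + iv k m = iv k n + {#n#}"
        using iv_split[of k m n] m by (simp del: upt_Suc add: union_commute)
      moreover have "twist tw (iv m n + {#n#}) (iv k m) = (if m = n then qb ^ 2 else qb)"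
      proof (cases "m = n")
        case True
        then show ?thesis using twist_single_iv[of k n n] k m C
          unfolding twist_simps left_nb_def left_tw_def by auto
      next
        case False
        have "twist tw {#n#} (iv k m) = 1"
          using twist_single_iv[of k n m] k m C False unfolding left_nb_def left_tw_def by auto
        then show ?thesis using twist_iv_iv[of k m m n] m k False unfolding twist_simps by simp
      qed
      moreover have "(q + qb) * qb ^ 2 = qb * (1 + qb ^ 2)"
        by (simp add: field_simps power2_eq_square)
      ultimately show "\<exists>\<nu> v. tv (F n (pr m)) \<nu> v \<and> \<nu> + iv k m = iv k n + {#n#} \<and>
          v * twist tw \<nu> (iv k m) = qb * pp ^ (n - m) * (1 + qb ^ 2)"
        using cross'[of m] m k
        by (intro exI[of _ "iv m n + {#n#}"]
            exI[of _ "if m = n then q + qb else pp ^ (n - m) * (1 + qb ^ 2)"]) (simp del: upt_Suc)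
    qed (use k in auto)
    moreover have "1 + qb ^ 2 \<noteq> 0"
      using q_add_qb by (simp add: field_simps power2_eq_square)
    ultimately show ?thesis by (auto simp: prn)
  qed
qed


text \<open>
  From \<open>n - 1\<close> the routes visit \<open>n\<close>, visit \<open>n'\<close>, or skip both.  The three sources \<open>n - 1\<close>, \<open>n\<close> and \<open>n'\<close> lead to the same
  product over the primed levels, with the coefficients \<open>(q - q\<^sup>-\<^sup>1) B\<^sub>n B\<^sub>n\<^sub>'\<close>, \<open>B\<^sub>n\<^sub>'\<close> and \<open>B\<^sub>n\<close>, up to a common
  scalar.  By \<open>A_inv_pair\<close> their sum is \<open>\<delta>\<^sub>j\<close>.
\<close>

lemma torus_value_middle_even:
  assumes D: "g = SO_even" and k: "1 \<le> k" "k \<le> n - 1"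
  shows "\<exists>\<mu> z. z \<noteq> 0 \<and> (\<forall>lam. tv (path_sum F (A' (pr k) lam) (n - 1) [n..<pr k] (pr k)) \<mu>
    (z * delta g n L (pr k) lam * y_prod k (n - 1) lam))"
proof -
  have n: "n \<ge> 3" using rank D by (simp add: simple_rank_def)
  have N: "dimN g n = 2 * n" unfolding D dimN_def by simp
  have top: "left_nb n = n - 2" "left_tw n = qb" "left_nb (n - 1) = n - 2" "left_tw (n - 1) = qb"
    unfolding left_nb_def left_tw_def using D n by auto
  have prn: "pr n = n + 1" "n + 1 < pr k" "pr (n - 1) = n + 2"
    using k n unfolding pr_eq N by simp_all
  have ls: "[n..<pr k] = n # (n + 1) # [pr (n - 1)..<pr k]"
    using prn by (simp add: upt_conv_Cons)
  note up_y = tv_path_sum_up_y[where l = "n - 1" and M = "n - 1" and k = k]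
  define P where "P lam = y_prod k (n - 1) lam" for lam
  let ?ls = "[pr (n - 1)..<pr k]"
  have tw_n: "twist tw {#n#} (iv k m) = (if k < m \<and> m = n - 1 then qb else 1)" if "m \<le> n - 1" for m
    using twist_single_iv[of k n m] that k n top by auto
  have tw_n1: "twist tw {#n - 1#} (iv k m) = (if k < m \<and> m = n - 1 then qb else 1)" if "m \<le> n - 1" for m
    using twist_single_iv[of k "n - 1" m] that k n top by auto
  have tw_iv: "twist tw (iv m (n - 1)) (iv k m) = (if m = n - 1 then 1 else qb)" if "k < m" "m \<le> n - 1" for m
    using twist_iv_iv[of k m m "n - 1"] that k n by (cases "m = n - 1") auto
  have s1: "tv (path_sum F (A' (pr k) lam) (n + 1) ?ls (pr k)) (iv k n) (P lam)" for lam
  proof -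
    have up: "F (n + 1) (pr m) = f_up L m n" "tv (f_up L m n) (iv m n) (pp ^ (n - 1 - m))"
      if "1 \<le> m" "m \<le> n - 1" for m
      using f_el_upper[of m n] tv_f_up[of m n] that n N prn(1) by simp_all
    have "tv (path_sum F (A' (pr k) lam) (n + 1) ?ls (pr k)) (iv k n)
        (pp ^ (n - 1 - (n - 1)) * 1 * y_prod k (n - 1) lam)"
    proof (rule up_y)
      show "tv (F (n + 1) (pr k)) (iv k n) (pp ^ (n - 1 - k) * 1)" using up[of k] k by simp
      fix m assume m: "k < m" "m \<le> n - 1"
      have "twist tw (iv m n) (iv k m) = qb" using twist_iv_iv[of k m m n] k m n by simp
      then show "\<exists>\<nu> v. tv (F (n + 1) (pr m)) \<nu> v \<and> \<nu> + iv k m = iv k n \<and>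
          v * twist tw \<nu> (iv k m) = qb * pp ^ (n - 1 - m) * 1"
        using up[of m] iv_split[of k m n] m k
        by (intro exI[of _ "iv m n"] exI[of _ "pp ^ (n - 1 - m)"]) simp
    qed (use k n in auto)
    then show ?thesis by (simp add: P_def)
  qed
  have s2: "tv (path_sum F (A' (pr k) lam) n ?ls (pr k)) (iv k (n - 1) + {#n#}) (P lam)" for lam
  proof -
    have r: "tv (F n (pr m)) (iv m (n - 1) + {#n#}) (pp ^ (n - 1 - m))" if "1 \<le> m" "m \<le> n - 1" for m
    proof -
      have "F n (pr m) = fD_right n L m"
        using f_el_cross_cases(3)[OF _ _ _ _ D, of n m] that n by (auto simp: fD_def)
      then show ?thesis using tv_fD_right[OF D, of m] that n by simp
    qed
    have "tv (path_sum F (A' (pr k) lam) n ?ls (pr k)) (iv k (n - 1) + {#n#})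
        (pp ^ (n - 1 - (n - 1)) * 1 * y_prod k (n - 1) lam)"
    proof (rule up_y)
      show "tv (F n (pr k)) (iv k (n - 1) + {#n#}) (pp ^ (n - 1 - k) * 1)" using r[of k] k by simp
      fix m assume m: "k < m" "m \<le> n - 1"
      have "iv m (n - 1) + {#n#} + iv k m = iv k (n - 1) + {#n#}"
        using iv_split[of k m "n - 1"] m by (simp add: union_commute)
      moreover have "twist tw (iv m (n - 1) + {#n#}) (iv k m) = qb"
        unfolding twist_simps tw_iv[OF m] tw_n[OF m(2)] using m by simp
      ultimately show "\<exists>\<nu> v. tv (F n (pr m)) \<nu> v \<and> \<nu> + iv k m = iv k (n - 1) + {#n#} \<and>
          v * twist tw \<nu> (iv k m) = qb * pp ^ (n - 1 - m) * 1"
        using r[of m] m k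
        by (intro exI[of _ "iv m (n - 1) + {#n#}"] exI[of _ "pp ^ (n - 1 - m)"]) simp
    qed (use k n in auto)
    then show ?thesis by (simp add: P_def)
  qed
  define t where "t = (if k = n - 1 then 1 else qb)"
  define \<mu> where "\<mu> = iv k (n - 1) + {#n#} + {#n - 1#}"
  have c: "tv (F (n - 1) (pr m)) (iv m (n - 1) + {#n#} + {#n - 1#})
      (if m = n - 1 then q * pp else pp ^ (n - m))" if "1 \<le> m" "m \<le> n - 1" for m
    using tv_fD[OF D that] f_el_cross_cases(3)[OF _ _ _ _ D, of "n - 1" m] that n by simp
  have s3: "tv (path_sum F (A' (pr k) lam) (n - 1) ?ls (pr k)) \<mu> (t * (q - qb) * P lam)" for lam
  proof (cases "k = n - 1")
    case True
    then have "tv (path_sum F (A' (pr k) lam) (n - 1) ?ls (pr k)) \<mu> (q * pp)"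
      using c[of k] k by (simp add: \<mu>_def)
    moreover have "q * pp = t * (q - qb) * P lam"
      using True by (simp add: t_def P_def y_prod_def pp_factor)
    ultimately show ?thesis by simp
  next
    case False
    have "tv (path_sum F (A' (pr k) lam) (n - 1) ?ls (pr k)) \<mu>
        (pp ^ (n - 1 - (n - 1)) * pp * y_prod k (n - 1) lam)"
    proof (rule up_y)
      have pow: "pp ^ (n - m) = pp ^ (n - 1 - m) * pp" if "m \<le> n - 1" for m
      proof -
        have "n - m = Suc (n - 1 - m)" using that n by simp
        then show ?thesis by (metis power_Suc2)
      qed
      show "tv (F (n - 1) (pr k)) \<mu> (pp ^ (n - 1 - k) * pp)"
        using c[of k] k False pow[of k] by (simp add: \<mu>_def)
      fix m assume m: "k < m" "m \<le> n - 1"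
      have "iv m (n - 1) + {#n#} + {#n - 1#} + iv k m = \<mu>"
        using iv_split[of k m "n - 1"] m by (simp add: union_commute \<mu>_def)
      moreover have "twist tw (iv m (n - 1) + {#n#} + {#n - 1#}) (iv k m) = (if m = n - 1 then qb ^ 2 else qb)"
        unfolding twist_simps tw_iv[OF m] tw_n[OF m(2)] tw_n1[OF m(2)] using m
        by (simp add: power2_eq_square)
      moreover have "q * pp * qb ^ 2 = qb * pp" by (simp add: power2_eq_square)
      ultimately show "\<exists>\<nu> v. tv (F (n - 1) (pr m)) \<nu> v \<and> \<nu> + iv k m = \<mu> \<and>
          v * twist tw \<nu> (iv k m) = qb * pp ^ (n - 1 - m) * pp"
        using c[of m] m k pow[of m]
        by (intro exI[of _ "iv m (n - 1) + {#n#} + {#n - 1#}"]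
            exI[of _ "if m = n - 1 then q * pp else pp ^ (n - m)"]) simp
    qed (use k n in auto)
    moreover have "pp = t * (q - qb)" using False by (simp add: t_def pp_factor)
    ultimately show ?thesis by (simp add: P_def)
  qed
  have f1: "F (n - 1) n = gen (n - 1)"
    using f_el_lower[of "n - 1" n] n N f_lo_unit[of "n - 1"] by simp
  have f2: "F (n - 1) (n + 1) = gen n"
    using f_el_cross_cases(3)[OF _ _ _ _ D, of "n - 1" n] n prn(1) by (auto simp: fD_def fD_left_def)
  have f3: "F n (n + 1) = 0"
    using f_el_incomparable[OF D] n by simp
  have t1: "twist tw {#n - 1#} (iv k (n - 1) + {#n#}) = t"
    unfolding twist_simps tw_n1[OF order_refl] using tw_le[of "n - 1" n] k by (auto simp: t_def)
  have ivn: "iv k n = iv k (n - 1) + {#n - 1#}" using iv_Suc[of k "n - 1"] k n by simp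
  have t2: "twist tw {#n#} (iv k n) = t"
    unfolding ivn twist_simps tw_n[OF order_refl] using tw_less[of "n - 1" n] top n k
    by (auto simp: t_def)
  have m1: "{#n - 1#} + (iv k (n - 1) + {#n#}) = \<mu>" "{#n#} + iv k n = \<mu>"
    unfolding ivn \<mu>_def by (simp_all add: union_ac)
  have "tv (path_sum F (A' (pr k) lam) (n - 1) [n..<pr k] (pr k)) \<mu>
      (t * delta g n L (pr k) lam * y_prod k (n - 1) lam)" for lam
  proof -
    let ?a = "A' (pr k) lam n" and ?b = "A' (pr k) lam (n + 1)"
    have "tv (path_sum F (A' (pr k) lam) (n - 1) [n..<pr k] (pr k)) \<mu>
      (?a * (?b * (t * (q - qb) * P lam) + P lam * t) + ?b * P lam * t)"
      using torus_value_add[OF torus_value_scal_mult[OF torus_value_add[OF torus_value_scal_mult[OF s3, of ?b lam]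
          torus_value_mult[OF torus_value_gen[of tw n] s1, of lam, unfolded t2 m1]], of ?a]
          torus_value_mult[OF torus_value_gen[of tw "n - 1"] torus_value_scal_mult[OF s2, of ?b lam], unfolded t1 m1]]
      unfolding ls path_sum.simps f1 f2 f3 by simp
    moreover have "?a * (?b * (t * (q - qb) * P lam) + P lam * t) + ?b * P lam * t =
        t * delta g n L (pr k) lam * y_prod k (n - 1) lam"
    proof -
      have "n \<noteq> k" "k \<le> n" using k n by auto
      then have "(q - qb) * (?a * ?b) = delta g n L (pr k) lam - ?a - ?b"
        using A_inv_pair(1)[of k n lam] k n prn(1) delta_even[OF D k, of lam] by simp
      moreover have "?a * (?b * (q - qb)) = (q - qb) * (?a * ?b)" by (simp only: mult_ac)
      ultimately have "?a * (?b * (q - qb)) + ?a + ?b = delta g n L (pr k) lam" by simp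
      moreover have "?a * (?b * (t * (q - qb) * P lam) + P lam * t) + ?b * P lam * t =
          t * (?a * (?b * (q - qb)) + ?a + ?b) * P lam" by (simp add: algebra_simps)
      ultimately show ?thesis unfolding P_def[symmetric] by simp
    qed
    ultimately show ?thesis by simp
  qed
  moreover have "t \<noteq> 0" by (simp add: t_def)
  ultimately show ?thesis by blast
qed

lemma Aalg_prod:
  "(\<And>m. m \<in> S \<Longrightarrow> f m \<in> Aalg g n L j) \<Longrightarrow> (\<lambda>lam. \<Prod>m\<in>S. f m lam) \<in> Aalg g n L j"
  by (induction S rule: infinite_finite_induct) (auto intro: Aalg.const Aalg.mult)

lemma y_prod_Aalg:
  assumes "1 \<le> k" "T \<le> n"
  shows "y_prod k T \<in> Aalg g n L (pr k)"
proof -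
  have "(\<lambda>lam. qb * yv (pr k) (pr m) lam) \<in> Aalg g n L (pr k)" if "m \<in> {k<..T}" for m
    using that assms dimN_bounds
    by (intro Aalg.mult Aalg.const Aalg.gen) (auto simp: prec_def pr_eq)
  from Aalg_prod[OF this, of "{k<..T}" "\<lambda>m. m"] show ?thesis
    by (simp add: y_prod_def[abs_def])
qed

lemma y_prod_nonzero: "y_prod k T lam \<noteq> 0"
  by (simp add: y_prod_def y_nonzero)

text \<open>
  The three cases are: \<open>j\<close> not beyond the middle, where the whole route consists of unit steps; \<open>j = n'\<close> in the series
  \<open>SO_even\<close>, which looks the same, the last step being \<open>f\<^sub>n\<close> instead of \<open>f\<^sub>n\<^sub>-\<^sub>1\<close>; and \<open>j\<close> beyond the middle, where
  unit steps lead to one of the sources above.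
\<close>

theorem torus_eval_f_check:
  assumes i: "1 \<le> i" and j: "j \<le> dimN g n" and ij: "prec g n i j" "i \<le> pr j"
  shows "\<exists>u\<in>Aalg g n L j. (\<forall>lam. u lam \<noteq> 0) \<and>
    (\<forall>lam. torus_eval tw (reg_rep {l. preceq g n i l \<and> prec g n l j} g n L i j lam) =
       delta g n L j lam * u lam)"
proof -
  define R where "R lam = reg_rep {l. preceq g n i l \<and> prec g n l j} g n L i j lam" for lam
  have R: "R lam = path_sum F (A' j lam) i
      (if g = SO_even \<and> j = n + 1 then [Suc i..<n] else [Suc i..<j]) j" for lam
    unfolding R_def reg_rep_eq_path_sum[OF rank ij(1)] level_list[OF rank ij(1) i ij(2)] ..
  have lt: "i < j" using ij(1) by (simp add: prec_def)
  have unit: "F a (Suc a) = gen a" if "1 \<le> a" "2 * Suc a \<le> dimN g n + 1" for a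
    using f_el_lower[of a "Suc a"] that f_lo_unit[of a] by simp
  have torus_kernel: "F a b \<in> torus_kernel" if "1 \<le> a" "Suc a < b" "2 * b \<le> dimN g n + 1" for a b
    using f_el_lower[of a b] f_lo_kernel[of a b] that by simp
  have eval: "\<exists>u\<in>Aalg g n L j. (\<forall>lam. u lam \<noteq> 0) \<and>
      (\<forall>lam. torus_eval tw (R lam) = delta g n L j lam * u lam)"
    if T: "i \<le> T" "2 * T \<le> dimN g n + 1" and ls: "\<And>lam. R lam = path_sum F (A' j lam) i ([Suc i..<Suc T] @ ls) j"
      and cross: "\<And>a b. i \<le> a \<Longrightarrow> a < T \<Longrightarrow> b \<in> insert j (set ls) \<Longrightarrow> F a b \<in> torus_kernel"
      and top: "\<exists>\<mu> z. z \<noteq> 0 \<and> (\<forall>lam. tv (path_sum F (A' j lam) T ls j) \<mu> (z * delta g n L j lam * v lam))"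
      and v: "v \<in> Aalg g n L j" "\<And>lam. v lam \<noteq> 0" for T ls v
  proof -
    obtain \<mu> z where z: "z \<noteq> 0"
      "\<And>lam. tv (path_sum F (A' j lam) T ls j) \<mu> (z * delta g n L j lam * v lam)"
      using top by blast
    have "\<exists>z \<mu>'. z \<noteq> 0 \<and> (\<forall>B w. tv (path_sum F B T ls j) \<mu> w \<longrightarrow>
      (\<exists>X. path_sum F B i ([Suc i..<Suc T] @ ls) j - X \<in> torus_kernel \<and> tv X \<mu>' (z * w)))"
    proof (intro path_sum_unit_steps)
      fix a b assume "i \<le> a" "a < T" "b \<in> insert j (set ls) \<or> Suc a < b \<and> b \<le> T"
      then show "F a b \<in> torus_kernel" using T i torus_kernel[of a b] cross[of a b] by auto
    qed (use T i in \<open>auto intro!: unit\<close>)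
    then obtain z' \<mu>' where z': "z' \<noteq> 0" "\<And>B w. tv (path_sum F B T ls j) \<mu> w \<Longrightarrow>
      (\<exists>X. path_sum F B i ([Suc i..<Suc T] @ ls) j - X \<in> torus_kernel \<and> tv X \<mu>' (z' * w))"
      by blast
    have "torus_eval tw (R lam) = delta g n L j lam * (z' * z * v lam)" for lam
      using z'(2)[OF z(2), of lam] kernel_eval[of "R lam"] unfolding ls[symmetric]
      by (auto simp: torus_value_def)
    then show ?thesis
      using z(1) z'(1) v by (intro bexI[of _ "\<lambda>lam. z' * z * v lam"] Aalg.mult Aalg.const) auto
  qed
  have one: "(\<lambda>lam. 1) \<in> Aalg g n L j" by (rule Aalg.const)
  consider (low) "2 * j \<le> dimN g n + 1" | (twin) "g = SO_even" "j = n + 1"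
    | (high) "2 * j > dimN g n + 1" "\<not> (g = SO_even \<and> j = n + 1)" by linarith
  then have "\<exists>u\<in>Aalg g n L j. (\<forall>lam. u lam \<noteq> 0) \<and>
      (\<forall>lam. torus_eval tw (R lam) = delta g n L j lam * u lam)"
  proof cases
    case low
    have "delta g n L j lam = 1" for lam
      using low by (cases g) (auto simp: delta_def s_prime_def prime_ix_def dimN_def)
    moreover have "R lam = path_sum F (A' j lam) i [Suc i..<j] j" for lam
    proof -
      have "\<not> (g = SO_even \<and> j = n + 1)" using low by (auto simp: dimN_def)
      then show ?thesis unfolding R by (simp only: if_False)
    qed
    ultimately show ?thesis
      using low lt unit[of "j - 1"] i torus_value_gen[of tw "j - 1"]
      by (intro eval[of "j - 1" "[]" "\<lambda>lam. 1"] one)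
        (auto intro!: torus_kernel exI[of _ "{#j - 1#}"] exI[of _ 1] simp del: upt_Suc)
  next
    case twin
    have "n \<ge> 3" using rank twin by (simp add: simple_rank_def)
    moreover have "i < n" using ij(1) twin by (auto simp: prec_def)
    moreover have "delta g n L j lam = 1" for lam
      using twin calculation by (auto simp: delta_def s_prime_def prime_ix_def dimN_def)
    moreover have "pr n = n + 1" unfolding pr_eq twin(1) by (simp add: dimN_def prime_ix_def)
    moreover have "F a (n + 1) \<in> torus_kernel" if "i \<le> a" "a < n - 1" for a
      using f_el_cross_cases(3)[OF _ _ _ _ twin(1), of a n] fD_kernel[OF twin(1), of a n] that i calculation
      by simp
    moreover have "F (n - 1) (n + 1) = gen n"
      using f_el_cross_cases(3)[OF _ _ _ _ twin(1), of "n - 1" n] calculation by (auto simp: fD_def fD_left_def)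
    ultimately show ?thesis
      using i torus_value_gen[of tw n] twin dimN_bounds
      by (intro eval[of "n - 1" "[]" "\<lambda>lam. 1"] one)
        (auto simp: R intro!: exI[of _ "{#n#}"] exI[of _ 1] simp del: upt_Suc)
  next
    case high
    define k where "k = pr j"
    have k: "1 \<le> k" "k \<le> n" "j = pr k" "i \<le> k" "n < j"
      using high j dimN_bounds lt ij(2) by (auto simp: k_def pr_eq)
    have Rh: "R lam = path_sum F (A' j lam) i ([Suc i..<Suc T] @ [Suc T..<j]) j" if "i \<le> T" "T < j" for lam T
    proof -
      have "[Suc i..<j] = [Suc i..<Suc T] @ [Suc T..<j]"
        using upt_add_eq_append[of "Suc i" "Suc T" "j - Suc T"] that by simp
      then show ?thesis unfolding R using high(2) by (simp only: if_False)
    qed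
    have cr: "\<exists>m. 1 \<le> m \<and> m \<le> n \<and> b = pr m" if "n < b" "b \<le> j" "b \<noteq> n + 1 \<or> g \<noteq> SO_odd" for b
      using that k j dimN_eq by (intro exI[of _ "pr b"]) (auto simp: pr_eq of_bool_def split: if_splits)
    show ?thesis
    proof (cases g)
      case SO_odd
      have null: "F a b \<in> torus_kernel" if ab: "i \<le> a" "a < n" "n < b" "b \<le> j" for a b
      proof (cases "b = n + 1")
        case True
        then show ?thesis using torus_kernel[of a b] ab i odd_top(1)[OF SO_odd] by linarith
      next
        case False
        then obtain m where m: "1 \<le> m" "m \<le> n" "b = pr m" using cr[of b] ab by blast
        have a: "1 \<le> a" "a \<le> n" using ab i by linarith+
        show ?thesis
          unfolding m(3) f_el_cross_cases(1)[OF a m(1,2) SO_odd] by (rule fB_kernel[OF SO_odd a(1) ab(2)])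
      qed
      show ?thesis
      proof (rule eval[of "n" "[n + 1..<j]" "y_prod k (n)"])
        show "i \<le> n" using k  by linarith
        show "2 * (n) \<le> dimN g n + 1" using dimN_bounds by linarith
        show "R lam = path_sum F (A' j lam) i ([Suc i..<Suc (n)] @ [n + 1..<j]) j" for lam
          using Rh[of "n" lam] k  by simp
        show "F a b \<in> torus_kernel" if "i \<le> a" "a < n" "b \<in> insert j (set [n + 1..<j])" for a b
          using null[of a b] that k by auto
        show "\<exists>\<mu> z. z \<noteq> 0 \<and> (\<forall>lam. tv (path_sum F (A' j lam) (n) [n + 1..<j] j) \<mu>
            (z * delta g n L j lam * y_prod k (n) lam))"
          using torus_value_middle_odd[OF SO_odd k(1,2)] unfolding k(3) .
        show "y_prod k (n) \<in> Aalg g n L j"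
          unfolding k(3) by (rule y_prod_Aalg) (use k in auto)
      qed (rule y_prod_nonzero)
    next
      case SP
      have null: "F a b \<in> torus_kernel" if ab: "i \<le> a" "a < n" "n < b" "b \<le> j" for a b
      proof -
        have "g \<noteq> SO_odd" by (simp add: SP)
        then obtain m where m: "1 \<le> m" "m \<le> n" "b = pr m" using cr[of b] ab by blast
        have a: "1 \<le> a" "a \<le> n" using ab i by linarith+
        show ?thesis
          unfolding m(3) f_el_cross_cases(2)[OF a m(1,2) SP] by (rule fC_kernel[OF SP a(1) ab(2) m(1,2)])
      qed
      have d1: "delta g n L b lam = 1" for b lam by (simp add: delta_def SP)
      show ?thesis
      proof (rule eval[of "n" "[n + 1..<j]" "y_prod k (n)"])
        show "i \<le> n" using k  by linarith
        show "2 * (n) \<le> dimN g n + 1" using dimN_bounds by linarith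
        show "R lam = path_sum F (A' j lam) i ([Suc i..<Suc (n)] @ [n + 1..<j]) j" for lam
          using Rh[of "n" lam] k  by simp
        show "F a b \<in> torus_kernel" if "i \<le> a" "a < n" "b \<in> insert j (set [n + 1..<j])" for a b
          using null[of a b] that k by auto
        show "\<exists>\<mu> z. z \<noteq> 0 \<and> (\<forall>lam. tv (path_sum F (A' j lam) (n) [n + 1..<j] j) \<mu>
            (z * delta g n L j lam * y_prod k (n) lam))"
          using torus_value_middle_symplectic[OF SP k(1,2)] unfolding k(3) by (simp add: d1 flip: k(3) del: upt_Suc)
        show "y_prod k (n) \<in> Aalg g n L j"
          unfolding k(3) by (rule y_prod_Aalg) (use k in auto)
      qed (rule y_prod_nonzero)
    next
      case SO_even
      have n: "n \<ge> 3" using rank SO_even by (simp add: simple_rank_def)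
      have N: "dimN g n = 2 * n" unfolding SO_even dimN_def by simp
      have "j \<noteq> n + 1" using high(2) SO_even by simp
      then have kn: "k \<le> n - 1" using k(1-3) unfolding pr_eq N by linarith
      have null: "F a b \<in> torus_kernel" if ab: "i \<le> a" "a < n - 1" "n \<le> b" "b \<le> j" for a b
      proof (cases "b = n")
        case True
        then show ?thesis using torus_kernel[of a b] ab i N by linarith
      next
        case False
        have "g \<noteq> SO_odd" by (simp add: SO_even)
        then obtain m where m: "1 \<le> m" "m \<le> n" "b = pr m" using cr[of b] ab False by auto
        have a: "1 \<le> a" "a \<le> n" using ab i by linarith+
        show ?thesis
          unfolding m(3) f_el_cross_cases(3)[OF a m(1,2) SO_even] by (rule fD_kernel[OF SO_even a(1) ab(2) m(1,2)])
      qed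
      show ?thesis
      proof (rule eval[of "n - 1" "[n..<j]" "y_prod k (n - 1)"])
        show "i \<le> n - 1" using k kn n by linarith
        show "2 * (n - 1) \<le> dimN g n + 1" using dimN_bounds by linarith
        show "R lam = path_sum F (A' j lam) i ([Suc i..<Suc (n - 1)] @ [n..<j]) j" for lam
          using Rh[of "n - 1" lam] k kn n by simp
        show "F a b \<in> torus_kernel" if "i \<le> a" "a < n - 1" "b \<in> insert j (set [n..<j])" for a b
          using null[of a b] that k by auto
        show "\<exists>\<mu> z. z \<noteq> 0 \<and> (\<forall>lam. tv (path_sum F (A' j lam) (n - 1) [n..<j] j) \<mu>
            (z * delta g n L j lam * y_prod k (n - 1) lam))"
          using torus_value_middle_even[OF SO_even k(1) kn] unfolding k(3) .
        show "y_prod k (n - 1) \<in> Aalg g n L j"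
          unfolding k(3) by (rule y_prod_Aalg) (use k in auto)
      qed (rule y_prod_nonzero)
    qed
  qed
  then show ?thesis by (simp add: R_def)
qed

end

section \<open>Uniqueness of the quotient\<close>

definition is_linear :: "(freealg \<Rightarrow> complex) \<Rightarrow> bool" where
  "is_linear \<phi> \<longleftrightarrow> (\<forall>x y. \<phi> (x + y) = \<phi> x + \<phi> y) \<and> (\<forall>c x. \<phi> (scal c * x) = c * \<phi> x)"

lemma is_linear_sum: "is_linear \<phi> \<Longrightarrow> \<phi> (sum f A) = (\<Sum>a\<in>A. \<phi> (f a))"
proof -
  assume l: "is_linear \<phi>"
  have "\<phi> (0 + 0) = \<phi> 0 + \<phi> 0" using l unfolding is_linear_def by blast
  then have "\<phi> 0 = 0" by simp
  then show ?thesis using l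
    by (induction A rule: infinite_finite_induct) (simp_all add: is_linear_def)
qed

lemma is_linear_minus: "is_linear \<phi> \<Longrightarrow> \<phi> (x - y) = \<phi> x - \<phi> y"
  unfolding is_linear_def by (metis add_diff_cancel_right' diff_add_cancel)

lemma scal_simps: "scal (a + b) = scal a + scal b" "scal 1 = 1" "scal 0 = 0"
  by (simp_all add: scal_def single_add)

lemma is_linear_torus_eval: "is_linear (torus_eval t)"
proof -
  have "torus_eval t (scal c * x) = c * torus_eval t x" for c x
  proof -
    have "torus_eval t (scal c * Poly_Mapping.single w a) = c * torus_eval t (Poly_Mapping.single w a)"
      for w a by (simp add: scal_def mult_single torus_eval_single)
    then show ?thesis
      by (subst (1 2) poly_mapping_sum_single[of x]) (simp add: sum_distrib_left torus_eval_sum)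
  qed
  then show ?thesis by (simp add: is_linear_def torus_eval_add)
qed

lemma vector_space_freealg: "vector_space (\<lambda>c x. scal c * x)"
  by unfold_locales (simp_all add: scal_simps scal_mult distrib_left distrib_right flip: mult.assoc)

lemma separating_functional:
  assumes "0 \<in> I" "\<And>x y. x \<in> I \<Longrightarrow> y \<in> I \<Longrightarrow> x + y \<in> I" "\<And>c x. x \<in> I \<Longrightarrow> scal c * x \<in> I" "v \<notin> I"
  obtains \<phi> where "is_linear \<phi>" "\<And>x. x \<in> I \<Longrightarrow> \<phi> x = 0" "\<phi> v \<noteq> 0"
proof -
  interpret V: vector_space "\<lambda>c x. scal c * x" by (rule vector_space_freealg)
  interpret C: vector_space "(*) :: complex \<Rightarrow> complex \<Rightarrow> complex"
    by unfold_locales (simp_all add: algebra_simps)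
  interpret P: vector_space_pair "\<lambda>c x. scal c * x" "(*) :: complex \<Rightarrow> complex \<Rightarrow> complex" ..
  have sub: "V.subspace I" using assms(1-3) by (simp add: V.subspace_def)
  obtain B where B: "B \<subseteq> I" "V.independent B" "I \<subseteq> V.span B"
    using V.basis_exists[of I] by metis
  have "v \<notin> V.span B" using V.span_minimal[OF B(1) sub] assms(4) by blast
  then have "V.independent (insert v B)" by (simp add: V.independent_insert B(2))
  from P.linear_independent_extend[OF this, of "\<lambda>x. if x = v then 1 else 0"]
  obtain \<phi> where \<phi>: "Vector_Spaces.linear (\<lambda>c x. scal c * x) (*) \<phi>"
    "\<forall>x\<in>insert v B. \<phi> x = (if x = v then 1 else 0)" by blast
  interpret \<phi>: Vector_Spaces.linear "\<lambda>c x. scal c * x" "(*)" \<phi> by (rule \<phi>(1))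
  have "v \<notin> B" using B(1) assms(4) by blast
  then have "\<phi> x = 0" if "x \<in> B" for x using \<phi>(2) that by auto
  then have "\<phi> x = 0" if "x \<in> I" for x
    using P.linear_eq_0_on_span[OF \<phi>(1), of B x] B(3) that by blast
  moreover have "is_linear \<phi>" by (simp add: is_linear_def \<phi>.add \<phi>.scale)
  moreover have "\<phi> v \<noteq> 0" using \<phi>(2) by simp
  ultimately show thesis using that by blast
qed

context quantum_group
begin

lemma Aalg_tendsto:
  assumes "a \<in> Aalg g n L j" "\<And>k. (\<lambda>m. \<Lambda> m k) \<longlonglongrightarrow> lam k"
  shows "(\<lambda>m. a (\<Lambda> m)) \<longlonglongrightarrow> a lam"
  using assms(1)
proof induction
  case (gen l)
  show ?case unfolding y_fun_def qpow_def eta_def Let_def h_fun_def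
    by (intro tendsto_intros assms(2))
next
  case (gen_inv l)
  have "(\<lambda>m. yv j l (\<Lambda> m)) \<longlonglongrightarrow> yv j l lam" unfolding y_fun_def qpow_def eta_def Let_def h_fun_def
    by (intro tendsto_intros assms(2))
  then show ?case using y_nonzero by (intro tendsto_inverse)
qed (intro tendsto_intros; assumption)+

lemma shifted_coord_update:
  "1 \<le> k \<Longrightarrow> k \<le> n \<Longrightarrow> shifted_coord (lam(k := lam k + c)) k = shifted_coord lam k + c"
proof -
  assume k: "1 \<le> k" "k \<le> n"
  have "h_fun n (eps g n k) \<nu> = \<nu> k" for \<nu>
    unfolding h_fun_def using k by (subst sum.cong[where h = "\<lambda>x. if x = k then \<nu> k else 0"])
      (auto simp: eps_low)
  then show ?thesis by (simp add: shifted_coord_def)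
qed

lemma exp_frac_nonunit:
  assumes "r > 0" shows "exp (- (of_nat r * L * (1 / of_nat (Suc m)))) \<noteq> 1"
proof
  assume "exp (- (of_nat r * L * (1 / of_nat (Suc m)))) = 1"
  then have "exp (- (of_nat r * L * (1 / of_nat (Suc m)))) ^ Suc m = 1" by simp
  then have "exp (of_nat (Suc m) * (- (of_nat r * L * (1 / of_nat (Suc m))))) = 1"
    by (simp only: exp_of_nat_mult)
  then have "exp (- (of_nat r * L)) = 1" by (simp del: of_nat_Suc)
  then have "exp L ^ r = 1" by (simp add: exp_minus exp_of_nat_mult)
  then show False using not_root_of_unity assms by blast
qed

text \<open>
  It is enough to approach a zero \<open>\<lambda>\<close> of \<open>\<delta>\<^sub>j\<close> by points where \<open>\<delta>\<^sub>j\<close> is not 0.  Along the coordinate \<open>j'\<close> the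
  relevant \<open>y\<close> changes by an exponential; if it returned to its value after the step \<open>1 / (m + 1)\<close>, then \<open>q\<close>
  would be a root of unity.
\<close>

lemma delta_cancel:
  assumes a: "a \<in> Aalg g n L j" and j: "1 \<le> j" "j \<le> dimN g n"
    and zero: "\<And>lam. delta g n L j lam * a lam = 0"
  shows "a lam = 0"
proof (cases "delta g n L j lam = 0")
  case True
  define k where "k = pr j"
  define \<Lambda> where "\<Lambda> m = lam(k := lam k + 1 / of_nat (Suc m))" for m
  have "g \<noteq> SP \<and> \<not> j < s_prime g n" using True by (auto simp: delta_def split: series.splits if_splits)
  then have k: "1 \<le> k" "k \<le> n" "j = pr k" "\<not> j < s_prime g n"
    using j rank by (auto simp: k_def prime_ix_def dimN_def s_prime_def simple_rank_def split: series.splits)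
  have yk: "yv j k (\<Lambda> m) = yv j k lam * exp (- (of_nat 4 * L * (1 / of_nat (Suc m))))" for m
    unfolding k(3) y_fun_def eta_values(1)[OF k(1,2)] qpow_def \<Lambda>_def shifted_coord_update[OF k(1,2)]
    by (simp add: algebra_simps flip: exp_add)
  have "delta g n L j (\<Lambda> m) \<noteq> 0" for m
  proof (cases "g = SO_odd")
    case True
    then have d: "delta g n L j \<mu> = (q * yv j (n + 1) \<mu> + 1) / (q + 1)" for \<mu>
      using k(4) unfolding delta_def by simp
    have "q + 1 \<noteq> 0"
      using q_power_nonunit[of 2] by (auto simp: eq_neg_iff_add_eq_0[symmetric])
    then have "q * yv j (n + 1) lam = - 1"
      using \<open>delta g n L j lam = 0\<close> by (simp add: d eq_neg_iff_add_eq_0)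
    moreover have "yv j (n + 1) (\<Lambda> m) = yv j (n + 1) lam * exp (- (of_nat 2 * L * (1 / of_nat (Suc m))))"
      unfolding k(3) y_fun_def eta_values(4)[OF k(1,2) True] qpow_def \<Lambda>_def shifted_coord_update[OF k(1,2)]
      by (simp add: algebra_simps flip: exp_add)
    ultimately have "q * yv j (n + 1) (\<Lambda> m) = - exp (- (of_nat 2 * L * (1 / of_nat (Suc m))))"
      by (simp only: mult.assoc[symmetric]) simp
    then show ?thesis
      using exp_frac_nonunit[of 2 m] \<open>q + 1 \<noteq> 0\<close> by (simp add: d)
  next
    case False
    then have "g = SO_even" using \<open>g \<noteq> SP \<and> \<not> j < s_prime g n\<close> by (cases g) auto
    then have d: "delta g n L j \<mu> = (yv j k \<mu> - 1) / (q - qb)" for \<mu>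
      using k(4) unfolding delta_def k_def by simp
    then have "yv j k lam = 1" using \<open>delta g n L j lam = 0\<close> q_sub_qb by simp
    then show ?thesis using yk[of m] exp_frac_nonunit[of 4 m] q_sub_qb by (simp add: d)
  qed
  then have "a (\<Lambda> m) = 0" for m using zero[of "\<Lambda> m"] by simp
  moreover have "(\<lambda>m. \<Lambda> m x) \<longlonglongrightarrow> lam x" for x
  proof (cases "x = k")
    case True
    have "(\<lambda>m. lam k + 1 / of_nat (Suc m)) \<longlonglongrightarrow> lam k + 0"
      by (intro tendsto_add tendsto_const LIMSEQ_Suc[OF lim_1_over_n])
    then show ?thesis using True by (simp add: \<Lambda>_def)
  qed (simp add: \<Lambda>_def)
  then have "(\<lambda>m. a (\<Lambda> m)) \<longlonglongrightarrow> a lam" by (rule Aalg_tendsto[OF a])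
  ultimately show ?thesis by (simp add: LIMSEQ_const_iff)
qed (use zero[of lam] in simp)

abbreviation "I \<equiv> serre_ideal g n L"

lemma cls_hom: "cls g n L \<in> ring_hom (free_ring n) (Uq g n L)"
  using ideal.rcos_ring_hom[OF ideal_serre] by (simp add: cls_def[abs_def] Uq_def)

lemma ring_Uq: "ring (Uq g n L)"
  unfolding Uq_def by (rule ideal.quotient_is_ring[OF ideal_serre])

lemma cls_closed: "x \<in> carrier (free_ring n) \<Longrightarrow> cls g n L x \<in> carrier (Uq g n L)"
  by (rule ring_hom_closed[OF cls_hom])

lemma cls_add:
  "x \<in> carrier (free_ring n) \<Longrightarrow> y \<in> carrier (free_ring n) \<Longrightarrow>
    cls g n L (x + y) = cls g n L x \<oplus>\<^bsub>Uq g n L\<^esub> cls g n L y"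
  using ring_hom_add[OF cls_hom] by (simp add: free_ring_def)

lemma uscale_cls: "x \<in> carrier (free_ring n) \<Longrightarrow> uscale g n L c (cls g n L x) = cls g n L (scal c * x)"
  using ring_hom_mult[OF cls_hom scal_carrier, of x c] by (simp add: uscale_def free_ring_def)

lemma cls_zero: "cls g n L 0 = \<zero>\<^bsub>Uq g n L\<^esub>"
  using ring_hom_zero[OF cls_hom ring_free_ring ring_Uq] by (simp add: free_ring_def)

lemma cls_eq_iff:
  assumes "x \<in> carrier (free_ring n)" "y \<in> carrier (free_ring n)"
  shows "cls g n L x = cls g n L y \<longleftrightarrow> x - y \<in> I"
proof -
  interpret ring "free_ring n" by (rule ring_free_ring)
  have "\<ominus>\<^bsub>free_ring n\<^esub> y = - y"
    using assms(2) by (intro minus_equality) (auto simp: free_ring_def)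
  then have "x \<ominus>\<^bsub>free_ring n\<^esub> y = x - y" by (simp add: a_minus_def) (simp add: free_ring_def)
  then show ?thesis
    using quotient_eq_iff_same_a_r_cos[OF ideal_serre assms] by (simp add: cls_def)
qed

lemma ideal_closed:
  "0 \<in> I" "x \<in> I \<Longrightarrow> y \<in> I \<Longrightarrow> x + y \<in> I" "x \<in> I \<Longrightarrow> y \<in> carrier (free_ring n) \<Longrightarrow> y * x \<in> I"
  "x \<in> I \<Longrightarrow> y \<in> carrier (free_ring n) \<Longrightarrow> x * y \<in> I" "x \<in> I \<Longrightarrow> x \<in> carrier (free_ring n)"
  "x \<in> I \<Longrightarrow> - x \<in> I"
proof -
  interpret ideal I "free_ring n" by (rule ideal_serre)
  show "0 \<in> I" "x \<in> I \<Longrightarrow> y \<in> I \<Longrightarrow> x + y \<in> I" "x \<in> I \<Longrightarrow> y \<in> carrier (free_ring n) \<Longrightarrow> y * x \<in> I"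
    "x \<in> I \<Longrightarrow> y \<in> carrier (free_ring n) \<Longrightarrow> x * y \<in> I"
    using additive_subgroup.zero_closed[OF is_additive_subgroup]
      additive_subgroup.a_closed[OF is_additive_subgroup] I_l_closed I_r_closed
    by (simp_all add: free_ring_def)
  show "x \<in> I \<Longrightarrow> x \<in> carrier (free_ring n)" by (rule a_Hcarr)
  show "- x \<in> I" if "x \<in> I"
  proof -
    have "scal (- 1) * x \<in> I" using I_l_closed[OF that scal_carrier] by (simp add: free_ring_def)
    then show ?thesis by (simp add: scal_minus scal_simps)
  qed
qed

lemma finsum_cls:
  assumes "\<And>k. k < (K::nat) \<Longrightarrow> x k \<in> carrier (free_ring n)"
  shows "(\<Oplus>\<^bsub>Uq g n L\<^esub>k\<in>{..<K}. cls g n L (x k)) = cls g n L (\<Sum>k<K. x k)"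
  using assms
proof (induction K)
  case 0
  interpret ring "Uq g n L" by (rule ring_Uq)
  show ?case by (simp add: cls_zero)
next
  case (Suc K)
  interpret ring "Uq g n L" by (rule ring_Uq)
  have "(\<Oplus>\<^bsub>Uq g n L\<^esub>k\<in>{..<Suc K}. cls g n L (x k)) =
      cls g n L (x K) \<oplus>\<^bsub>Uq g n L\<^esub> (\<Oplus>\<^bsub>Uq g n L\<^esub>k\<in>{..<K}. cls g n L (x k))"
    unfolding lessThan_Suc using Suc.prems
    by (intro finsum_insert) (auto intro!: cls_closed)
  also have "\<dots> = cls g n L (x K + (\<Sum>k<K. x k))"
    using Suc cls_add[of "x K" "sum x {..<K}"] carrier_sum[of "{..<K}" x] by simp
  finally show ?case by (simp add: add.commute)
qed

definition "comb K b c lam = (\<Sum>k<(K::nat). scal (c k lam) * b k :: freealg)" for lam :: dual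

lemma UA_iff:
  "u \<in> UA g n L j \<longleftrightarrow> (\<exists>K b c. (\<forall>k<K. b k \<in> carrier (free_ring n) \<and> c k \<in> Aalg g n L j) \<and>
     u = (\<lambda>lam. cls g n L (comb K b c lam)))"
proof -
  have eq: "(\<Oplus>\<^bsub>Uq g n L\<^esub>k\<in>{..<K}. uscale g n L (c k lam) (cls g n L (x k))) = cls g n L (comb K x c lam)"
    if "\<And>k. k < K \<Longrightarrow> x k \<in> carrier (free_ring n)" for K c x and lam :: dual
  proof -
    interpret ring "Uq g n L" by (rule ring_Uq)
    have "(\<Oplus>\<^bsub>Uq g n L\<^esub>k\<in>{..<K}. uscale g n L (c k lam) (cls g n L (x k))) =
        (\<Oplus>\<^bsub>Uq g n L\<^esub>k\<in>{..<K}. cls g n L (scal (c k lam) * x k))"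
      using that by (intro finsum_cong')
        (auto simp: uscale_cls intro!: cls_closed carrier_closed scal_carrier)
    also have "\<dots> = cls g n L (comb K x c lam)"
      unfolding comb_def using that by (intro finsum_cls carrier_closed scal_carrier)
    finally show ?thesis .
  qed
  have surj: "\<exists>x\<in>carrier (free_ring n). b = cls g n L x" if "b \<in> carrier (Uq g n L)" for b
    using that by (auto simp: Uq_def FactRing_def A_RCOSETS_def' cls_def)
  show ?thesis
  proof
    assume "u \<in> UA g n L j"
    then obtain K :: nat and b c where u: "u = (\<lambda>lam. \<Oplus>\<^bsub>Uq g n L\<^esub>k\<in>{..<K}. uscale g n L (c k lam) (b k))"
      "\<forall>k<K. b k \<in> carrier (Uq g n L) \<and> c k \<in> Aalg g n L j"
      unfolding UA_def mem_Collect_eq by (elim exE conjE) (rule that; assumption)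
    have "\<forall>k. \<exists>x. k < K \<longrightarrow> x \<in> carrier (free_ring n) \<and> b k = cls g n L x"
      using surj u(2) by blast
    from choice[OF this] obtain x
      where x: "\<And>k. k < K \<Longrightarrow> x k \<in> carrier (free_ring n) \<and> b k = cls g n L (x k)" by blast
    interpret ring "Uq g n L" by (rule ring_Uq)
    have "u = (\<lambda>lam. \<Oplus>\<^bsub>Uq g n L\<^esub>k\<in>{..<K}. uscale g n L (c k lam) (cls g n L (x k)))"
      unfolding u(1) using x
      by (intro ext finsum_cong') (auto simp: uscale_cls intro!: cls_closed carrier_closed scal_carrier)
    then show "\<exists>K b c. (\<forall>k<K. b k \<in> carrier (free_ring n) \<and> c k \<in> Aalg g n L j) \<and>
     u = (\<lambda>lam. cls g n L (comb K b c lam))"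
      using eq[of K x c] u(2) x by (intro exI[of _ K] exI[of _ x] exI[of _ c]) auto
  next
    assume "\<exists>K b c. (\<forall>k<K. b k \<in> carrier (free_ring n) \<and> c k \<in> Aalg g n L j) \<and>
     u = (\<lambda>lam. cls g n L (comb K b c lam))"
    then obtain K b c where u: "\<And>k. k < K \<Longrightarrow> b k \<in> carrier (free_ring n) \<and> c k \<in> Aalg g n L j"
      "u = (\<lambda>lam. cls g n L (comb K b c lam))" by blast
    then show "u \<in> UA g n L j"
      unfolding UA_def using eq[of K b c]
      by (intro CollectI exI[of _ K] exI[of _ "\<lambda>k. cls g n L (b k)"] exI[of _ c])
        (auto simp: cls_closed)
  qed
qed

lemma comb_carrier:
  "(\<And>k. k < K \<Longrightarrow> b k \<in> carrier (free_ring n)) \<Longrightarrow> comb K b c lam \<in> carrier (free_ring n)"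
  unfolding comb_def by (intro carrier_sum carrier_closed scal_carrier) auto

lemma Aalg_sum:
  "(\<And>m. m \<in> S \<Longrightarrow> f m \<in> Aalg g n L j) \<Longrightarrow> (\<lambda>lam. \<Sum>m\<in>S. f m lam) \<in> Aalg g n L j"
  by (induction S rule: infinite_finite_induct) (auto intro: Aalg.const Aalg.add)

lemma linear_comb_Aalg:
  assumes "is_linear \<phi>" "\<And>k. k < K \<Longrightarrow> c k \<in> Aalg g n L j"
  shows "(\<lambda>lam. \<phi> (comb K b c lam)) \<in> Aalg g n L j"
proof -
  have "(\<lambda>lam. \<phi> (comb K b c lam)) = (\<lambda>lam. \<Sum>k<K. c k lam * \<phi> (b k))"
    using assms(1) by (simp add: comb_def is_linear_sum) (simp add: is_linear_def)
  then show ?thesis using assms(2) by (auto intro!: Aalg_sum Aalg.mult Aalg.const)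
qed

lemma Aalg_diff: "a \<in> Aalg g n L j \<Longrightarrow> b \<in> Aalg g n L j \<Longrightarrow> (\<lambda>lam. a lam - b lam) \<in> Aalg g n L j"
  using Aalg.add[OF _ Aalg.mult[OF Aalg.const[of "- 1"]], of a g n L j b] by simp

text \<open>
  A linear functional on the free algebra that kills the Serre ideal can be applied to both sides of
  \<open>\<delta> u = x\<close>, which then becomes an equation between functions where \<open>\<delta>\<close> can be cancelled.
\<close>

lemma quotient_value:
  assumes j: "1 \<le> j" "j \<le> dimN g n" and \<phi>: "is_linear \<phi>" "\<And>x. x \<in> I \<Longrightarrow> \<phi> x = 0"
    and c: "\<And>k. k < K \<Longrightarrow> b k \<in> carrier (free_ring n) \<and> c k \<in> Aalg g n L j"
    and v: "v \<in> Aalg g n L j"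
    and x: "\<And>lam. x lam \<in> carrier (free_ring n)" "\<And>lam. \<phi> (x lam) = delta g n L j lam * v lam"
    and eq: "\<And>lam. uscale g n L (delta g n L j lam) (cls g n L (comb K b c lam)) = cls g n L (x lam)"
  shows "\<phi> (comb K b c lam) = v lam"
proof -
  let ?a = "\<lambda>lam. \<phi> (comb K b c lam) - v lam"
  have "?a \<in> Aalg g n L j" using c by (intro Aalg_diff linear_comb_Aalg \<phi>(1) v) auto
  moreover have "delta g n L j lam * ?a lam = 0" for lam
  proof -
    have car: "comb K b c lam \<in> carrier (free_ring n)" using c by (intro comb_carrier) auto
    have "cls g n L (scal (delta g n L j lam) * comb K b c lam) = cls g n L (x lam)"
      using eq[of lam] uscale_cls[OF car] by simp
    then have "scal (delta g n L j lam) * comb K b c lam - x lam \<in> I"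
      using cls_eq_iff[OF carrier_closed(1)[OF scal_carrier car] x(1)] by simp
    then have "\<phi> (scal (delta g n L j lam) * comb K b c lam) = \<phi> (x lam)"
      using \<phi>(2) is_linear_minus[OF \<phi>(1)] by fastforce
    then show ?thesis using \<phi>(1) x(2) by (simp add: is_linear_def right_diff_distrib)
  qed
  ultimately have "?a lam = 0" using delta_cancel[of ?a j lam] j by blast
  then show ?thesis by simp
qed

end

section \<open>Commutation relations for chains and their products\<close>

text \<open>
  The relations of a chain \<open>w\<^sub>T, w\<^sub>T\<^sub>-\<^sub>1 = [w\<^sub>T, f\<^sub>T\<^sub>-\<^sub>1], \<dots>, w\<^sub>1\<close> of \<open>q\<^sup>-\<^sup>1\<close>-commutators with the generators \<open>f\<^sub>1, \<dots>, f\<^sub>T\<^sub>-\<^sub>1\<close>.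
  The multiplication is a parameter so that the opposite one can be substituted, which turns lower chains
  into upper ones.
\<close>

definition lo_family where
  "lo_family sc m q f T w \<longleftrightarrow>
     (\<forall>a. 1 \<le> a \<longrightarrow> a < T \<longrightarrow> m (w (Suc a)) (f a) = w a + sc (inverse q) (m (f a) (w (Suc a)))) \<and>
     (\<forall>a. 1 \<le> a \<longrightarrow> a < T \<longrightarrow> m (w a) (f a) = sc q (m (f a) (w a))) \<and>
     (\<forall>a l. 1 \<le> a \<longrightarrow> a \<le> T \<longrightarrow> 1 \<le> l \<longrightarrow> l < T \<longrightarrow> l \<noteq> a \<longrightarrow> Suc l \<noteq> a \<longrightarrow> m (w a) (f l) = m (f l) (w a))"
  for sc :: "complex \<Rightarrow> 'a::ab_group_add \<Rightarrow> 'a" and T :: nat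

text \<open>
  The commutation of \<open>f\<^sub>1, \<dots>, f\<^sub>M\<^sub>-\<^sub>1\<close> with a matrix \<open>G\<^sub>a\<^sub>b\<close> whose two indices transform like the indices of two chains:
  the generators act as on a tensor square of the vector representation.  This half of the relations lowers the first index;
  the other half is the same for the opposite multiplication and the transposed matrix.  The
  relations are linear in \<open>G\<close>.
\<close>

definition half_rel where
  "half_rel sc m q f M G \<longleftrightarrow>
     (\<forall>a b. 1 \<le> a \<longrightarrow> a < M \<longrightarrow> 1 \<le> b \<longrightarrow> b \<le> M \<longrightarrow> b \<noteq> a \<longrightarrow> b \<noteq> Suc a \<longrightarrow>
        m (G (Suc a) b) (f a) = G a b + sc (inverse q) (m (f a) (G (Suc a) b))) \<and>
     (\<forall>a. 1 \<le> a \<longrightarrow> a < M \<longrightarrow>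
        sc q (m (G (Suc a) a) (f a)) = G a a + sc (inverse q) (m (f a) (G (Suc a) a))) \<and>
     (\<forall>a. 1 \<le> a \<longrightarrow> a < M \<longrightarrow>
        m (G (Suc a) (Suc a)) (f a) = sc q (G a (Suc a)) - sc q (G (Suc a) a) + m (f a) (G (Suc a) (Suc a))) \<and>
     (\<forall>a b. 1 \<le> a \<longrightarrow> a < M \<longrightarrow> 1 \<le> b \<longrightarrow> b \<le> M \<longrightarrow> b \<noteq> a \<longrightarrow> b \<noteq> Suc a \<longrightarrow>
        m (G a b) (f a) = sc q (m (f a) (G a b))) \<and>
     (\<forall>a b l. 1 \<le> a \<longrightarrow> a \<le> M \<longrightarrow> 1 \<le> b \<longrightarrow> b \<le> M \<longrightarrow> 1 \<le> l \<longrightarrow> l < M \<longrightarrow>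
        l \<noteq> a \<longrightarrow> Suc l \<noteq> a \<longrightarrow> l \<noteq> b \<longrightarrow> Suc l \<noteq> b \<longrightarrow> m (G a b) (f l) = m (f l) (G a b))"
  for sc :: "complex \<Rightarrow> 'a::ab_group_add \<Rightarrow> 'a" and M :: nat

locale q_algebra = vector_space sc for sc :: "complex \<Rightarrow> 'a::ab_group_add \<Rightarrow> 'a" +
  fixes m :: "'a \<Rightarrow> 'a \<Rightarrow> 'a" (infixr "\<cdot>" 70) and q :: complex
  assumes m_assoc: "(x \<cdot> y) \<cdot> z = x \<cdot> (y \<cdot> z)"
    and m_add: "(x + y) \<cdot> z = x \<cdot> z + y \<cdot> z" "x \<cdot> (y + z) = x \<cdot> y + x \<cdot> z"
    and m_sc: "sc c x \<cdot> y = sc c (x \<cdot> y)" "x \<cdot> sc c y = sc c (x \<cdot> y)"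
    and q_nz: "q \<noteq> 0" and q_add: "q + inverse q \<noteq> 0" and q_sub: "q - inverse q \<noteq> 0"
begin

lemma m_diff: "(x - y) \<cdot> z = x \<cdot> z - y \<cdot> z" "x \<cdot> (y - z) = x \<cdot> y - x \<cdot> z"
  using m_add(1)[of "x - y" y z] m_add(2)[of x "y - z" z] by (simp_all add: algebra_simps)

lemma m_zero: "0 \<cdot> z = 0" "z \<cdot> 0 = 0"
  using m_diff(1)[of 0 0 z] m_diff(2)[of z 0 0] by simp_all

lemmas sc_simps = scale_right_distrib scale_right_diff_distrib scale_scale
lemmas alg = m_assoc m_add m_diff m_sc m_zero sc_simps

lemma then_mult: "x \<cdot> y = z \<Longrightarrow> x \<cdot> (y \<cdot> r) = z \<cdot> r"
  by (simp flip: m_assoc)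

lemma flip: "q_algebra sc (\<lambda>x y. y \<cdot> x) q"
  by unfold_locales (use q_sub in \<open>simp_all add: alg q_nz q_add\<close>)

abbreviation "qb \<equiv> inverse q"
abbreviation "serre2 x y \<equiv> x \<cdot> x \<cdot> y + y \<cdot> x \<cdot> x = sc (q + qb) (x \<cdot> y \<cdot> x)"

lemma sc_eq_iff: "c \<noteq> 0 \<Longrightarrow> sc c x = y \<longleftrightarrow> x = sc (inverse c) y"
  by (auto simp: sc_simps)

text \<open>
  The known fact that \<open>y\<close> commutes with the double commutator of \<open>v\<close>, \<open>y\<close> and \<open>x\<close>.  Each of \<open>A\<close> and \<open>B\<close>
  below becomes \<open>Z\<close> when multiplied by \<open>q + q\<^sup>-\<^sup>1\<close>, by both Serre relations, and
  \<open>1 + q\<^sup>-\<^sup>2 = q\<^sup>-\<^sup>1 (q + q\<^sup>-\<^sup>1)\<close>.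
\<close>

lemma serre2_commute:
  assumes s: "serre2 y x" "serre2 y v" and c: "v \<cdot> x = x \<cdot> v"
  defines "u \<equiv> v \<cdot> y - sc qb (y \<cdot> v)"
  defines "w \<equiv> u \<cdot> x - sc qb (x \<cdot> u)"
  shows "w \<cdot> y = y \<cdot> w"
proof -
  note c' = c then_mult[OF c]
  define Z where "Z = y \<cdot> y \<cdot> x \<cdot> v - x \<cdot> v \<cdot> y \<cdot> y"
  define A where "A = y \<cdot> v \<cdot> y \<cdot> x - v \<cdot> y \<cdot> x \<cdot> y"
  define B where "B = y \<cdot> x \<cdot> y \<cdot> v - x \<cdot> y \<cdot> v \<cdot> y"
  have "sc (q + qb) (y \<cdot> v \<cdot> y \<cdot> x) = (y \<cdot> y \<cdot> v + v \<cdot> y \<cdot> y) \<cdot> x"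
    "sc (q + qb) (v \<cdot> y \<cdot> x \<cdot> y) = v \<cdot> (y \<cdot> y \<cdot> x + x \<cdot> y \<cdot> y)"
    "sc (q + qb) (y \<cdot> x \<cdot> y \<cdot> v) = (y \<cdot> y \<cdot> x + x \<cdot> y \<cdot> y) \<cdot> v"
    "sc (q + qb) (x \<cdot> y \<cdot> v \<cdot> y) = x \<cdot> (y \<cdot> y \<cdot> v + v \<cdot> y \<cdot> y)"
    unfolding s by (simp_all add: alg)
  then have "sc (q + qb) A = Z" "sc (q + qb) B = Z"
    unfolding A_def B_def Z_def scale_right_diff_distrib by (simp_all add: alg c')
  then have AB: "A = sc (inverse (q + qb)) Z" "B = sc (inverse (q + qb)) Z"
    by (simp_all add: sc_eq_iff q_add)
  have "y \<cdot> w - w \<cdot> y = A + sc (qb * qb) B - sc qb Z"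
    unfolding A_def B_def Z_def w_def u_def by (simp add: alg c' algebra_simps)
  also have "\<dots> = sc (inverse (q + qb) + qb * qb * inverse (q + qb) - qb) Z"
    unfolding AB by (simp add: scale_left_distrib scale_left_diff_distrib sc_simps)
  also have "inverse (q + qb) + qb * qb * inverse (q + qb) - qb = 0"
  proof -
    have "1 + qb * qb = qb * (q + qb)" using q_nz by (simp add: algebra_simps)
    then have "(1 + qb * qb) * inverse (q + qb) = qb" using q_add by simp
    then show ?thesis by (simp add: distrib_right)
  qed
  finally show ?thesis by simp
qed

lemma serre2_q_commute:
  assumes "serre2 x v" defines "w \<equiv> v \<cdot> x - sc qb (x \<cdot> v)"
  shows "w \<cdot> x = sc q (x \<cdot> w)"
proof -
  have "w \<cdot> x - sc q (x \<cdot> w) = x \<cdot> x \<cdot> v + v \<cdot> x \<cdot> x - sc (q + qb) (x \<cdot> v \<cdot> x)"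
    unfolding w_def using q_nz by (simp add: alg scale_left_distrib algebra_simps)
  then show ?thesis using assms(1) by simp
qed

lemma serre2_descend:
  assumes "serre2 x y" and c: "v \<cdot> x = x \<cdot> v" defines "w \<equiv> v \<cdot> y - sc qb (y \<cdot> v)"
  shows "serre2 x w"
proof -
  note c' = c then_mult[OF c]
  have "v \<cdot> (x \<cdot> x \<cdot> y + y \<cdot> x \<cdot> x) - sc qb ((x \<cdot> x \<cdot> y + y \<cdot> x \<cdot> x) \<cdot> v) =
      v \<cdot> sc (q + qb) (x \<cdot> y \<cdot> x) - sc qb (sc (q + qb) (x \<cdot> y \<cdot> x) \<cdot> v)"
    unfolding assms(1) ..
  then show ?thesis unfolding w_def by (simp add: alg c' algebra_simps)
qed

text \<open>
  The top element satisfies the Serre relation that is quadratic in \<open>f\<^sub>T\<^sub>-\<^sub>1\<close>.  This is the one that a simple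
  edge of the Dynkin diagram and the double edge of \<open>SO_odd\<close> have in common, so the chain may start from any simple
  generator attached to \<open>f\<^sub>T\<^sub>-\<^sub>1\<close>: from the short root vector \<open>f\<^sub>n\<close> of \<open>SO_odd\<close>, and for \<open>SO_even\<close> from
  either end node of the fork.
\<close>

lemma lo_familyI:
  assumes far: "\<And>k l. 1 \<le> k \<Longrightarrow> l < T \<Longrightarrow> Suc k < l \<Longrightarrow> f k \<cdot> f l = f l \<cdot> f k"
    and near: "\<And>k. 1 \<le> k \<Longrightarrow> Suc k < T \<Longrightarrow> serre2 (f k) (f (Suc k)) \<and> serre2 (f (Suc k)) (f k)"
    and top: "\<And>k. 1 \<le> k \<Longrightarrow> Suc k < T \<Longrightarrow> w T \<cdot> f k = f k \<cdot> w T"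
    and topS: "\<And>k. 1 \<le> k \<Longrightarrow> Suc k = T \<Longrightarrow> serre2 (f k) (w T)"
    and rec: "\<And>a. 1 \<le> a \<Longrightarrow> a < T \<Longrightarrow> w a = w (Suc a) \<cdot> f a - sc qb (f a \<cdot> w (Suc a))"
  shows "lo_family sc m q f T w"
proof -
  have *: "(a < T \<longrightarrow> w a \<cdot> f a = sc q (f a \<cdot> w a)) \<and>
      (\<forall>l. 1 \<le> l \<longrightarrow> l < T \<longrightarrow> l \<noteq> a \<longrightarrow> Suc l \<noteq> a \<longrightarrow> w a \<cdot> f l = f l \<cdot> w a) \<and>
      (\<forall>l. 1 \<le> l \<longrightarrow> Suc l = a \<longrightarrow> serre2 (f l) (w a))" if "1 \<le> a" "a \<le> T" for a
    using that
  proof (induction "T - a" arbitrary: a rule: less_induct)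
    case less
    show ?case
    proof (cases "a = T")
      case True
      then show ?thesis using top topS by auto
    next
      case False
      then have aT: "a < T" using less.prems by simp
      have IH1: "\<And>l. 1 \<le> l \<Longrightarrow> l < T \<Longrightarrow> l \<noteq> Suc a \<Longrightarrow> Suc l \<noteq> Suc a \<Longrightarrow>
          w (Suc a) \<cdot> f l = f l \<cdot> w (Suc a)" "serre2 (f a) (w (Suc a))"
        using less.hyps[of "Suc a"] less.prems aT by auto
      note w = rec[OF less.prems(1) aT]
      have q_comm: "w a \<cdot> f a = sc q (f a \<cdot> w a)"
        unfolding w by (rule serre2_q_commute[OF IH1(2)])
      have comm: "w a \<cdot> f l = f l \<cdot> w a" if l: "1 \<le> l" "l < T" "l \<noteq> a" "Suc l \<noteq> a" for l
      proof (cases "l = Suc a")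
        case True
        have "w (Suc (Suc a)) \<cdot> f a = f a \<cdot> w (Suc (Suc a))" "serre2 (f (Suc a)) (w (Suc (Suc a)))"
          using less.hyps[of "Suc (Suc a)"] less.prems aT True l by auto
        moreover have "serre2 (f (Suc a)) (f a)" using near[of a] less.prems True l by simp
        ultimately show ?thesis
          using serre2_commute[of "f (Suc a)" "f a" "w (Suc (Suc a))"] rec[of "Suc a"] w True l by simp
      next
        case False
        have c: "w (Suc a) \<cdot> f l = f l \<cdot> w (Suc a)" using IH1(1) l False by simp
        have d: "f a \<cdot> f l = f l \<cdot> f a"
          using far[of a l] far[of l a] l False less.prems aT by (cases "l < a") auto
        show ?thesis unfolding w by (simp add: alg c d then_mult[OF c] then_mult[OF d])
      qed
      have "serre2 (f l) (w a)" if l: "1 \<le> l" "Suc l = a" for l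
      proof -
        have "serre2 (f l) (f a)" using near[of l] l aT by simp
        moreover have "w (Suc a) \<cdot> f l = f l \<cdot> w (Suc a)" using IH1(1)[of l] l aT by simp
        ultimately show ?thesis unfolding w by (rule serre2_descend)
      qed
      then show ?thesis using q_comm comm by blast
    qed
  qed
  show ?thesis
    unfolding lo_family_def using * rec by (auto simp: alg)
qed

lemma half_relD:
  assumes "half_rel sc m q f M G"
  shows "1 \<le> a \<Longrightarrow> a < M \<Longrightarrow> 1 \<le> b \<Longrightarrow> b \<le> M \<Longrightarrow> b \<noteq> a \<Longrightarrow> b \<noteq> Suc a \<Longrightarrow>
        G (Suc a) b \<cdot> f a = G a b + sc qb (f a \<cdot> G (Suc a) b)"
    and "1 \<le> a \<Longrightarrow> a < M \<Longrightarrow> G (Suc a) a \<cdot> f a = sc qb (G a a) + sc (qb * qb) (f a \<cdot> G (Suc a) a)"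
    and "1 \<le> a \<Longrightarrow> a < M \<Longrightarrow>
        G (Suc a) (Suc a) \<cdot> f a = sc q (G a (Suc a)) - sc q (G (Suc a) a) + f a \<cdot> G (Suc a) (Suc a)"
    and "1 \<le> a \<Longrightarrow> a < M \<Longrightarrow> 1 \<le> b \<Longrightarrow> b \<le> M \<Longrightarrow> b \<noteq> a \<Longrightarrow> b \<noteq> Suc a \<Longrightarrow>
        G a b \<cdot> f a = sc q (f a \<cdot> G a b)"
    and "1 \<le> a \<Longrightarrow> a \<le> M \<Longrightarrow> 1 \<le> b \<Longrightarrow> b \<le> M \<Longrightarrow> 1 \<le> l \<Longrightarrow> l < M \<Longrightarrow>
        l \<noteq> a \<Longrightarrow> Suc l \<noteq> a \<Longrightarrow> l \<noteq> b \<Longrightarrow> Suc l \<noteq> b \<Longrightarrow> G a b \<cdot> f l = f l \<cdot> G a b"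
  using assms unfolding half_rel_def by (blast, simp add: sc_eq_iff q_nz sc_simps, blast+)

lemma half_relI:
  assumes "\<And>a b. 1 \<le> a \<Longrightarrow> a < M \<Longrightarrow> 1 \<le> b \<Longrightarrow> b \<le> M \<Longrightarrow> b \<noteq> a \<Longrightarrow> b \<noteq> Suc a \<Longrightarrow>
        G (Suc a) b \<cdot> f a = G a b + sc qb (f a \<cdot> G (Suc a) b)"
    and "\<And>a. 1 \<le> a \<Longrightarrow> a < M \<Longrightarrow> G (Suc a) a \<cdot> f a = sc qb (G a a) + sc (qb * qb) (f a \<cdot> G (Suc a) a)"
    and "\<And>a. 1 \<le> a \<Longrightarrow> a < M \<Longrightarrow>
        G (Suc a) (Suc a) \<cdot> f a = sc q (G a (Suc a)) - sc q (G (Suc a) a) + f a \<cdot> G (Suc a) (Suc a)"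
    and "\<And>a b. 1 \<le> a \<Longrightarrow> a < M \<Longrightarrow> 1 \<le> b \<Longrightarrow> b \<le> M \<Longrightarrow> b \<noteq> a \<Longrightarrow> b \<noteq> Suc a \<Longrightarrow>
        G a b \<cdot> f a = sc q (f a \<cdot> G a b)"
    and "\<And>a b l. 1 \<le> a \<Longrightarrow> a \<le> M \<Longrightarrow> 1 \<le> b \<Longrightarrow> b \<le> M \<Longrightarrow> 1 \<le> l \<Longrightarrow> l < M \<Longrightarrow>
        l \<noteq> a \<Longrightarrow> Suc l \<noteq> a \<Longrightarrow> l \<noteq> b \<Longrightarrow> Suc l \<noteq> b \<Longrightarrow> G a b \<cdot> f l = f l \<cdot> G a b"
  shows "half_rel sc m q f M G"
  unfolding half_rel_def using assms(1,3,4,5) assms(2) q_nz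
  by (intro conjI allI impI) (simp_all add: sc_simps flip: mult.assoc)

lemma lo_familyD:
  assumes "lo_family sc m q f T w"
  shows "1 \<le> a \<Longrightarrow> a < T \<Longrightarrow> w (Suc a) \<cdot> f a = w a + sc qb (f a \<cdot> w (Suc a))"
    and "1 \<le> a \<Longrightarrow> a < T \<Longrightarrow> w a \<cdot> f a = sc q (f a \<cdot> w a)"
    and "1 \<le> a \<Longrightarrow> a \<le> T \<Longrightarrow> 1 \<le> l \<Longrightarrow> l < T \<Longrightarrow> l \<noteq> a \<Longrightarrow> Suc l \<noteq> a \<Longrightarrow> w a \<cdot> f l = f l \<cdot> w a"
  using assms unfolding lo_family_def by blast+

lemma up_familyD:
  assumes "lo_family sc (\<lambda>x y. y \<cdot> x) q f T w"
  shows "1 \<le> a \<Longrightarrow> a < T \<Longrightarrow> w (Suc a) \<cdot> f a = sc q (f a \<cdot> w (Suc a)) - sc q (w a)"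
    and "1 \<le> a \<Longrightarrow> a < T \<Longrightarrow> w a \<cdot> f a = sc qb (f a \<cdot> w a)"
    and "1 \<le> a \<Longrightarrow> a \<le> T \<Longrightarrow> 1 \<le> l \<Longrightarrow> l < T \<Longrightarrow> l \<noteq> a \<Longrightarrow> Suc l \<noteq> a \<Longrightarrow> w a \<cdot> f l = f l \<cdot> w a"
proof -
  have "f a \<cdot> w (Suc a) = w a + sc qb (w (Suc a) \<cdot> f a)" if "1 \<le> a" "a < T"
    using assms that unfolding lo_family_def by blast
  then show "1 \<le> a \<Longrightarrow> a < T \<Longrightarrow> w (Suc a) \<cdot> f a = sc q (f a \<cdot> w (Suc a)) - sc q (w a)"
    using q_nz by (simp add: sc_simps)
  have "f a \<cdot> w a = sc q (w a \<cdot> f a)" if "1 \<le> a" "a < T"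
    using assms that unfolding lo_family_def by blast
  then show "1 \<le> a \<Longrightarrow> a < T \<Longrightarrow> w a \<cdot> f a = sc qb (f a \<cdot> w a)"
    using q_nz by (simp add: sc_simps)
  show "1 \<le> a \<Longrightarrow> a \<le> T \<Longrightarrow> 1 \<le> l \<Longrightarrow> l < T \<Longrightarrow> l \<noteq> a \<Longrightarrow> Suc l \<noteq> a \<Longrightarrow> w a \<cdot> f l = f l \<cdot> w a"
    using assms unfolding lo_family_def by metis
qed

lemma half_rel_linear:
  assumes "half_rel sc m q f M G" "half_rel sc m q f M H"
  shows "half_rel sc m q f M (\<lambda>a b. sc \<alpha> (G a b) + sc \<beta> (H a b))"
  by (rule half_relI)
    (simp_all add: alg half_relD[OF assms(1)] half_relD[OF assms(2)] algebra_simps)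

text \<open>
  The two ways of multiplying a lower and an upper chain.  The factor \<open>q\<close> on the diagonal in the second one is
  the \<open>q\<^bsup>\<delta>\<^sub>i\<^sub>j\<^esup>\<close> in the definition of the elements \<open>f\<^sub>i\<^sub>j\<^sub>'\<close>.
\<close>

lemma half_rel_product:
  assumes w: "lo_family sc m q f M w" and w': "lo_family sc (\<lambda>x y. y \<cdot> x) q f M w'"
  shows "half_rel sc m q f M (\<lambda>a b. w a \<cdot> w' b)"
proof -
  note 1 = lo_familyD[OF w] then_mult[OF lo_familyD(1)[OF w]] then_mult[OF lo_familyD(2)[OF w]]
    then_mult[OF lo_familyD(3)[OF w]] up_familyD[OF w']
  show ?thesis
    using q_nz by (intro half_relI) (simp_all add: alg 1 algebra_simps)
qed

lemma half_rel_reverse_product: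
  assumes w: "lo_family sc m q f M w" and w': "lo_family sc (\<lambda>x y. y \<cdot> x) q f M w'"
  shows "half_rel sc m q f M (\<lambda>a b. sc (if a = b then q else 1) (w' b \<cdot> w a))"
proof -
  note 1 = lo_familyD[OF w] up_familyD[OF w'] then_mult[OF up_familyD(1)[OF w']]
    then_mult[OF up_familyD(2)[OF w']] then_mult[OF up_familyD(3)[OF w']]
  show ?thesis
    using q_nz by (intro half_relI) (simp_all add: alg 1 algebra_simps)
qed

text \<open>
  The index \<open>M + 1\<close> is out of reach of the generators \<open>f\<^sub>1, \<dots>, f\<^sub>M\<^sub>-\<^sub>1\<close>.  Hence \<open>G\<^sub>M\<^sub>+\<^sub>1\<^sub>b\<close> behaves like an upper
  chain, and its product with the lower chain satisfies the same relations as \<open>G\<close>.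
\<close>

lemma half_rel_left:
  assumes G: "half_rel sc m q f (Suc M) G" "half_rel sc (\<lambda>x y. y \<cdot> x) q f (Suc M) (\<lambda>a b. G b a)"
    and w: "lo_family sc m q f M w"
  shows "half_rel sc m q f M (\<lambda>a b. sc \<kappa> (G a b) + w a \<cdot> G (Suc M) b)"
proof -
  interpret fl: q_algebra sc "\<lambda>x y. y \<cdot> x" q by (rule flip)
  have c: "G (Suc M) b \<cdot> f l = f l \<cdot> G (Suc M) b"
    if "1 \<le> b" "b \<le> M" "1 \<le> l" "l < M" "l \<noteq> b" "Suc l \<noteq> b" for b l
    using half_relD(5)[OF G(1), of "Suc M" b l] that by simp
  have c1: "G (Suc M) a \<cdot> f a = sc qb (f a \<cdot> G (Suc M) a)" if "1 \<le> a" "a < M" for a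
    using fl.half_relD(4)[OF G(2), of a "Suc M"] that q_nz by (simp add: sc_simps)
  have c2: "G (Suc M) (Suc a) \<cdot> f a = sc q (f a \<cdot> G (Suc M) (Suc a)) - sc q (G (Suc M) a)"
    if "1 \<le> a" "a < M" for a
    using fl.half_relD(1)[OF G(2), of a "Suc M"] that q_nz by (simp add: sc_simps)
  note 1 = c c1 c2 lo_familyD[OF w] then_mult[OF lo_familyD(1)[OF w]] then_mult[OF lo_familyD(2)[OF w]]
    then_mult[OF lo_familyD(3)[OF w]] half_relD[OF G(1)]
  show ?thesis
    using q_nz by (intro half_relI) (simp_all add: alg 1 algebra_simps)
qed

lemma half_rel_right:
  assumes G: "half_rel sc m q f (Suc M) G" and w': "lo_family sc (\<lambda>x y. y \<cdot> x) q f M w'"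
  shows "half_rel sc m q f M (\<lambda>a b. sc \<kappa> (G a b) + G a (Suc M) \<cdot> w' b)"
proof -
  have c: "G a (Suc M) \<cdot> f l = f l \<cdot> G a (Suc M)"
    if "1 \<le> a" "a \<le> M" "1 \<le> l" "l < M" "l \<noteq> a" "Suc l \<noteq> a" for a l
    using half_relD(5)[OF G, of a "Suc M" l] that by simp
  have c1: "G a (Suc M) \<cdot> f a = sc q (f a \<cdot> G a (Suc M))" if "1 \<le> a" "a < M" for a
    using half_relD(4)[OF G, of a "Suc M"] that by simp
  have c2: "G (Suc a) (Suc M) \<cdot> f a = G a (Suc M) + sc qb (f a \<cdot> G (Suc a) (Suc M))"
    if "1 \<le> a" "a < M" for a
    using half_relD(1)[OF G, of a "Suc M"] that by simp
  note 1 = c c1 c2 then_mult[OF c] then_mult[OF c1] then_mult[OF c2] up_familyD[OF w'] half_relD[OF G]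
  show ?thesis
    using q_nz by (intro half_relI) (simp_all add: alg 1 algebra_simps)
qed

text \<open>
  If the last diagonal entry is 0, its neighbours \<open>X = G\<^sub>M\<^sub>+\<^sub>1\<^sub>M\<close> and \<open>G\<^sub>M\<^sub>M\<^sub>+\<^sub>1\<close> agree.  Then both halves of the
  relations express \<open>G\<^sub>M\<^sub>M\<close> by \<open>X\<close> and \<open>f\<^sub>M\<close>; comparison shows that these commute and
  \<open>G\<^sub>M\<^sub>M = (q - q\<^sup>-\<^sup>1) f\<^sub>M X\<close>.
\<close>

lemma diagonal_vanishes:
  assumes G: "half_rel sc m q f (Suc M) G" "half_rel sc (\<lambda>x y. y \<cdot> x) q f (Suc M) (\<lambda>a b. G b a)"
    and M: "1 \<le> M" and zero: "G (Suc M) (Suc M) = 0"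
  shows "sc (- inverse (q - qb)) (G M M) + f M \<cdot> G (Suc M) M = 0"
    and "sc (- inverse (q - qb)) (G M M) + G M (Suc M) \<cdot> f M = 0"
proof -
  interpret fl: q_algebra sc "\<lambda>x y. y \<cdot> x" q by (rule flip)
  define X where "X = G (Suc M) M"
  have "sc q (G M (Suc M) - X) = 0"
    using half_relD(3)[OF G(1), of M] M zero by (simp add: m_zero sc_simps X_def)
  then have X: "G M (Suc M) = X" using q_nz by simp
  have 1: "X \<cdot> f M = sc qb (G M M) + sc (qb * qb) (f M \<cdot> X)"
    using half_relD(2)[OF G(1), of M] M by (simp add: X_def)
  have 2: "f M \<cdot> X = sc qb (G M M) + sc (qb * qb) (X \<cdot> f M)"
    using fl.half_relD(2)[OF G(2), of M] M by (simp add: X)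
  have "sc (1 + qb * qb) (X \<cdot> f M - f M \<cdot> X) = X \<cdot> f M - f M \<cdot> X + sc (qb * qb) (X \<cdot> f M - f M \<cdot> X)"
    by (simp add: scale_left_distrib)
  also have "\<dots> = (sc qb (G M M) + sc (qb * qb) (f M \<cdot> X)) - (sc qb (G M M) + sc (qb * qb) (X \<cdot> f M)) +
      sc (qb * qb) (X \<cdot> f M - f M \<cdot> X)"
    using 1 2 by simp
  also have "\<dots> = 0" by (simp add: sc_simps)
  finally have "sc (1 + qb * qb) (X \<cdot> f M - f M \<cdot> X) = 0" .
  moreover have "1 + qb * qb \<noteq> 0" using q_add q_nz by (auto simp: field_simps)
  ultimately have c: "X \<cdot> f M = f M \<cdot> X" by simp
  have "sc qb (G M M) = sc (1 - qb * qb) (f M \<cdot> X)"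
    using 1 unfolding c by (simp add: scale_left_diff_distrib eq_diff_eq)
  then have "sc q (sc qb (G M M)) = sc q (sc (1 - qb * qb) (f M \<cdot> X))" by simp
  moreover have "q * (1 - qb * qb) = q - qb" using q_nz by (simp add: algebra_simps)
  ultimately have H: "G M M = sc (q - qb) (f M \<cdot> X)" using q_nz by (simp add: sc_simps)
  show "sc (- inverse (q - qb)) (G M M) + f M \<cdot> G (Suc M) M = 0"
    "sc (- inverse (q - qb)) (G M M) + G M (Suc M) \<cdot> f M = 0"
    unfolding X X_def[symmetric] c H using q_sub by (simp_all add: sc_simps)
qed

end

section \<open>A ring type containing the quotient algebras\<close>

text \<open>
  The projection of the free algebra on countably many generators to that on \<open>f\<^sub>1, \<dots>, f\<^sub>n\<close> which kills the other
  generators.  Pulling the Serre ideal back along it removes all conditions of membership in the carrier.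
\<close>

definition restrict_letters :: "nat \<Rightarrow> freealg \<Rightarrow> freealg" where
  "restrict_letters n x = (\<Sum>w\<in>Poly_Mapping.keys x.
     if set (letters w) \<subseteq> {1..n} then Poly_Mapping.single w (Poly_Mapping.lookup x w) else 0)"

lemma lookup_restrict_letters:
  "Poly_Mapping.lookup (restrict_letters n x) w = (if set (letters w) \<subseteq> {1..n} then Poly_Mapping.lookup x w else 0)"
proof -
  have "Poly_Mapping.lookup (restrict_letters n x) w = (\<Sum>v\<in>Poly_Mapping.keys x.
      if v = w then (if set (letters w) \<subseteq> {1..n} then Poly_Mapping.lookup x w else 0) else 0)"
    unfolding restrict_letters_def lookup_sum
    by (intro sum.cong) (auto simp: lookup_single when_def)
  then show ?thesis by (simp add: in_keys_iff)
qed

lemma restrict_letters_add: "restrict_letters n (x + y) = restrict_letters n x + restrict_letters n y"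
  by (rule poly_mapping_eqI) (simp add: lookup_restrict_letters lookup_add)

lemma restrict_letters_sum: "restrict_letters n (sum f A) = (\<Sum>a\<in>A. restrict_letters n (f a))"
proof -
  have "restrict_letters n 0 = 0" by (rule poly_mapping_eqI) (simp add: lookup_restrict_letters)
  then show ?thesis
    by (induction A rule: infinite_finite_induct) (simp_all add: restrict_letters_add)
qed

lemma restrict_letters_single:
  "restrict_letters n (Poly_Mapping.single w a) = (if set (letters w) \<subseteq> {1..n} then Poly_Mapping.single w a else 0)"
  by (rule poly_mapping_eqI) (simp add: lookup_restrict_letters lookup_single when_def)

lemma restrict_letters_mult: "restrict_letters n (x * y) = restrict_letters n x * restrict_letters n y"
proof -
  have "restrict_letters n (Poly_Mapping.single u a * Poly_Mapping.single v b) =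
      restrict_letters n (Poly_Mapping.single u a) * restrict_letters n (Poly_Mapping.single v b)" for u v a b
    by (simp add: mult_single restrict_letters_single plus_fword_def)
  then show ?thesis
    by (subst (1 2) poly_mapping_sum_single[of x], subst (1 2) poly_mapping_sum_single[of y])
      (simp add: sum_distrib_left sum_distrib_right restrict_letters_sum)
qed

lemma restrict_letters_carrier: "restrict_letters n x \<in> carrier (free_ring n)"
proof -
  have "set (letters w) \<subseteq> {1..n}" if "w \<in> Poly_Mapping.keys (restrict_letters n x)" for w
    using that lookup_restrict_letters[of n x w] unfolding in_keys_iff by presburger
  then show ?thesis by (simp add: free_ring_def)
qed

lemma restrict_letters_id: "x \<in> carrier (free_ring n) \<Longrightarrow> restrict_letters n x = x"
  by (rule poly_mapping_eqI) (auto simp: lookup_restrict_letters free_ring_def in_keys_iff)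

lemma restrict_letters_minus: "restrict_letters n (- x) = - restrict_letters n x"
  by (rule poly_mapping_eqI) (simp add: lookup_restrict_letters)

definition null_at :: "series \<times> nat \<times> complex \<Rightarrow> freealg \<Rightarrow> bool" where
  "null_at p x = (case p of (g, n, L) \<Rightarrow> quantum_group g n L \<longrightarrow> restrict_letters n x \<in> serre_ideal g n L)"

lemma null_at_closed:
  "null_at p 0" "null_at p x \<Longrightarrow> null_at p y \<Longrightarrow> null_at p (x + y)" "null_at p x \<Longrightarrow> null_at p (- x)"
  "null_at p x \<Longrightarrow> null_at p (x * y)" "null_at p x \<Longrightarrow> null_at p (y * x)"
proof -
  obtain g n L where p: "p = (g, n, L)" by (cases p)
  have "restrict_letters n 0 = 0" by (rule poly_mapping_eqI) (simp add: lookup_restrict_letters)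
  then show "null_at p 0" "null_at p x \<Longrightarrow> null_at p y \<Longrightarrow> null_at p (x + y)"
    "null_at p x \<Longrightarrow> null_at p (- x)" "null_at p x \<Longrightarrow> null_at p (x * y)" "null_at p x \<Longrightarrow> null_at p (y * x)"
    using quantum_group.ideal_closed[of g n L]
    by (simp_all add: null_at_def p restrict_letters_add restrict_letters_minus restrict_letters_mult restrict_letters_carrier)
qed

definition null_family :: "(series \<times> nat \<times> complex \<Rightarrow> freealg) \<Rightarrow> bool" where
  "null_family x \<longleftrightarrow> (\<forall>p. null_at p (x p))"

text \<open>
  The algebras \<open>U\<^sub>q(\<gg>\<^sub>-)\<close> depend on parameters, so none of them is a type, but their product over all parameters is
  one.  It is an instance of the class of rings, each factor is embedded in it, and identities in a factor can be
  proved by rewriting in the product.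
\<close>

quotient_type uq_product = "series \<times> nat \<times> complex \<Rightarrow> freealg" / "\<lambda>x y. null_family (\<lambda>p. x p - y p)"
proof (rule equivpI)
  show "reflp (\<lambda>x y. null_family (\<lambda>p. x p - y p))"
    by (simp add: reflp_def null_family_def null_at_closed)
  show "symp (\<lambda>x y. null_family (\<lambda>p. x p - y p))"
    unfolding symp_def null_family_def using null_at_closed(3) by (metis minus_diff_eq)
  show "transp (\<lambda>x y. null_family (\<lambda>p. x p - y p))"
    unfolding transp_def null_family_def using null_at_closed(2) by (metis add_diff_eq diff_add_cancel)
qed

instantiation uq_product :: ring
begin

lift_definition zero_uq_product :: uq_product is "\<lambda>p. 0" .

lift_definition plus_uq_product :: "uq_product \<Rightarrow> uq_product \<Rightarrow> uq_product" is "\<lambda>x y p. x p + y p"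
  unfolding null_family_def using null_at_closed(2) by (metis add_diff_add)

lift_definition uminus_uq_product :: "uq_product \<Rightarrow> uq_product" is "\<lambda>x p. - x p"
  unfolding null_family_def using null_at_closed(3) by (metis minus_diff_minus)

lift_definition minus_uq_product :: "uq_product \<Rightarrow> uq_product \<Rightarrow> uq_product" is "\<lambda>x y p. x p - y p"
proof -
  fix x x' y y' :: "series \<times> nat \<times> complex \<Rightarrow> freealg"
  assume "null_family (\<lambda>p. x p - x' p)" "null_family (\<lambda>p. y p - y' p)"
  then have "null_at p ((x p - x' p) + - (y p - y' p))" for p
    unfolding null_family_def using null_at_closed(2,3) by blast
  then show "null_family (\<lambda>p. (x p - y p) - (x' p - y' p))"
    by (simp add: null_family_def algebra_simps)
qed

lift_definition times_uq_product :: "uq_product \<Rightarrow> uq_product \<Rightarrow> uq_product" is "\<lambda>x y p. x p * y p"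
proof -
  fix x x' y y' :: "series \<times> nat \<times> complex \<Rightarrow> freealg"
  assume "null_family (\<lambda>p. x p - x' p)" "null_family (\<lambda>p. y p - y' p)"
  then have "null_at p ((x p - x' p) * y p + x' p * (y p - y' p))" for p
    unfolding null_family_def using null_at_closed(2,4,5) by blast
  then show "null_family (\<lambda>p. x p * y p - x' p * y' p)"
    by (simp add: null_family_def algebra_simps)
qed

instance
  by standard (transfer; simp add: null_family_def null_at_closed algebra_simps)+

end

lift_definition uq_scale :: "complex \<Rightarrow> uq_product \<Rightarrow> uq_product" is "\<lambda>c x p. scal c * x p"
proof -
  fix c and x y :: "series \<times> nat \<times> complex \<Rightarrow> freealg"
  assume "null_family (\<lambda>p. x p - y p)"
  then have "null_at p (scal c * (x p - y p))" for p
    unfolding null_family_def using null_at_closed(5) by blast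
  then show "null_family (\<lambda>p. scal c * x p - scal c * y p)"
    by (simp add: null_family_def algebra_simps)
qed

lemma uq_scale_laws:
  "uq_scale c (x + y) = uq_scale c x + uq_scale c y" "uq_scale (c + d) x = uq_scale c x + uq_scale d x"
  "uq_scale c (uq_scale d x) = uq_scale (c * d) x" "uq_scale 1 x = x"
  "uq_scale c x * y = uq_scale c (x * y)" "x * uq_scale c y = uq_scale c (x * y)"
proof -
  have *: "x * (scal c * y) = scal c * (x * y)" for c x y by (metis mult.assoc scal_commute)
  show "uq_scale c (x + y) = uq_scale c x + uq_scale c y"
    by transfer (simp add: null_family_def null_at_closed distrib_left)
  show "uq_scale (c + d) x = uq_scale c x + uq_scale d x"
    by transfer (simp add: null_family_def null_at_closed scal_simps distrib_right)
  show "uq_scale c (uq_scale d x) = uq_scale (c * d) x"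
    by transfer (simp add: null_family_def null_at_closed scal_mult mult.assoc[symmetric])
  show "uq_scale 1 x = x"
    by transfer (simp add: null_family_def null_at_closed scal_simps)
  show "uq_scale c x * y = uq_scale c (x * y)"
    by transfer (simp add: null_family_def null_at_closed mult.assoc)
  show "x * uq_scale c y = uq_scale c (x * y)"
    by transfer (simp add: null_family_def null_at_closed *)
qed

definition embed :: "series \<times> nat \<times> complex \<Rightarrow> freealg \<Rightarrow> uq_product" where
  "embed p x = abs_uq_product (\<lambda>p'. if p' = p then x else 0)"

lemma embed_hom:
  "embed p (x + y) = embed p x + embed p y" "embed p (x - y) = embed p x - embed p y"
  "embed p (x * y) = embed p x * embed p y" "embed p 0 = 0"
  "embed p (scal c * x) = uq_scale c (embed p x)"
  unfolding embed_def plus_uq_product.abs_eq minus_uq_product.abs_eq times_uq_product.abs_eq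
    zero_uq_product.abs_eq uq_scale.abs_eq
  by (rule arg_cong[where f = abs_uq_product], auto)+

lemma embed_eq_zero: "embed p x = 0 \<longleftrightarrow> null_at p x"
  unfolding embed_def zero_uq_product.abs_eq uq_product.abs_eq_iff
  by (auto simp: null_family_def null_at_closed simp del: split_paired_All split: if_splits)

context quantum_group
begin

definition "\<iota> = embed (g, n, L)"

lemmas \<iota>_hom = embed_hom[of "(g, n, L)", folded \<iota>_def]

lemma \<iota>_eq_iff:
  assumes "x \<in> carrier (free_ring n)" "y \<in> carrier (free_ring n)"
  shows "\<iota> x = \<iota> y \<longleftrightarrow> x - y \<in> I"
proof -
  have "\<iota> x = \<iota> y \<longleftrightarrow> embed (g, n, L) (x - y) = 0" by (simp add: \<iota>_def embed_hom)
  also have "\<dots> \<longleftrightarrow> x - y \<in> I"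
    unfolding embed_eq_zero
    using restrict_letters_id[OF carrier_closed(3)[OF assms]] quantum_group_axioms by (simp add: null_at_def)
  finally show ?thesis .
qed

lemma \<iota>_restrict_letters: "\<iota> (restrict_letters n x) = \<iota> x"
proof -
  have "restrict_letters n (restrict_letters n x - x) = 0"
    by (rule poly_mapping_eqI) (simp add: lookup_restrict_letters lookup_minus)
  then have "embed (g, n, L) (restrict_letters n x - x) = 0"
    unfolding embed_eq_zero null_at_def by (simp add: ideal_closed)
  then show ?thesis by (simp add: \<iota>_def embed_hom)
qed

sublocale U: q_algebra uq_scale "(*)" q
proof unfold_locales
  show "q - inverse q \<noteq> 0" "q + inverse q \<noteq> 0" by (rule q_sub_qb, rule q_add_qb)
qed (simp_all add: uq_scale_laws distrib_left distrib_right mult.assoc)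

end

section \<open>Chains in \<open>U\<^sub>q(\<gg>\<^sub>-)\<close>\<close>

lemma scal_diff: "scal (a - b) = scal a - scal b"
  by (simp add: scal_def single_diff)

context quantum_group
begin

definition "fq a = \<iota> (gen a)"

abbreviation "sc \<equiv> uq_scale"

lemma \<iota>_serre: "l \<in> {1..n} \<Longrightarrow> m \<in> {1..n} \<Longrightarrow> l \<noteq> m \<Longrightarrow> \<iota> (serre g n L l m) = 0"
proof -
  assume lm: "l \<in> {1..n}" "m \<in> {1..n}" "l \<noteq> m"
  then have "serre g n L l m \<in> I"
    unfolding serre_ideal_def
    by (intro subsetD[OF ring.genideal_self[OF ring_free_ring serre_generators]]) auto
  then have "\<iota> (serre g n L l m) = \<iota> 0"
    using lm by (subst \<iota>_eq_iff) (simp_all add: serre_carrier carrier_closed)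
  then show ?thesis by (simp add: \<iota>_hom)
qed

lemma fq_commute:
  assumes "l \<in> {1..n}" "m \<in> {1..n}" "l \<noteq> m" "ip n (alpha g n l) (alpha g n m) = 0"
  shows "fq l * fq m = fq m * fq l"
proof -
  define p where "p = q_ix g n L l"
  have p: "p \<noteq> 0" "p ^ 2 \<noteq> 1"
    using q_ix_nonunit[OF assms(1), of 1] by (auto simp: p_def q_ix_def qpow_simps)
  then have d: "p - inverse p \<noteq> 0" by (auto simp: field_simps power2_eq_square)
  note qbinom_small(1,2)[OF p(1) d]
  moreover have "nat (1 - cartan g n l m) = 1" by (simp add: cartan_def assms(4))
  ultimately have "serre g n L l m = gen l * gen m - gen m * gen l"
    by (simp add: serre_def Let_def p_def[symmetric] scal_simps scal_minus)
  then show ?thesis using \<iota>_serre[OF assms(1-3)] by (simp add: \<iota>_hom fq_def)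
qed

lemma fq_serre:
  assumes "l \<in> {1..n}" "m \<in> {1..n}" "l < n" "l \<noteq> m" "ip n (alpha g n l) (alpha g n m) = - 1"
  shows "U.serre2 (fq l) (fq m)"
proof -
  have d: "ip n (alpha g n l) (alpha g n l) = 2" using ip_alpha_self[OF rank, of l] assms by simp
  have "q_ix g n L l = q" by (simp add: q_ix_def d)
  moreover have "nat (1 - cartan g n l m) = 2" by (simp add: cartan_def assms(5) d)
  ultimately have "serre g n L l m =
      gen l * gen l * gen m - scal (q + qb) * (gen l * gen m * gen l) + gen m * gen l * gen l"
    using qbinom_small(3-5)[OF q_nonzero q_sub_qb q_add_qb]
    by (simp add: serre_def Let_def numeral_2_eq_2 scal_simps scal_minus scal_diff algebra_simps)
  then have "\<iota> (gen l * gen l * gen m) - sc (q + qb) (\<iota> (gen l * gen m * gen l)) + \<iota> (gen m * gen l * gen l) = 0"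
    using \<iota>_serre[OF assms(1,2,4)] by (simp only: \<iota>_hom(1,2,5))
  then show ?thesis by (simp add: \<iota>_hom(3) fq_def mult.assoc algebra_simps)
qed

definition "br x y = x * y - sc qb (y * x)"

lemma \<iota>_qcomm: "\<iota> (qcomm c x y) = \<iota> x * \<iota> y - sc c (\<iota> y * \<iota> x)"
proof -
  have "\<iota> (scal c * (y * x)) = sc c (\<iota> y * \<iota> x)" by (simp only: \<iota>_hom(5)) (simp only: \<iota>_hom(3))
  then show ?thesis by (simp add: qcomm_def \<iota>_hom(2,3) mult.assoc)
qed

lemma \<iota>_br: "\<iota> (qcomm qb x y) = br (\<iota> x) (\<iota> y)"
  by (simp add: \<iota>_qcomm br_def)

text \<open>
  The chains are defined by nested commutators with the top generator outside.  This moves the bottom generator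
  outside instead.
\<close>

lemma br_assoc: "x * z = z * x \<Longrightarrow> br x (br y z) = br (br x y) z"
proof -
  assume c: "x * z = z * x"
  have "x * (z * y) = z * (x * y)" "y * (x * z) = y * (z * x)"
    using c by (simp_all flip: mult.assoc)
  then show ?thesis
    unfolding br_def by (simp add: U.alg algebra_simps)
qed

lemma ip_far:
  assumes "1 \<le> l" "Suc l < m" "2 * Suc m \<le> dimN g n + 1"
  shows "ip n (alpha g n l) (alpha g n m) = 0"
  using assms ip_alpha_less[OF rank, of l m] left_adjacent[OF assms(3)]
  unfolding left_nb_def by (auto split: series.splits if_splits)

lemma ip_adjacent:
  assumes "1 \<le> l" "2 * Suc (Suc l) \<le> dimN g n + 1"
  shows "ip n (alpha g n l) (alpha g n (Suc l)) = - 1"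
  using assms ip_alpha_less[OF rank, of l "Suc l"] left_adjacent[OF assms(2)] tw_less[of l "Suc l"]
  unfolding left_nb_def left_tw_def by (auto simp: dimN_def split: series.splits if_splits)

lemma fq_far:
  assumes "1 \<le> l" "Suc l < m" "2 * Suc m \<le> dimN g n + 1"
  shows "fq l * fq m = fq m * fq l"
  using ip_far[OF assms] left_adjacent(1)[OF assms(3)] assms by (intro fq_commute) auto

lemma fq_near:
  assumes "1 \<le> l" "2 * Suc (Suc l) \<le> dimN g n + 1"
  shows "U.serre2 (fq l) (fq (Suc l))" "Suc l < n \<Longrightarrow> U.serre2 (fq (Suc l)) (fq l)"
  using ip_adjacent[OF assms] left_adjacent(1)[OF assms(2)] assms
  by (auto intro!: fq_serre simp: ip_commute[of n "alpha g n (Suc l)"])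

lemma chain_lo_rec:
  "1 \<le> a \<Longrightarrow> 2 * (a + Suc (Suc d)) \<le> dimN g n + 1 \<Longrightarrow>
    \<iota> (chain_lo L a (Suc d)) = br (\<iota> (chain_lo L (Suc a) d)) (fq a)"
proof (induction d)
  case 0
  then show ?case by (simp add: \<iota>_br fq_def)
next
  case (Suc d)
  have "\<iota> (chain_lo L a (Suc (Suc d))) = br (fq (a + Suc (Suc d))) (br (\<iota> (chain_lo L (Suc a) d)) (fq a))"
    using Suc by (simp add: \<iota>_br fq_def)
  also have "\<dots> = br (br (fq (a + Suc (Suc d))) (\<iota> (chain_lo L (Suc a) d))) (fq a)"
    by (rule br_assoc, rule fq_far[symmetric]) (use Suc.prems in auto)
  also have "br (fq (a + Suc (Suc d))) (\<iota> (chain_lo L (Suc a) d)) = \<iota> (chain_lo L (Suc a) (Suc d))"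
    by (simp add: \<iota>_br fq_def)
  finally show ?case .
qed

lemma chain_up_rec:
  "1 \<le> a \<Longrightarrow> 2 * (a + Suc (Suc d)) \<le> dimN g n + 1 \<Longrightarrow>
    \<iota> (chain_up L a (Suc d)) = br (fq a) (\<iota> (chain_up L (Suc a) d))"
proof (induction d)
  case 0
  then show ?case by (simp add: \<iota>_br fq_def)
next
  case (Suc d)
  have "\<iota> (chain_up L a (Suc (Suc d))) = br (br (fq a) (\<iota> (chain_up L (Suc a) d))) (fq (a + Suc (Suc d)))"
    using Suc by (simp add: \<iota>_br fq_def)
  also have "\<dots> = br (fq a) (br (\<iota> (chain_up L (Suc a) d)) (fq (a + Suc (Suc d))))"
    by (rule br_assoc[symmetric], rule fq_far) (use Suc.prems in auto)
  also have "br (\<iota> (chain_up L (Suc a) d)) (fq (a + Suc (Suc d))) = \<iota> (chain_up L (Suc a) (Suc d))"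
    by (simp add: \<iota>_br fq_def)
  finally show ?case .
qed

abbreviation "is_lo T w \<equiv> lo_family sc (*) q fq T w"
abbreviation "is_up T w \<equiv> lo_family sc (\<lambda>x y. y * x) q fq T w"

lemma lo_family_fq:
  assumes T: "T \<le> n" and z: "\<And>k. 1 \<le> k \<Longrightarrow> Suc k < T \<Longrightarrow> w T * fq k = fq k * w T"
      "\<And>k. 1 \<le> k \<Longrightarrow> Suc k = T \<Longrightarrow> U.serre2 (fq k) (w T)"
    and rec: "\<And>a. 1 \<le> a \<Longrightarrow> a < T \<Longrightarrow> w a = br (w (Suc a)) (fq a)"
  shows "is_lo T w"
proof (rule U.lo_familyI)
  fix k l assume "1 \<le> k" "l < T" "Suc k < l"
  then show "fq k * fq l = fq l * fq k" using T dimN_bounds by (intro fq_far) auto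
next
  fix k assume "1 \<le> k" "Suc k < T"
  then show "U.serre2 (fq k) (fq (Suc k)) \<and> U.serre2 (fq (Suc k)) (fq k)"
    using fq_near[of k] T dimN_bounds by auto
qed (use z rec in \<open>auto simp: br_def\<close>)

lemma up_family_fq:
  assumes T: "T \<le> n" and z: "\<And>k. 1 \<le> k \<Longrightarrow> Suc k < T \<Longrightarrow> w T * fq k = fq k * w T"
      "\<And>k. 1 \<le> k \<Longrightarrow> Suc k = T \<Longrightarrow> U.serre2 (fq k) (w T)"
    and rec: "\<And>a. 1 \<le> a \<Longrightarrow> a < T \<Longrightarrow> w a = br (fq a) (w (Suc a))"
  shows "is_up T w"
proof (rule q_algebra.lo_familyI[OF U.flip])
  fix k l assume "1 \<le> k" "l < T" "Suc k < l"
  then show "fq l * fq k = fq k * fq l" using T dimN_bounds by (intro fq_far[symmetric]) auto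
next
  fix k assume "1 \<le> k" "Suc k < T"
  then have "U.serre2 (fq k) (fq (Suc k))" "U.serre2 (fq (Suc k)) (fq k)"
    using fq_near[of k] T dimN_bounds by auto
  then show "(fq (Suc k) * fq k) * fq k + (fq k * fq k) * fq (Suc k) =
      sc (q + qb) ((fq k * fq (Suc k)) * fq k) \<and>
    (fq k * fq (Suc k)) * fq (Suc k) + (fq (Suc k) * fq (Suc k)) * fq k =
      sc (q + qb) ((fq (Suc k) * fq k) * fq (Suc k))"
    by (simp add: mult.assoc add.commute)
next
  fix k assume "1 \<le> k" "Suc k = T"
  then show "(w T * fq k) * fq k + (fq k * fq k) * w T = sc (q + qb) ((fq k * w T) * fq k)"
    using z(2)[of k] by (simp add: mult.assoc add.commute)
qed (use z rec in \<open>auto simp: br_def\<close>)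

lemma lo_family_f_lo:
  assumes "1 \<le> T" "2 * Suc T \<le> dimN g n + 1"
  shows "is_lo T (\<lambda>a. \<iota> (f_lo L a (Suc T)))"
proof (rule lo_family_fq)
  show T: "T \<le> n" by (rule left_adjacent(1)[OF assms(2)])
  have top: "\<iota> (f_lo L T (Suc T)) = fq T" by (simp add: f_lo_unit fq_def)
  show "\<iota> (f_lo L T (Suc T)) * fq k = fq k * \<iota> (f_lo L T (Suc T))" if "1 \<le> k" "Suc k < T" for k
    unfolding top using fq_far[of k T] that assms by simp
  show "U.serre2 (fq k) (\<iota> (f_lo L T (Suc T)))" if "1 \<le> k" "Suc k = T" for k
    unfolding top using fq_near(1)[of k] that assms by simp
  show "\<iota> (f_lo L a (Suc T)) = br (\<iota> (f_lo L (Suc a) (Suc T))) (fq a)" if "1 \<le> a" "a < T" for a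
  proof -
    have "Suc T - a - 1 = Suc (Suc T - Suc a - 1)" using that by simp
    then show ?thesis unfolding f_lo_def using chain_lo_rec[of a "Suc T - Suc a - 1"] that assms by simp
  qed
qed

lemma up_family_f_up:
  assumes "1 \<le> T" "2 * Suc T \<le> dimN g n + 1"
  shows "is_up T (\<lambda>a. \<iota> (f_up L a (Suc T)))"
proof (rule up_family_fq)
  show T: "T \<le> n" by (rule left_adjacent(1)[OF assms(2)])
  have top: "\<iota> (f_up L T (Suc T)) = fq T" by (simp add: f_up_def fq_def)
  show "\<iota> (f_up L T (Suc T)) * fq k = fq k * \<iota> (f_up L T (Suc T))" if "1 \<le> k" "Suc k < T" for k
    unfolding top using fq_far[of k T] that assms by simp
  show "U.serre2 (fq k) (\<iota> (f_up L T (Suc T)))" if "1 \<le> k" "Suc k = T" for k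
    unfolding top using fq_near(1)[of k] that assms by simp
  show "\<iota> (f_up L a (Suc T)) = br (fq a) (\<iota> (f_up L (Suc a) (Suc T)))" if "1 \<le> a" "a < T" for a
  proof -
    have "Suc T - a - 1 = Suc (Suc T - Suc a - 1)" using that by simp
    then show ?thesis unfolding f_up_def using chain_up_rec[of a "Suc T - Suc a - 1"] that assms by simp
  qed
qed

text \<open>
  The chains that start from the end node \<open>n\<close> of the fork.  They use the same generators
  \<open>f\<^sub>1, \<dots>, f\<^sub>n\<^sub>-\<^sub>2\<close> as those that start from \<open>n - 1\<close>.
\<close>

lemma fD_families:
  assumes D: "g = SO_even"
  shows "is_lo (n - 1) (\<lambda>a. \<iota> (fD_left n L a))" "is_up (n - 1) (\<lambda>a. \<iota> (fD_right n L a))"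
    "fq (n - 1) * fq n = fq n * fq (n - 1)"
proof -
  have n: "n \<ge> 3" using rank D by (simp add: simple_rank_def)
  have ip: "ip n (alpha g n k) (alpha g n n) = - of_bool (n = k + 2)" if "1 \<le> k" "k < n" for k
    using ip_alpha_less[OF rank that order_refl] by (simp add: D)
  have far: "fq k * fq n = fq n * fq k" if "1 \<le> k" "k < n" "k \<noteq> n - 2" for k
    using ip[of k] that by (intro fq_commute) auto
  have near: "U.serre2 (fq (n - 2)) (fq n)"
    using ip[of "n - 2"] n by (intro fq_serre) auto
  show "fq (n - 1) * fq n = fq n * fq (n - 1)" using far[of "n - 1"] n by simp
  have bounds: "2 * (n - 1) \<le> dimN g n + 1" using dimN_bounds by simp
  have top: "\<iota> (fD_left n L (n - 1)) = fq n" "\<iota> (fD_right n L (n - 1)) = fq n"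
    by (simp_all add: fD_left_def fD_right_def fq_def)
  have top_rel: "fq n * fq k = fq k * fq n" if "1 \<le> k" "Suc k < n - 1" for k
    using far[of k] that by simp
  have top_serre: "U.serre2 (fq k) (fq n)" if "1 \<le> k" "Suc k = n - 1" for k
  proof -
    have "k = n - 2" using that by simp
    then show ?thesis using near by simp
  qed
  have left: "\<iota> (fD_left n L a) = br (fq n) (\<iota> (f_lo L a (n - 1)))" if "a \<noteq> n - 1" for a
    using that by (simp add: fD_left_def \<iota>_br fq_def)
  have right: "\<iota> (fD_right n L a) = br (\<iota> (f_up L a (n - 1))) (fq n)" if "a \<noteq> n - 1" for a
    using that by (simp add: fD_right_def \<iota>_br fq_def)
  show "is_lo (n - 1) (\<lambda>a. \<iota> (fD_left n L a))"
  proof (rule lo_family_fq)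
    show "\<iota> (fD_left n L a) = br (\<iota> (fD_left n L (Suc a))) (fq a)" if a: "1 \<le> a" "a < n - 1" for a
    proof (cases "Suc a = n - 1")
      case True
      then have "f_lo L a (n - 1) = gen a" using f_lo_unit[of a] by simp
      then show ?thesis using left[of a] a True top by (simp add: fq_def)
    next
      case False
      have "\<iota> (f_lo L a (n - 1)) = br (\<iota> (f_lo L (Suc a) (n - 1))) (fq a)"
      proof -
        have "n - 1 - a - 1 = Suc (n - 1 - Suc a - 1)" using a False by simp
        then show ?thesis unfolding f_lo_def
          using chain_lo_rec[of a "n - 1 - Suc a - 1"] a False bounds by simp
      qed
      then have "\<iota> (fD_left n L a) = br (fq n) (br (\<iota> (f_lo L (Suc a) (n - 1))) (fq a))"
        using left[of a] a by simp
      also have "\<dots> = br (br (fq n) (\<iota> (f_lo L (Suc a) (n - 1)))) (fq a)"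
        by (rule br_assoc) (use far[of a] a False in simp)
      finally show ?thesis using left[of "Suc a"] False by simp
    qed
  qed (use n top top_rel top_serre in simp_all)
  show "is_up (n - 1) (\<lambda>a. \<iota> (fD_right n L a))"
  proof (rule up_family_fq)
    show "\<iota> (fD_right n L a) = br (fq a) (\<iota> (fD_right n L (Suc a)))" if a: "1 \<le> a" "a < n - 1" for a
    proof (cases "Suc a = n - 1")
      case True
      then have "f_up L a (n - 1) = gen a" by (simp add: f_up_def)
      then show ?thesis using right[of a] a True top by (simp add: fq_def)
    next
      case False
      have "\<iota> (f_up L a (n - 1)) = br (fq a) (\<iota> (f_up L (Suc a) (n - 1)))"
      proof -
        have "n - 1 - a - 1 = Suc (n - 1 - Suc a - 1)" using a False by simp
        then show ?thesis unfolding f_up_def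
          using chain_up_rec[of a "n - 1 - Suc a - 1"] a False bounds by simp
      qed
      then have "\<iota> (fD_right n L a) = br (br (fq a) (\<iota> (f_up L (Suc a) (n - 1)))) (fq n)"
        using right[of a] a by simp
      also have "\<dots> = br (fq a) (br (\<iota> (f_up L (Suc a) (n - 1))) (fq n))"
        by (rule br_assoc[symmetric]) (use far[of a] a False in simp)
      finally show ?thesis using right[of "Suc a"] False by simp
    qed
  qed (use n top top_rel top_serre in simp_all)
qed

section \<open>Elimination of pairs of levels\<close>

text \<open>
  The counterpart of \<open>UA\<close> in the product ring.
\<close>

inductive_set UAq :: "nat \<Rightarrow> (dual \<Rightarrow> uq_product) set" for j where
  zero: "(\<lambda>lam. 0) \<in> UAq j"
| step: "v \<in> UAq j \<Longrightarrow> c \<in> Aalg g n L j \<Longrightarrow> (\<lambda>lam. v lam + sc (c lam) (\<iota> x)) \<in> UAq j"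

lemma UAq_add:
  assumes "u \<in> UAq j" "v \<in> UAq j"
  shows "(\<lambda>lam. u lam + v lam) \<in> UAq j"
  using assms(2)
proof induction
  case zero
  show ?case using assms(1) by simp
next
  case (step v c x)
  from UAq.step[OF step.IH step.hyps(2), of x] show ?case by (simp add: add.assoc)
qed

lemma UAq_single: "c \<in> Aalg g n L j \<Longrightarrow> (\<lambda>lam. sc (c lam) (\<iota> x)) \<in> UAq j"
  using UAq.step[OF UAq.zero] by simp

lemma UAq_scale: "v \<in> UAq j \<Longrightarrow> c \<in> Aalg g n L j \<Longrightarrow> (\<lambda>lam. sc (c lam) (v lam)) \<in> UAq j"
proof (induction v rule: UAq.induct)
  case zero
  then show ?case using UAq.zero by simp
next
  case (step v d x)
  have "(\<lambda>lam. sc (c lam) (v lam) + sc (c lam * d lam) (\<iota> x)) \<in> UAq j"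
    using step by (intro UAq.step Aalg.mult) auto
  then show ?case by (simp add: U.alg)
qed

lemma UAq_mult: "u \<in> UAq j \<Longrightarrow> v \<in> UAq j \<Longrightarrow> (\<lambda>lam. u lam * v lam) \<in> UAq j"
proof (induction u rule: UAq.induct)
  case zero
  then show ?case using UAq.zero by simp
next
  case (step u c x)
  have "(\<lambda>lam. \<iota> x * v lam) \<in> UAq j" using step.prems
  proof (induction v rule: UAq.induct)
    case zero
    then show ?case using UAq.zero by simp
  next
    case (step v d y)
    from UAq.step[OF step.IH step.hyps(2), of "x * y"] show ?case by (simp add: U.alg \<iota>_hom(3))
  qed
  from UAq_add[OF step.IH[OF step.prems] UAq_scale[OF this step.hyps(2)]] show ?case
    by (simp add: distrib_right U.m_sc)
qed

lemma UAq_const: "(\<lambda>lam. \<iota> x) \<in> UAq j"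
  using UAq_single[OF Aalg.const[of 1]] by simp

lemma UAq_comb:
  "v \<in> UAq j \<Longrightarrow> \<exists>K b c. (\<forall>k<K. b k \<in> carrier (free_ring n) \<and> c k \<in> Aalg g n L j) \<and>
     (\<forall>lam. v lam = \<iota> (comb K b c lam))"
proof (induction v rule: UAq.induct)
  case zero
  show ?case by (intro exI[of _ 0]) (simp add: comb_def \<iota>_hom)
next
  case (step v d x)
  then obtain K b c where "\<forall>k<K. b k \<in> carrier (free_ring n) \<and> c k \<in> Aalg g n L j"
    "\<forall>lam. v lam = \<iota> (comb K b c lam)" by blast
  note K = this
  define b' c' where "b' = b(K := restrict_letters n x)" and "c' = c(K := d)"
  have "\<iota> (comb (Suc K) b' c' lam) = \<iota> (comb K b c lam) + sc (d lam) (\<iota> x)" for lam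
    by (simp add: comb_def \<iota>_hom(1,5) \<iota>_restrict_letters b'_def c'_def)
  moreover have "b' k \<in> carrier (free_ring n) \<and> c' k \<in> Aalg g n L j" if "k < Suc K" for k
    using that K(1) step.hyps(2) by (auto simp: restrict_letters_carrier less_Suc_eq b'_def c'_def)
  ultimately show ?case
    using K(2) by (intro exI[of _ "Suc K"] exI[of _ b'] exI[of _ c']) simp
qed

lemma A_inv_Aalg: "1 \<le> l \<Longrightarrow> prec g n l j \<Longrightarrow> (\<lambda>lam. A' j lam l) \<in> Aalg g n L j"
  using Aalg.mult[OF Aalg_diff[OF Aalg.gen Aalg.const[of 1]] Aalg.const[of "inverse (q - qb)"]]
  by (simp add: A_inv_def divide_inverse)

lemma \<iota>_path_sum_Cons:
  "\<iota> (path_sum F B a (l # ls) b) = sc (B l) (\<iota> (path_sum F B a ls b)) + \<iota> (F a l) * \<iota> (path_sum F B l ls b)"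
  by (simp add: \<iota>_hom(1,5), simp add: \<iota>_hom(3))

lemma \<iota>_path_sum_split:
  "\<iota> (path_sum F B a (xs @ k # ys) b) =
    sc (B k) (\<iota> (path_sum F B a (xs @ ys) b)) + \<iota> (path_sum F B a xs k) * \<iota> (path_sum F B k ys b)"
  unfolding path_sum_split by (simp add: \<iota>_hom(1,5), simp add: \<iota>_hom(3))

lemma path_sum_UAq:
  "(\<And>l. l \<in> set ls \<Longrightarrow> 1 \<le> l \<and> prec g n l j) \<Longrightarrow> (\<lambda>lam. \<iota> (path_sum F (A' j lam) a ls b)) \<in> UAq j"
proof (induction ls arbitrary: a)
  case Nil
  show ?case by (simp add: UAq_const)
next
  case (Cons l ls)
  have "(\<lambda>lam. sc (A' j lam l) (\<iota> (path_sum F (A' j lam) a ls b)) +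
      \<iota> (F a l) * \<iota> (path_sum F (A' j lam) l ls b)) \<in> UAq j"
    using Cons by (intro UAq_add UAq_scale UAq_mult UAq_const A_inv_Aalg) auto
  then show ?case by (simp only: \<iota>_path_sum_Cons)
qed

abbreviation "both_rel M G \<equiv> half_rel sc (*) q fq M G \<and> half_rel sc (\<lambda>x y. y * x) q fq M (\<lambda>a b. G b a)"

text \<open>
  Matrix-valued functions that are, modulo multiples of \<open>\<delta>\<^sub>j\<close>, combinations of constant matrices with both halves of the
  relations and last diagonal entry 0.  Only the entries up to \<open>M\<close> matter, which is the reason for the
  last rule.
\<close>

inductive diag_divisible :: "nat \<Rightarrow> nat \<Rightarrow> (dual \<Rightarrow> nat \<Rightarrow> nat \<Rightarrow> uq_product) \<Rightarrow> bool" for j where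
  rel: "both_rel M G \<Longrightarrow> G M M = 0 \<Longrightarrow> (\<And>a b. G a b \<in> range \<iota>) \<Longrightarrow> c \<in> Aalg g n L j \<Longrightarrow>
    diag_divisible j M (\<lambda>lam a b. sc (c lam) (G a b))"
| multiple: "(\<And>a b. (\<lambda>lam. v lam a b) \<in> UAq j) \<Longrightarrow>
    diag_divisible j M (\<lambda>lam a b. sc (delta g n L j lam) (v lam a b))"
| add: "diag_divisible j M E1 \<Longrightarrow> diag_divisible j M E2 \<Longrightarrow> diag_divisible j M (\<lambda>lam a b. E1 lam a b + E2 lam a b)"
| agree: "diag_divisible j M E \<Longrightarrow> (\<And>lam a b. 1 \<le> a \<Longrightarrow> a \<le> M \<Longrightarrow> 1 \<le> b \<Longrightarrow> b \<le> M \<Longrightarrow> E' lam a b = E lam a b) \<Longrightarrow>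
    diag_divisible j M E'"

lemma diag_divisible_diagonal:
  "diag_divisible j M E \<Longrightarrow> 1 \<le> M \<Longrightarrow> \<exists>v\<in>UAq j. \<forall>lam. E lam M M = sc (delta g n L j lam) (v lam)"
proof (induction rule: diag_divisible.induct)
  case (rel M G c)
  show ?case by (intro bexI[OF _ UAq.zero]) (simp add: rel)
next
  case (multiple v M)
  show ?case by (intro bexI[OF _ multiple(1)[of M M]]) simp
next
  case (add M E1 E2)
  then obtain v1 v2 where v: "v1 \<in> UAq j" "v2 \<in> UAq j"
    "\<forall>lam. E1 lam M M = sc (delta g n L j lam) (v1 lam)"
    "\<forall>lam. E2 lam M M = sc (delta g n L j lam) (v2 lam)" by blast
  show ?case by (intro bexI[OF _ UAq_add[OF v(1,2)]]) (simp add: v U.sc_simps)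
qed simp

lemma range_\<iota>:
  "x \<in> range \<iota> \<Longrightarrow> y \<in> range \<iota> \<Longrightarrow> x + y \<in> range \<iota>" "x \<in> range \<iota> \<Longrightarrow> y \<in> range \<iota> \<Longrightarrow> x * y \<in> range \<iota>"
  "x \<in> range \<iota> \<Longrightarrow> sc c x \<in> range \<iota>" "x \<in> range \<iota> \<Longrightarrow> y \<in> range \<iota> \<Longrightarrow> x - y \<in> range \<iota>"
  unfolding image_iff by (metis UNIV_I \<iota>_hom)+

text \<open>
  If \<open>E\<close> collects the routes with levels strictly between \<open>l = M + 1\<close> and \<open>l'\<close>, this adds the levels \<open>l\<close> and
  \<open>l'\<close> themselves.
\<close>

definition "eliminate j M E lam a b =
  sc (A' j lam (Suc M)) (sc (A' j lam (pr (Suc M))) (E lam a b) + E lam a (Suc M) * \<iota> (F (pr (Suc M)) (pr b))) +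
  \<iota> (F a (Suc M)) * (sc (A' j lam (pr (Suc M))) (E lam (Suc M) b) + E lam (Suc M) (Suc M) * \<iota> (F (pr (Suc M)) (pr b)))"

lemma y_minus_1_divisible:
  assumes k: "1 \<le> k" "k \<le> n" and s: "g = SO_odd \<or> g = SO_even \<and> k < n"
  obtains r where "r \<in> Aalg g n L (pr k)"
    "\<And>lam. A' (pr k) lam k = delta g n L (pr k) lam * r lam"
proof (cases "g = SO_odd")
  case True
  have prec: "prec g n (n + 1) (pr k)" using k by (auto simp: prec_def True prime_ix_def dimN_def)
  let ?r = "\<lambda>lam. (q * yv (pr k) (n + 1) lam - 1) * ((q + 1) / (q - qb))"
  have "?r \<in> Aalg g n L (pr k)"
    by (intro Aalg.mult Aalg_diff Aalg.const Aalg.gen prec) simp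
  moreover have "A' (pr k) lam k = delta g n L (pr k) lam * ?r lam" for lam
  proof -
    have "A' (pr k) lam k = ((q * yv (pr k) (n + 1) lam) ^ 2 - 1) / (q - qb)"
      unfolding A_inv_def y_mid[OF k True] ..
    also have "\<dots> = delta g n L (pr k) lam * ?r lam"
      unfolding delta_odd[OF True k] using q_add_1 by (simp add: power2_eq_square square_diff_one_factored)
    finally show ?thesis .
  qed
  ultimately show thesis by (rule that)
next
  case False
  then have D: "g = SO_even" "k < n" using s by auto
  then have "A' (pr k) lam k = delta g n L (pr k) lam * 1" for lam
    using delta_even[of k lam] k by simp
  then show thesis using that[OF Aalg.const[of 1]] by blast
qed

text \<open>
  \<open>A_inv_pair\<close> replaces \<open>B\<^sub>l B\<^sub>l\<^sub>'\<close> by a linear expression in \<open>B\<^sub>l\<close>, \<open>B\<^sub>l\<^sub>'\<close> and \<open>B\<^sub>k\<close>.  The coefficients of \<open>B\<^sub>l\<^sub>'\<close> and \<open>B\<^sub>l\<close>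
  are then the matrices of \<open>half_rel_left\<close> and \<open>half_rel_right\<close>, and \<open>B\<^sub>k\<close> is a multiple of \<open>\<delta>\<^sub>j\<close>.
\<close>

lemma diag_divisible_eliminate:
  assumes k: "1 \<le> k" "k \<le> M" "Suc M \<le> n" and s: "g = SO_odd \<or> g = SO_even"
    and "diag_divisible (pr k) (Suc M) E"
  shows "diag_divisible (pr k) M (eliminate (pr k) M E)"
  using assms(5)
proof (induction "Suc M" E rule: diag_divisible.induct)
  case (rel G c)
  let ?j = "pr k" and ?l = "Suc M"
  let ?lo = "\<lambda>a. \<iota> (F a ?l)" and ?up = "\<lambda>b. \<iota> (F (pr ?l) (pr b))"
  have Md: "2 * Suc M \<le> dimN g n + 1" "1 \<le> M" using k dimN_bounds by simp_all
  have lo: "is_lo M ?lo"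
  proof -
    have "is_lo M (\<lambda>a. \<iota> (f_lo L a ?l))" by (rule lo_family_f_lo) (use Md in auto)
    then show ?thesis unfolding lo_family_def using f_el_lower[OF _ _ Md(1)] by simp
  qed
  have up: "is_up M ?up"
  proof -
    have "is_up M (\<lambda>a. \<iota> (f_up L a ?l))" by (rule up_family_f_up) (use Md in auto)
    then show ?thesis unfolding lo_family_def using f_el_upper[OF _ _ Md(1)] by simp
  qed
  have top: "?lo M = fq M" "?up M = fq M"
    using f_el_lower[OF Md(2) _ Md(1)] f_el_upper[OF Md(2) _ Md(1)] f_lo_unit[of M]
    by (simp_all add: fq_def f_up_def)
  interpret fl: q_algebra sc "\<lambda>x y. y * x" q by (rule U.flip)
  note G = rel(1)[THEN conjunct1] rel(1)[THEN conjunct2]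
  define \<kappa> where "\<kappa> = - inverse (q - qb)"
  define G1 where "G1 a b = sc \<kappa> (G a b) + ?lo a * G ?l b" for a b
  define G2 where "G2 a b = sc \<kappa> (G a b) + G a ?l * ?up b" for a b
  have r1: "both_rel M G1"
    unfolding G1_def using U.half_rel_left[OF G lo, of \<kappa>] fl.half_rel_right[OF G(2) lo, of \<kappa>] by blast
  have r2: "both_rel M G2"
    unfolding G2_def using U.half_rel_right[OF G(1) up, of \<kappa>] fl.half_rel_left[OF G(2) _ up, of \<kappa>] G(1)
    by blast
  have z: "G1 M M = 0" "G2 M M = 0"
    using U.diagonal_vanishes[OF G Md(2) rel(2)] by (simp_all add: G1_def G2_def \<kappa>_def top)
  have ran: "G1 a b \<in> range \<iota>" "G2 a b \<in> range \<iota>" for a b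
    unfolding G1_def G2_def by (intro range_\<iota> rel(3) rangeI)+
  have kn: "g = SO_odd \<or> g = SO_even \<and> k < n" using s k by auto
  obtain r where r: "r \<in> Aalg g n L ?j" "\<And>lam. A' ?j lam k = delta g n L ?j lam * r lam"
    using y_minus_1_divisible[OF k(1) _ kn] k by auto
  have prec: "prec g n ?l ?j" "prec g n (pr ?l) ?j" "1 \<le> pr ?l"
    using k dimN_bounds by (auto simp: prec_def pr_eq)
  note A = A_inv_Aalg[OF _ prec(1)] A_inv_Aalg[OF prec(3,2)]
  have g1: "diag_divisible ?j M (\<lambda>lam a b. sc (c lam * A' ?j lam (pr ?l)) (G1 a b))"
    using r1 z ran by (intro diag_divisible.rel Aalg.mult rel(4) A) auto
  have g2: "diag_divisible ?j M (\<lambda>lam a b. sc (c lam * A' ?j lam ?l) (G2 a b))"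
    using r2 z ran by (intro diag_divisible.rel Aalg.mult rel(4) A) auto
  have g3: "diag_divisible ?j M (\<lambda>lam a b. sc (delta g n L ?j lam) (sc (c lam * r lam * inverse (q - qb)) (G a b)))"
  proof (rule diag_divisible.multiple)
    fix a b
    obtain x where "G a b = \<iota> x" using rel(3) by blast
    then show "(\<lambda>lam. sc (c lam * r lam * inverse (q - qb)) (G a b)) \<in> UAq ?j"
      using UAq_single[OF Aalg.mult[OF Aalg.mult[OF rel(4) r(1)] Aalg.const]] by simp
  qed
  show ?case
  proof (rule diag_divisible.agree[OF diag_divisible.add[OF diag_divisible.add[OF g1 g2] g3]])
    fix lam a b
    let ?B = "A' ?j lam ?l" and ?B' = "A' ?j lam (pr ?l)"
    have BB: "?B * ?B' = \<kappa> * ?B + \<kappa> * ?B' + delta g n L ?j lam * r lam * inverse (q - qb)"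
      using A_inv_pair(2)[of k ?l lam] k by (simp add: r(2) \<kappa>_def)
    have "eliminate ?j M (\<lambda>lam a b. sc (c lam) (G a b)) lam a b =
        sc (c lam * (?B * ?B')) (G a b) + sc (c lam * ?B) (G a ?l * ?up b) + sc (c lam * ?B') (?lo a * G ?l b)"
      unfolding eliminate_def by (simp add: rel(2) U.alg mult_ac)
    also have "\<dots> = sc (c lam * ?B') (G1 a b) + sc (c lam * ?B) (G2 a b) +
        sc (delta g n L ?j lam) (sc (c lam * r lam * inverse (q - qb)) (G a b))"
      unfolding BB G1_def G2_def
      by (simp add: U.sc_simps distrib_left U.scale_left_distrib mult_ac add_ac)
    finally show "eliminate ?j M (\<lambda>lam a b. sc (c lam) (G a b)) lam a b =
        sc (c lam * ?B') (G1 a b) + sc (c lam * ?B) (G2 a b) +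
        sc (delta g n L ?j lam) (sc (c lam * r lam * inverse (q - qb)) (G a b))" .
  qed
next
  case (multiple v)
  let ?j = "pr k" and ?l = "Suc M"
  have prec: "prec g n ?l ?j" "prec g n (pr ?l) ?j" "1 \<le> pr ?l"
    using k dimN_bounds by (auto simp: prec_def pr_eq)
  note A = A_inv_Aalg[OF _ prec(1)] A_inv_Aalg[OF prec(3,2)]
  have "diag_divisible ?j M (\<lambda>lam a b. sc (delta g n L ?j lam) (eliminate ?j M v lam a b))"
    unfolding eliminate_def
    by (intro diag_divisible.multiple UAq_add UAq_scale UAq_mult UAq_const multiple A) auto
  then show ?case
    by (rule diag_divisible.agree) (simp add: eliminate_def U.alg mult_ac)
next
  case (add E1 E2)
  show ?case
    by (rule diag_divisible.agree[OF diag_divisible.add[OF add(2,4)]])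
      (simp add: eliminate_def U.alg distrib_left distrib_right add_ac)
next
  case (agree E E')
  show ?case
    by (rule diag_divisible.agree[OF agree(2)]) (simp add: eliminate_def agree(3))
qed

text \<open>
  All routes from \<open>a\<close> to \<open>b'\<close> whose levels lie strictly between \<open>M\<close> and \<open>M'\<close>.
\<close>

definition "middle_sum k M lam a b = \<iota> (path_sum F (A' (pr k) lam) a [Suc M..<pr M] (pr b))"

lemma middle_sum_eliminate:
  assumes "Suc M \<le> n"
  shows "middle_sum k M lam a b = eliminate (pr k) M (middle_sum k (Suc M)) lam a b"
proof -
  have "pr M = Suc (pr (Suc M))" "Suc (Suc M) \<le> pr (Suc M)"
    using assms dimN_bounds by (simp_all add: pr_eq)
  then have "[Suc M..<pr M] = Suc M # [Suc (Suc M)..<pr (Suc M)] @ [pr (Suc M)]"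
    by (simp add: upt_conv_Cons)
  then show ?thesis
    unfolding middle_sum_def eliminate_def
    by (simp only: \<iota>_path_sum_Cons \<iota>_path_sum_split append_Nil2 path_sum.simps(1))
qed

lemma diag_divisible_descend:
  assumes "1 \<le> k" "k \<le> T" "T \<le> n" and s: "g = SO_odd \<or> g = SO_even" and "diag_divisible (pr k) T (middle_sum k T)"
  shows "diag_divisible (pr k) k (middle_sum k k)"
proof -
  have "diag_divisible (pr k) M (middle_sum k M)" if "k \<le> M" "M \<le> T" for M
    using that(2,1)
  proof (induction M rule: inc_induct)
    case base
    show ?case by (rule assms(5))
  next
    case (step M)
    have "diag_divisible (pr k) M (eliminate (pr k) M (middle_sum k (Suc M)))"
      using step assms by (intro diag_divisible_eliminate) auto
    then show ?case
      by (rule diag_divisible.agree) (use step assms in \<open>simp add: middle_sum_eliminate\<close>)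
  qed
  then show ?thesis using assms(2) by simp
qed

section \<open>Existence of the quotient, and the theorem\<close>

lemma rel_linear: "both_rel M G \<Longrightarrow> both_rel M H \<Longrightarrow> both_rel M (\<lambda>a b. sc \<alpha> (G a b) + sc \<beta> (H a b))"
  using U.half_rel_linear q_algebra.half_rel_linear[OF U.flip] by blast

lemma rel_products:
  assumes "is_lo M w" "is_up M w'"
  shows "both_rel M (\<lambda>a b. w a * w' b)" "both_rel M (\<lambda>a b. sc (if a = b then q else 1) (w' b * w a))"
proof -
  interpret fl: q_algebra sc "\<lambda>x y. y * x" q by (rule U.flip)
  show "both_rel M (\<lambda>a b. w a * w' b)"
    using U.half_rel_product[OF assms] fl.half_rel_product[OF assms(2,1)] by blast
  have "(\<lambda>a b. sc (if b = a then q else 1) (w' a * w b)) = (\<lambda>a b. sc (if a = b then q else 1) (w' a * w b))"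
    by (auto simp: fun_eq_iff)
  then show "both_rel M (\<lambda>a b. sc (if a = b then q else 1) (w' b * w a))"
    using U.half_rel_reverse_product[OF assms] fl.half_rel_reverse_product[OF assms(2,1)] by simp
qed

lemma \<iota>_scal_qcomm: "\<iota> (scal c * qcomm d x y) = sc c (\<iota> x * \<iota> y) - sc (c * d) (\<iota> y * \<iota> x)"
  by (simp add: \<iota>_hom(5) \<iota>_qcomm U.sc_simps)

text \<open>
  Put \<open>W\<^sub>a\<^sub>b = f\<^sub>a\<^sub>* f\<^sub>*\<^sub>b\<^sub>'\<close> and \<open>S\<^sub>a\<^sub>b = q\<^bsup>\<delta>\<^sub>a\<^sub>b\<^esup> f\<^sub>*\<^sub>b\<^sub>' f\<^sub>a\<^sub>*\<close>.  Then \<open>f\<^sub>a\<^sub>b\<^sub>' = S\<^sub>a\<^sub>b - W\<^sub>a\<^sub>b\<close>, and eliminating the level \<open>*\<close> gives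
  \<open>B\<^sub>* (S - W) + W = B\<^sub>* (S - q W) + \<delta>\<^sub>j W\<close>.  The last diagonal entry of \<open>S - q W\<close> is 0 because
  \<open>f\<^sub>n\<^sub>* = f\<^sub>*\<^sub>n\<^sub>' = f\<^sub>n\<close>.
\<close>

lemma diag_divisible_odd:
  assumes o: "g = SO_odd" and k: "1 \<le> k" "k \<le> n"
  shows "diag_divisible (pr k) n (middle_sum k n)"
proof -
  let ?j = "pr k"
  define w where "w a = \<iota> (f_lo L a (Suc n))" for a
  define w' where "w' b = \<iota> (f_up L b (Suc n))" for b
  define W where "W a b = w a * w' b" for a b
  define S where "S a b = sc (if a = b then q else 1) (w' b * w a)" for a b
  have N: "dimN g n = 2 * n + 1" by (rule odd_top(1)[OF o])
  have fam: "is_lo n w" "is_up n w'"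
    unfolding w_def[abs_def] w'_def[abs_def]
    by (rule lo_family_f_lo up_family_f_up; use k N in simp)+
  define G where "G a b = sc 1 (S a b) + sc (- q) (W a b)" for a b
  have "both_rel n G"
    unfolding G_def[abs_def] S_def W_def by (intro rel_linear rel_products fam)
  moreover have "G n n = 0"
  proof -
    have "w n = w' n" by (simp add: w_def w'_def f_lo_def f_up_def)
    then show ?thesis by (simp add: G_def S_def W_def)
  qed
  moreover have "G a b \<in> range \<iota>" for a b
    unfolding G_def S_def W_def w_def w'_def by (intro range_\<iota> rangeI)
  moreover have "prec g n (n + 1) ?j" using k by (auto simp: prec_def o prime_ix_def dimN_def)
  then have A: "(\<lambda>lam. A' ?j lam (n + 1)) \<in> Aalg g n L ?j" by (intro A_inv_Aalg) auto
  ultimately have g1: "diag_divisible ?j n (\<lambda>lam a b. sc (A' ?j lam (n + 1)) (G a b))"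
    by (intro diag_divisible.rel) auto
  have g2: "diag_divisible ?j n (\<lambda>lam a b. sc (delta g n L ?j lam) (W a b))"
  proof (rule diag_divisible.multiple)
    fix a b
    have "W a b = \<iota> (f_lo L a (Suc n) * f_up L b (Suc n))" by (simp add: W_def w_def w'_def \<iota>_hom(3))
    then show "(\<lambda>lam. W a b) \<in> UAq ?j" by (simp add: UAq_const)
  qed
  show ?thesis
  proof (rule diag_divisible.agree[OF diag_divisible.add[OF g1 g2]])
    fix lam a b assume ab: "1 \<le> a" "a \<le> n" "1 \<le> b" "b \<le> n"
    have prn: "pr n = Suc (Suc n)" "pr (Suc n) = Suc n" using N by (simp_all add: pr_eq)
    have F: "F a (Suc n) = f_lo L a (Suc n)" "F (Suc n) (pr b) = f_up L b (Suc n)"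
      using f_el_lower[of a "Suc n"] f_el_upper[of b "Suc n"] ab N prn by simp_all
    have "\<iota> (F a (pr b)) = S a b - W a b"
      unfolding f_el_cross_cases(1)[OF ab o] fB_def Let_def \<iota>_scal_qcomm S_def W_def w_def w'_def
      by simp
    then have "middle_sum k n lam a b = sc (A' ?j lam (Suc n)) (S a b - W a b) + W a b"
      unfolding middle_sum_def prn by (simp add: \<iota>_path_sum_Cons F W_def w_def w'_def del: path_sum.simps(2))
    also have "\<dots> = sc (A' ?j lam (n + 1)) (G a b) + sc (A' ?j lam (n + 1) * (q - 1) + 1) (W a b)"
      by (simp add: G_def U.sc_simps U.scale_left_distrib U.scale_left_diff_distrib algebra_simps)
    also have "A' ?j lam (n + 1) * (q - 1) + 1 = delta g n L ?j lam"
      by (rule A_inv_mid[OF o k])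
    finally show "middle_sum k n lam a b = sc (A' ?j lam (n + 1)) (G a b) + sc (delta g n L ?j lam) (W a b)" .
  qed
qed

text \<open>
  Eliminating \<open>n\<close> and \<open>n'\<close> is like the general step, except that the two chains into and out of the middle
  are different: one starts from \<open>f\<^sub>n\<^sub>-\<^sub>1\<close>, the other from \<open>f\<^sub>n\<close>.  These two commute, which
  makes the last diagonal entries vanish.
\<close>

lemma diag_divisible_even:
  assumes D: "g = SO_even" and k: "1 \<le> k" "k \<le> n - 1"
  shows "diag_divisible (pr k) (n - 1) (middle_sum k (n - 1))"
proof -
  let ?j = "pr k" and ?M = "n - 1"
  have n: "n \<ge> 3" using rank D by (simp add: simple_rank_def)
  have N: "dimN g n = 2 * n" unfolding D dimN_def by simp
  have prn: "pr n = Suc n" "pr ?M = Suc (Suc n)" "Suc n < ?j" using n k unfolding pr_eq N by simp_all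
  define w where "w a = \<iota> (f_lo L a n)" for a
  define w' where "w' b = \<iota> (fD_right n L b)" for b
  define v where "v a = \<iota> (fD_left n L a)" for a
  define v' where "v' b = \<iota> (f_up L b n)" for b
  have "is_lo ?M (\<lambda>a. \<iota> (f_lo L a (Suc ?M)))" "is_up ?M (\<lambda>a. \<iota> (f_up L a (Suc ?M)))"
    by (rule lo_family_f_lo up_family_f_up; use n N in simp)+
  then have fam: "is_lo ?M w" "is_up ?M v'" "is_up ?M w'" "is_lo ?M v"
    using n fD_families[OF D] by (simp_all add: w_def[abs_def] v'_def[abs_def] w'_def[abs_def] v_def[abs_def])
  define \<kappa> where "\<kappa> = - inverse (q - qb)"
  define H where "H a b = sc 1 (sc (if a = b then q else 1) (w' b * w a)) + sc (- qb) (w a * w' b)" for a b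
  define G1 where "G1 a b = sc \<kappa> (H a b) + sc 1 (w a * w' b)" for a b
  define G2 where "G2 a b = sc \<kappa> (H a b) + sc 1 (v a * v' b)" for a b
  have r: "both_rel ?M G1" "both_rel ?M G2"
    unfolding G1_def[abs_def] G2_def[abs_def] H_def by (intro rel_linear rel_products fam)+
  have z: "G1 ?M ?M = 0" "G2 ?M ?M = 0"
  proof -
    have top: "w ?M = fq ?M" "v' ?M = fq ?M" "w' ?M = fq n" "v ?M = fq n"
      using f_lo_unit[of ?M] n
      by (simp_all add: w_def v'_def w'_def v_def fD_left_def fD_right_def f_up_def fq_def)
    have c: "fq n * fq ?M = fq ?M * fq n" using fD_families(3)[OF D] by simp
    have "H ?M ?M = sc (q - qb) (fq ?M * fq n)"
      unfolding H_def top c by (simp add: U.scale_left_diff_distrib)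
    then show "G1 ?M ?M = 0" "G2 ?M ?M = 0"
      unfolding G1_def G2_def top c \<kappa>_def using q_sub_qb by (simp_all add: U.sc_simps)
  qed
  have ran: "G1 a b \<in> range \<iota>" "G2 a b \<in> range \<iota>" "H a b \<in> range \<iota>" for a b
    unfolding G1_def G2_def H_def w_def w'_def v_def v'_def by (intro range_\<iota> rangeI)+
  have prec: "prec g n n ?j" "prec g n (Suc n) ?j" using prn n by (auto simp: prec_def)
  have g1: "diag_divisible ?j ?M (\<lambda>lam a b. sc (A' ?j lam (Suc n)) (G1 a b))"
    using r z ran prec by (intro diag_divisible.rel A_inv_Aalg) auto
  have g2: "diag_divisible ?j ?M (\<lambda>lam a b. sc (A' ?j lam n) (G2 a b))"
    using r z ran prec n by (intro diag_divisible.rel A_inv_Aalg) auto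
  have g3: "diag_divisible ?j ?M (\<lambda>lam a b. sc (delta g n L ?j lam) (sc (inverse (q - qb)) (H a b)))"
  proof (rule diag_divisible.multiple)
    fix a b
    obtain x where "H a b = \<iota> x" using ran(3) by blast
    then show "(\<lambda>lam. sc (inverse (q - qb)) (H a b)) \<in> UAq ?j" using UAq_single[OF Aalg.const] by simp
  qed
  show ?thesis
  proof (rule diag_divisible.agree[OF diag_divisible.add[OF diag_divisible.add[OF g1 g2] g3]])
    fix lam a b assume ab: "1 \<le> a" "a \<le> ?M" "1 \<le> b" "b \<le> ?M"
    then have ab': "1 \<le> a" "a \<le> n" "1 \<le> b" "b \<le> n" "1 \<le> n" "n \<le> n" "a \<noteq> n" "b \<noteq> n" using n by auto
    let ?B = "A' ?j lam n" and ?B' = "A' ?j lam (Suc n)"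
    have F: "F a n = f_lo L a n" "F (Suc n) (pr b) = f_up L b n" "F n (pr b) = fD_right n L b"
      "F a (Suc n) = fD_left n L a" "F n (Suc n) = 0"
    proof -
      show "F a n = f_lo L a n" "F (Suc n) (pr b) = f_up L b n"
        using f_el_lower[of a n] f_el_upper[of b n] ab n N prn by simp_all
      show "F n (pr b) = fD_right n L b"
        using f_el_cross_cases(3)[OF ab'(5,6,3,4) D] ab'(8) by (simp add: fD_def)
      show "F a (Suc n) = fD_left n L a"
        using f_el_cross_cases(3)[OF ab'(1,2,5,6) D] ab'(7) by (simp add: fD_def prn)
      show "F n (Suc n) = 0" using f_el_incomparable[OF D] n by simp
    qed
    have "\<iota> (F a (pr b)) = H a b"
    proof -
      have "fD n L a b = scal (q ^ of_bool (a = b)) * qcomm (qb ^ (1 + of_bool (a = b))) (fD_right n L b) (f_lo L a n)"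
        using ab'(7,8) by (simp add: fD_def Let_def)
      then show ?thesis
        unfolding f_el_cross_cases(3)[OF ab'(1-4) D] H_def w_def w'_def by (simp add: \<iota>_scal_qcomm)
    qed
    moreover have "[Suc ?M..<pr ?M] = [n, Suc n]" using n prn by (simp add: upt_conv_Cons)
    ultimately have "middle_sum k ?M lam a b =
        sc ?B (sc ?B' (H a b) + v a * v' b) + w a * sc ?B' (w' b)"
      unfolding middle_sum_def
      by (simp add: \<iota>_path_sum_Cons F w_def w'_def v_def v'_def \<iota>_hom(4) del: path_sum.simps(2))
    also have "\<dots> = sc (?B * ?B') (H a b) + sc ?B (v a * v' b) + sc ?B' (w a * w' b)"
      by (simp add: U.alg)
    also have "?B * ?B' = \<kappa> * ?B + \<kappa> * ?B' + delta g n L ?j lam * inverse (q - qb)"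
    proof -
      have "n \<noteq> k" "k \<le> n" using k n by auto
      then show ?thesis
        using A_inv_pair(2)[of k n lam] k n prn delta_even[OF D k] by (simp add: \<kappa>_def)
    qed
    also have "sc (\<kappa> * ?B + \<kappa> * ?B' + delta g n L ?j lam * inverse (q - qb)) (H a b) +
        sc ?B (v a * v' b) + sc ?B' (w a * w' b) =
        sc ?B' (G1 a b) + sc ?B (G2 a b) + sc (delta g n L ?j lam) (sc (inverse (q - qb)) (H a b))"
      unfolding G1_def G2_def by (simp add: U.sc_simps U.scale_left_distrib mult_ac add_ac)
    finally show "middle_sum k ?M lam a b =
        sc ?B' (G1 a b) + sc ?B (G2 a b) + sc (delta g n L ?j lam) (sc (inverse (q - qb)) (H a b))" .
  qed
qed

abbreviation "check_rep i j lam \<equiv> reg_rep {l. preceq g n i l \<and> prec g n l j} g n L i j lam"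

text \<open>
  Routes that skip \<open>k = j'\<close> carry a factor \<open>B\<^sub>k\<close>, and those that visit it factor through the sum from \<open>k\<close> to \<open>k'\<close>.
\<close>

theorem delta_divides_f_check:
  assumes i: "1 \<le> i" and j: "j \<le> dimN g n" and ij: "prec g n i j" "i \<le> pr j"
  obtains v where "v \<in> UAq j" "\<And>lam. \<iota> (check_rep i j lam) = sc (delta g n L j lam) (v lam)"
proof (cases "g = SP \<or> j < s_prime g n")
  case True
  then have "delta g n L j lam = 1" for lam by (auto simp: delta_def split: series.splits)
  moreover have "(\<lambda>lam. \<iota> (check_rep i j lam)) \<in> UAq j"
    unfolding reg_rep_eq_path_sum[OF rank ij(1)] by (rule path_sum_UAq) (use i in auto)
  ultimately show thesis by (intro that) auto
next
  case False
  define k where "k = pr j"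
  have s: "g = SO_odd \<or> g = SO_even" using False by (cases g) auto
  have k: "1 \<le> k" "k \<le> n" "j = pr k" "i \<le> k" "g = SO_even \<longrightarrow> k \<le> n - 1" "j \<noteq> n + 1"
    using False j ij(2) rank s
    by (auto simp: k_def prime_ix_def s_prime_def dimN_def simple_rank_def)
  have lt: "k < j" using k(1-3) dimN_bounds by (simp add: pr_eq)
  have "diag_divisible (pr k) k (middle_sum k k)"
  proof (cases "g = SO_odd")
    case True
    then show ?thesis using diag_divisible_odd k by (intro diag_divisible_descend[of k n]) auto
  next
    case False
    then have D: "g = SO_even" using s by simp
    then show ?thesis using diag_divisible_even[OF D k(1)] k by (intro diag_divisible_descend[of k "n - 1"]) auto
  qed
  from diag_divisible_diagonal[OF this k(1)] obtain v where v: "v \<in> UAq j"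
    "\<And>lam. \<iota> (path_sum F (A' j lam) k [Suc k..<j] j) = sc (delta g n L j lam) (v lam)"
    unfolding middle_sum_def k(3)[symmetric] by blast
  have R: "check_rep i j lam = path_sum F (A' j lam) i [Suc i..<j] j" for lam
    unfolding reg_rep_eq_path_sum[OF rank ij(1)] level_list[OF rank ij(1) i ij(2)] using k(6) by simp
  show thesis
  proof (cases "i = k")
    case True
    then show ?thesis using v that unfolding R by blast
  next
    case False
    then have ik: "i < k" using k(4) by simp
    have ls: "[Suc i..<j] = [Suc i..<k] @ k # [Suc k..<j]"
      using upt_add_eq_append[of "Suc i" k "j - k"] ik lt by (simp add: upt_conv_Cons)
    have kn: "g = SO_odd \<or> g = SO_even \<and> k < n" using s k(1,5) by auto
    obtain r where r: "r \<in> Aalg g n L j" "\<And>lam. A' j lam k = delta g n L j lam * r lam"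
      using y_minus_1_divisible[OF k(1,2) kn, folded k(3)] by blast
    have prec: "prec g n l j" if "l < j" for l
      using that k(6) by (auto simp: prec_def)
    let ?v = "\<lambda>lam. sc (r lam) (\<iota> (path_sum F (A' j lam) i ([Suc i..<k] @ [Suc k..<j]) j)) +
      \<iota> (path_sum F (A' j lam) i [Suc i..<k] k) * v lam"
    have "?v \<in> UAq j"
      using lt by (intro UAq_add UAq_mult UAq_scale path_sum_UAq v r(1)) (auto intro!: prec)
    moreover have "\<iota> (check_rep i j lam) = sc (delta g n L j lam) (?v lam)" for lam
      unfolding R ls \<iota>_path_sum_split r(2) v(2) by (simp add: U.alg)
    ultimately show ?thesis by (rule that)
  qed
qed

lemma f_el_carrier:
  assumes "1 \<le> a" "b \<le> dimN g n"
  shows "F a b \<in> carrier (free_ring n)"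
proof -
  note closed = carrier_closed scal_carrier gen_carrier
  have qc: "qcomm c x y \<in> carrier (free_ring n)"
    if "x \<in> carrier (free_ring n)" "y \<in> carrier (free_ring n)" for c x y
    using that by (simp add: qcomm_def closed)
  have lo: "chain_lo L i d \<in> carrier (free_ring n)" "chain_up L i d \<in> carrier (free_ring n)"
    if "1 \<le> i" "i + d \<le> n" for i d
    using that by (induction d) (simp_all add: qc closed)
  have f: "f_lo L i m \<in> carrier (free_ring n)" "f_up L i m \<in> carrier (free_ring n)"
    if "1 \<le> i" "i \<le> n" "m \<le> Suc n" for i m
    using that unfolding f_lo_def f_up_def by (auto intro!: lo)
  have rank1: "n \<ge> 1" using rank by (auto simp: simple_rank_def split: series.splits)
  have cross: "fB n L i m \<in> carrier (free_ring n)" "fC n L i m \<in> carrier (free_ring n)"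
    "fD n L i m \<in> carrier (free_ring n)" if "1 \<le> i" "i \<le> n" "1 \<le> m" "m \<le> n" for i m
    using that rank1
    by (auto simp: fB_def fC_def fD_def Let_def fC_left_def fC_right_def fD_left_def fD_right_def
        intro!: qc closed f)
  consider "a = b" | "a > b" | "a < b" "2 * b \<le> dimN g n + 1"
    | "a < b" "2 * b > dimN g n + 1" "2 * a \<ge> dimN g n + 1" | "a < b" "2 * b > dimN g n + 1" "2 * a < dimN g n + 1"
    by linarith
  then show ?thesis
  proof cases
    case 3
    then show ?thesis using assms f(1)[of a b] left_adjacent(1)[of "b - 1"] by (simp add: f_el_def)
  next
    case 4
    then have "1 \<le> pr b" "pr b \<le> n" "pr a \<le> Suc n" using assms dimN_bounds by (simp_all add: pr_eq)
    then show ?thesis using 4 f(2)[of "pr b" "pr a"] by (simp add: f_el_def)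
  next
    case 5
    then have "1 \<le> pr b" "pr b \<le> n" "a \<le> n" using assms dimN_bounds by (simp_all add: pr_eq)
    moreover have "(case g of SO_odd \<Rightarrow> fB | SP \<Rightarrow> fC | SO_even \<Rightarrow> fD) n L a m \<in> carrier (free_ring n)"
      if "1 \<le> m" "m \<le> n" for m
      using cross[of a m] assms(1) \<open>a \<le> n\<close> that by (cases g) simp_all
    ultimately show ?thesis using 5 by (simp add: f_el_def)
  qed (simp_all add: f_el_def closed)
qed

lemma check_rep_carrier:
  assumes "1 \<le> i" "j \<le> dimN g n" "prec g n i j"
  shows "check_rep i j lam \<in> carrier (free_ring n)"
proof -
  have "path_sum F B a ls j \<in> carrier (free_ring n)"
    if "1 \<le> a" "\<forall>l\<in>set ls. 1 \<le> l \<and> l \<le> dimN g n" for B a ls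
    using that
  proof (induction ls arbitrary: a)
    case Nil
    then show ?case using f_el_carrier assms(2) by simp
  next
    case (Cons l ls)
    then show ?case by (simp add: carrier_closed scal_carrier f_el_carrier)
  qed
  then show ?thesis
    unfolding reg_rep_eq_path_sum[OF rank assms(3)] using assms by auto
qed

theorem f_check_quot_nonzero:
  assumes i: "1 \<le> i" and j: "j \<le> dimN g n" and ij: "prec g n i j" "i \<le> pr j"
  shows "f_check_quot g n L i j lam \<noteq> \<zero>\<^bsub>Uq g n L\<^esub>"
proof -
  have j1: "1 \<le> j" using ij(1) by (simp add: prec_def)
  let ?d = "delta g n L j"
  note car = check_rep_carrier[OF i j ij(1)]
  obtain w where w: "w \<in> UAq j" "\<And>lam. \<iota> (check_rep i j lam) = sc (?d lam) (w lam)"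
    using delta_divides_f_check[OF assms] by blast
  obtain K b c where K: "\<forall>k<K. b k \<in> carrier (free_ring n) \<and> c k \<in> Aalg g n L j"
    and "\<forall>lam. w lam = \<iota> (comb K b c lam)" using UAq_comb[OF w(1)] by blast
  then have v: "\<iota> (check_rep i j lam) = sc (?d lam) (\<iota> (comb K b c lam))" for lam
    using w(2) by simp
  have comb_car: "comb K b c lam \<in> carrier (free_ring n)" for lam using K by (intro comb_carrier) auto
  define u where "u lam = cls g n L (comb K b c lam)" for lam
  have u: "u \<in> UA g n L j" unfolding UA_iff using K by (auto simp: u_def[abs_def])
  have f_check: "f_check g n L i j lam = cls g n L (check_rep i j lam)" for lam
    by (simp add: f_check_def)
  have "\<iota> (scal (?d lam) * comb K b c lam) = \<iota> (check_rep i j lam)" for lam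
    by (simp add: v \<iota>_hom(5))
  then have eq: "uscale g n L (?d lam) (u lam) = f_check g n L i j lam" for lam
    unfolding f_check u_def uscale_cls[OF comb_car]
    by (subst cls_eq_iff) (simp_all add: \<iota>_eq_iff comb_car car carrier_closed scal_carrier)
  have unique: "u' = u" if u': "u' \<in> UA g n L j" "\<And>lam. uscale g n L (?d lam) (u' lam) = f_check g n L i j lam" for u'
  proof
    fix lam
    obtain K' b' c' where K': "\<forall>k<K'. b' k \<in> carrier (free_ring n) \<and> c' k \<in> Aalg g n L j"
      and u'_def: "u' = (\<lambda>lam. cls g n L (comb K' b' c' lam))" using u'(1) unfolding UA_iff by blast
    have car': "comb K' b' c' lam \<in> carrier (free_ring n)" using K' by (intro comb_carrier) auto
    have "comb K' b' c' lam - comb K b c lam \<in> I"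
    proof (rule ccontr)
      assume "comb K' b' c' lam - comb K b c lam \<notin> I"
      then obtain \<phi> where \<phi>: "is_linear \<phi>" "\<And>x. x \<in> I \<Longrightarrow> \<phi> x = 0"
        "\<phi> (comb K' b' c' lam - comb K b c lam) \<noteq> 0"
        using separating_functional[of I] ideal_closed(1-3) scal_carrier by metis
      have "\<phi> (comb K' b' c' lam) = \<phi> (comb K b c lam)"
      proof (rule quotient_value[OF j1 j \<phi>(1,2), where x = "\<lambda>lam. scal (?d lam) * comb K b c lam"])
        show "(\<lambda>lam. \<phi> (comb K b c lam)) \<in> Aalg g n L j"
          using K by (intro linear_comb_Aalg \<phi>(1)) auto
        show "uscale g n L (?d lam) (cls g n L (comb K' b' c' lam)) =
            cls g n L (scal (?d lam) * comb K b c lam)" for lam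
          using u'(2)[of lam] eq[of lam] uscale_cls[OF comb_car] by (simp add: u'_def u_def)
      qed (use K' \<phi>(1) in \<open>auto simp: comb_car carrier_closed scal_carrier is_linear_def\<close>)
      then show False using \<phi>(3) is_linear_minus[OF \<phi>(1)] by simp
    qed
    then show "u' lam = u lam"
      unfolding u'_def u_def using cls_eq_iff[OF car' comb_car] by blast
  qed
  have quot: "f_check_quot g n L i j = u"
    unfolding f_check_quot_def
  proof (rule the_equality)
    show "u \<in> UA g n L j \<and> (\<forall>lam. uscale g n L (?d lam) (u lam) = f_check g n L i j lam)"
      using u eq by blast
  qed (use unique in blast)
  obtain z where z: "z \<in> Aalg g n L j" "\<And>lam. z lam \<noteq> 0"
    "\<And>lam. torus_eval tw (check_rep i j lam) = ?d lam * z lam"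
    using torus_eval_f_check[OF assms] by blast
  have null: "torus_eval tw x = 0" if "x \<in> I" for x
  proof -
    have "\<forall>y z. torus_eval tw (y * x * z) = 0"
      using that serre_ideal_torus_null by (auto simp: torus_kernel_def)
    from this[rule_format, of 1 1] show ?thesis by simp
  qed
  have "torus_eval tw (comb K b c lam) = z lam"
  proof (rule quotient_value[OF j1 j is_linear_torus_eval null _ z(1), where x = "check_rep i j"])
    show "b k \<in> carrier (free_ring n) \<and> c k \<in> Aalg g n L j" if "k < K" for k using K that by blast
    show "uscale g n L (?d lam) (cls g n L (comb K b c lam)) = cls g n L (check_rep i j lam)" for lam
      using eq[of lam] by (simp only: u_def f_check)
  qed (rule car z(3) | assumption)+
  then have "comb K b c lam \<notin> I" using z(2)[of lam] null[of "comb K b c lam"] by auto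
  then have "cls g n L (comb K b c lam) \<noteq> cls g n L 0"
    using cls_eq_iff[OF comb_car carrier_closed(4)] by simp
  then show ?thesis by (simp add: quot u_def cls_zero)
qed

end

theorem theorem4p4:
  fixes g :: series and n i j :: nat and q L :: complex and lam :: "nat \<Rightarrow> complex"
  assumes "simple_rank g n"
    and "q \<noteq> 0" and "\<forall>k::nat. k > 0 \<longrightarrow> q ^ k \<noteq> 1" and "exp L = q"
    and "i \<in> {1..dimN g n}" and "j \<in> {1..dimN g n}"
    and "prec g n i j" and "i \<le> prime_ix g n j"
  shows "f_check_quot g n L i j lam \<noteq> \<zero>\<^bsub>Uq g n L\<^esub>"
proof -
  interpret quantum_group g n L
    by unfold_locales (use assms in auto)
  show ?thesis by (rule f_check_quot_nonzero) (use assms in auto)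
qed

end
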